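(* Let $(T(z))_{\Re z>0}$ be a uniformly bounded holomorphic semigroup of type $HG_\beta$ for some $\beta\ge0$ on a Banach space $X$, whose restriction to $[0,\infty)$ is a $C_0$-semigroup with infinitesimal generator $-A$. (i) For $\alpha>-1$ there is $C_{\alpha,\beta}>0$ such that for all $n\ge1$ and $x\in X$, $$\|A^n(A+1)^{-n-\alpha-1}x\|\le\frac{C_{\alpha,\beta}\|x\|}{n^{\alpha+1}}.$$ (ii) For $\alpha>0$ and $t>0$ there is $C_{\alpha,\beta,t}>0$ such that for all $m\ge1$ and $x\in X$, $$\Big\|T(t)x-\sum_{n=0}^mA^n(A+1)^{-n-\alpha-1}x\,L_n^{(\alpha)}(t)\Big\|\le\frac{C_{\alpha,\beta,t}}{m^{\alpha/2}}\|x\|.$$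
   Context: A holomorphic semigroup $(T(z))_{\Re z>0}$ is of type $HG_\beta$ if for every $\nu>\beta$ there is $C_\nu>0$ with $\|T(z)\|\le C_\nu\big(\frac{|z|}{\Re z}\big)^\nu$ for all $\Re z>0$. $L_n^{(\alpha)}(t)=\sum_{k=0}^n(-1)^k\binom{n+\alpha}{n-k}\frac{t^k}{k!}$ is the generalized Laguerre polynomial. The generator is defined by $-Ax=\lim_{t\to0^+}\frac{T(t)x-x}{t}$. For $\gamma>0$, $(A+1)^{-\gamma}x:=\frac{1}{\Gamma(\gamma)}\int_0^\infty s^{\gamma-1}e^{-s}T(s)x\,ds$. *)

theory Defs
  imports "HOL-Analysis.Analysis"
begin

text \<open>A complex scalar multiplication on a (real) Banach space, compatible with the
  real structure and the norm; this turns the space into a complex Banach space.\<close>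
definition complex_scaling :: "(complex \<Rightarrow> 'a::banach \<Rightarrow> 'a) \<Rightarrow> bool" where
  "complex_scaling sc \<longleftrightarrow>
     (\<forall>a b x. sc (a + b) x = sc a x + sc b x) \<and>
     (\<forall>a x y. sc a (x + y) = sc a x + sc a y) \<and>
     (\<forall>a b x. sc (a * b) x = sc a (sc b x)) \<and>
     (\<forall>r x. sc (complex_of_real r) x = r *\<^sub>R x) \<and>
     (\<forall>a x. norm (sc a x) = cmod a * norm x)"

text \<open>Holomorphic semigroup on the open right half plane (holomorphy in the strong sense:
  every orbit is complex differentiable), consisting of bounded complex-linear operators.\<close>
definition holomorphic_semigroup ::
  "(complex \<Rightarrow> 'a::banach \<Rightarrow> 'a) \<Rightarrow> (complex \<Rightarrow> 'a \<Rightarrow> 'a) \<Rightarrow> bool" where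
  "holomorphic_semigroup sc T \<longleftrightarrow>
     (\<forall>z. Re z > 0 \<longrightarrow> bounded_linear (T z) \<and> (\<forall>c x. T z (sc c x) = sc c (T z x))) \<and>
     (\<forall>z w. Re z > 0 \<longrightarrow> Re w > 0 \<longrightarrow> T (z + w) = T z \<circ> T w) \<and>
     (\<forall>x z. Re z > 0 \<longrightarrow> (\<exists>v. ((\<lambda>w. T w x) has_derivative (\<lambda>h. sc h v)) (at z)))"

definition HG_type :: "(complex \<Rightarrow> 'a::real_normed_vector \<Rightarrow> 'a) \<Rightarrow> real \<Rightarrow> bool" where
  "HG_type T \<beta> \<longleftrightarrow>
     (\<forall>\<nu>>\<beta>. \<exists>C>0. \<forall>z x. Re z > 0 \<longrightarrow> norm (T z x) \<le> C * (cmod z / Re z) powr \<nu> * norm x)"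

definition gen_dom :: "(complex \<Rightarrow> 'a::real_normed_vector \<Rightarrow> 'a) \<Rightarrow> 'a \<Rightarrow> bool" where
  "gen_dom T x \<longleftrightarrow>
     (\<exists>y. ((\<lambda>t. (1 / t) *\<^sub>R (T (complex_of_real t) x - x)) \<longlongrightarrow> y) (at_right 0))"

definition genA :: "(complex \<Rightarrow> 'a::real_normed_vector \<Rightarrow> 'a) \<Rightarrow> 'a \<Rightarrow> 'a" where
  "genA T x = - Lim (at_right 0) (\<lambda>t. (1 / t) *\<^sub>R (T (complex_of_real t) x - x))"

definition gen_dom_pow :: "(complex \<Rightarrow> 'a::real_normed_vector \<Rightarrow> 'a) \<Rightarrow> nat \<Rightarrow> 'a \<Rightarrow> bool" where
  "gen_dom_pow T n x \<longleftrightarrow> (\<forall>k<n. gen_dom T ((genA T ^^ k) x))"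

text \<open>\<open>(A+1)^{-\<gamma>} x = 1/\<Gamma>(\<gamma>) \<integral>_0^\<infinity> s^{\<gamma>-1} e^{-s} T(s) x ds\<close>.\<close>
definition frac_res :: "(complex \<Rightarrow> 'a::real_normed_vector \<Rightarrow> 'a) \<Rightarrow> real \<Rightarrow> 'a \<Rightarrow> 'a" where
  "frac_res T \<gamma> x = (1 / Gamma \<gamma>) *\<^sub>R
     integral {0<..} (\<lambda>s. (s powr (\<gamma> - 1) * exp (- s)) *\<^sub>R T (complex_of_real s) x)"

definition laguerre :: "nat \<Rightarrow> real \<Rightarrow> real \<Rightarrow> real" where
  "laguerre n \<alpha> t = (\<Sum>k=0..n. (-1) ^ k * ((real n + \<alpha>) gchoose (n - k)) * t ^ k / fact k)"

end

theory Submission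
  imports Defs "HOL-Complex_Analysis.Complex_Analysis" "HOL-Real_Asymp.Real_Asymp"
begin

text \<open>
  Write \<open>c_n = A^n (A+1)^{-n-\<alpha>-1} x\<close>. Differentiating under the integral,
  \<open>c_n = 1/\<Gamma>(n+\<alpha>+1) \<integral>_0^\<infinity> s^{n+\<alpha>} e^{-s} A^n T(s) x ds\<close>.

  Part (i). Norming functionals reduce the estimate to the scalar function \<open>h(z) = l(T(z) x)\<close>. Up to the
  factor \<open>(n-2)!\<close>, the integral is the Taylor coefficient of order \<open>n-2\<close> at \<open>\<tau> = 1\<close> of
  \<open>\<Phi>(\<tau>) = \<integral>_0^\<infinity> s^{\<alpha>+2} e^{-s} h''(\<tau> s) ds\<close>. Rotating the path of integration by half the argument
  of \<open>\<tau>\<close> gives \<open>|\<Phi>(\<tau>)| \<le> C / |\<tau>|^2\<close> on the whole right half plane, so Cauchy's formula on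
  \<open>|\<tau> - 1| = 1 - 1/n\<close> bounds the coefficient by \<open>C n\<close>; only a bound for \<open>T\<close> in sectors is needed here.

  Part (ii). Cauchy's formula for the generating function on the circle of radius \<open>n/(n+1)\<close> gives
  \<open>|L_n(t)| \<le> C n^{\<alpha>/2}\<close>, and with (i) the series converges at the claimed rate. To identify its sum, let
  \<open>S_m(s)\<close> be the partial sum at time \<open>s\<close>. Since \<open>c_{n+1} = A c_n - A c_{n+1}\<close>, the derivative of
  \<open>s \<mapsto> T(t + e - s) S_m(s)\<close> telescopes to \<open>L_m^{(\<alpha>+1)}(s) T(t + e - s) A c_m\<close>, which is small because of
  the smoothing by \<open>T(e)\<close>; and \<open>T(t + e) S_m(0)\<close> tends to \<open>T(t + e) x\<close> by Taylor's formula. Hence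
  \<open>T(e) S_m(t)\<close> tends to \<open>T(e) T(t) x\<close> for every \<open>e > 0\<close>.
\<close>

section \<open>Norming functionals\<close>

text \<open>Why two derivatives in (i): splitting off \<open>j\<close> derivatives bounds \<Phi> by
  C / |\<tau>|^j, and the mean of |\<tau>|^(-j) over the circle is of order n^(j-1) if j >= 2, but
  log n if j = 1. So j = 2 is the least order giving the integral the size (n-1)!, that is
  n^(-\<alpha>-1) after division by Gamma(n+\<alpha>+1). In a sector |h''(z)| <= C / |z|^2, which
  turns the weight s^(\<alpha>+2) into s^\<alpha>; this is integrable at 0 because \<alpha> > -1.

  Why \<alpha>/2 in (ii): the singularity |1+w|^(-\<alpha>-1) of the generating function would alone
  give n^\<alpha>. The exponential factor contributes exp(-t a / |1+w|^2) with a = 1/(n+1), which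
  cuts the singularity off at distance sqrt a.

  Why the smoothing: near s = 0 the Laguerre factor of the telescoped derivative is as large as
  m^(\<alpha>+1), which the decay of A c_m does not outweigh. Under T(e) the integrand gains
  (s/(s+e))^m, and with e^(-s) this beats every power of m. The smoothed limit only names the sum;
  the rate comes from the tail of the series, and e tends to 0 with m fixed.\<close>

definition sublinear :: "('a::real_normed_vector \<Rightarrow> real) \<Rightarrow> bool" where
  "sublinear p \<longleftrightarrow> (\<forall>x y. p (x + y) \<le> p x + p y) \<and> (\<forall>c>0. \<forall>x. p (c *\<^sub>R x) \<le> c * p x)"

lemma sublinear_scaleR:
  assumes "sublinear p" "c > 0"
  shows "p (c *\<^sub>R x) = c * p x"
proof (rule antisym)
  show "p (c *\<^sub>R x) \<le> c * p x" using assms by (auto simp: sublinear_def)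
  have "p ((1/c) *\<^sub>R (c *\<^sub>R x)) \<le> (1/c) * p (c *\<^sub>R x)"
    using assms unfolding sublinear_def by (meson divide_pos_pos zero_less_one)
  then show "c * p x \<le> p (c *\<^sub>R x)" using assms(2) by (simp add: field_simps)
qed

lemma sublinear_zero: "sublinear p \<Longrightarrow> p 0 = 0"
  using sublinear_scaleR[of p 2 0] by simp

lemma sublinear_lower:
  assumes "sublinear p"
  shows "- p (- x) \<le> p x"
proof -
  have "p (x + - x) \<le> p x + p (- x)" using assms unfolding sublinear_def by blast
  then show ?thesis using sublinear_zero[OF assms] by simp
qed

text \<open>The descent step of the Zorn proof of Hahn-Banach: for sublinear \<open>p\<close> the
  shift is sublinear, lies below \<open>p\<close>, and takes at most the value \<open>- p y\<close>
  at \<open>- y\<close> (choose t = 1).\<close>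

definition sublinear_shift :: "('a::real_normed_vector \<Rightarrow> real) \<Rightarrow> 'a \<Rightarrow> 'a \<Rightarrow> real" where
  "sublinear_shift p y x = (INF t\<in>{0..}. p (x + t *\<^sub>R y) - t * p y)"

lemma sublinear_shift_bdd:
  assumes "sublinear p"
  shows "bdd_below ((\<lambda>t. p (x + t *\<^sub>R y) - t * p y) ` {0..})"
proof (rule bdd_belowI2)
  fix t :: real assume t: "t \<in> {0..}"
  have "t * p y = p (t *\<^sub>R y)"
    using t sublinear_scaleR[OF assms] sublinear_zero[OF assms] by (cases "t = 0") auto
  also have "p (t *\<^sub>R y) = p ((x + t *\<^sub>R y) + (- x))" by simp
  also have "\<dots> \<le> p (x + t *\<^sub>R y) + p (- x)"
    using assms unfolding sublinear_def by blast
  finally show "- p (- x) \<le> p (x + t *\<^sub>R y) - t * p y" by simp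
qed

lemma sublinear_shift_le:
  assumes "sublinear p" "t \<ge> 0"
  shows "sublinear_shift p y x \<le> p (x + t *\<^sub>R y) - t * p y"
  unfolding sublinear_shift_def
  by (rule cINF_lower[OF sublinear_shift_bdd[OF assms(1)]]) (use assms in auto)

text \<open>Parameters \<open>t\<close> and \<open>t'\<close> that are nearly optimal for the two
  summands combine to the parameter \<open>t + t'\<close> for the sum; a scalar \<open>c\<close>
  rescales \<open>t\<close> to \<open>c * t\<close>.\<close>

lemma sublinear_shift_sublinear:
  assumes "sublinear p"
  shows "sublinear (sublinear_shift p y)"
  unfolding sublinear_def
proof (intro conjI allI impI)
  fix x x'
  have "sublinear_shift p y (x + x') - (p (x' + t' *\<^sub>R y) - t' * p y) \<le> p (x + t *\<^sub>R y) - t * p y"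
    if "t \<ge> 0" "t' \<ge> 0" for t t'
  proof -
    have "sublinear_shift p y (x + x') \<le> p ((x + x') + (t + t') *\<^sub>R y) - (t + t') * p y"
      using that by (intro sublinear_shift_le assms) auto
    moreover have "p ((x + t *\<^sub>R y) + (x' + t' *\<^sub>R y)) \<le> p (x + t *\<^sub>R y) + p (x' + t' *\<^sub>R y)"
      using assms unfolding sublinear_def by blast
    ultimately show ?thesis by (simp add: algebra_simps)
  qed
  then have "sublinear_shift p y (x + x') - (p (x' + t' *\<^sub>R y) - t' * p y) \<le> sublinear_shift p y x"
    if "t' \<ge> 0" for t'
    unfolding sublinear_shift_def[of p y x] using that by (intro cINF_greatest) auto
  then have "sublinear_shift p y (x + x') - sublinear_shift p y x \<le> sublinear_shift p y x'"
    unfolding sublinear_shift_def[of p y x'] by (intro cINF_greatest) (auto simp: algebra_simps)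
  then show "sublinear_shift p y (x + x') \<le> sublinear_shift p y x + sublinear_shift p y x'" by simp
next
  fix c :: real and x assume c: "c > 0"
  have "sublinear_shift p y (c *\<^sub>R x) / c \<le> p (x + t *\<^sub>R y) - t * p y" if "t \<ge> 0" for t
  proof -
    have "sublinear_shift p y (c *\<^sub>R x) \<le> p (c *\<^sub>R x + (c * t) *\<^sub>R y) - (c * t) * p y"
      using that c by (intro sublinear_shift_le assms) auto
    also have "c *\<^sub>R x + (c * t) *\<^sub>R y = c *\<^sub>R (x + t *\<^sub>R y)" by (simp add: scaleR_add_right)
    finally have "sublinear_shift p y (c *\<^sub>R x) \<le> c * (p (x + t *\<^sub>R y) - t * p y)"
      unfolding sublinear_scaleR[OF assms c] by (simp add: algebra_simps)
    then show ?thesis using c by (simp add: pos_divide_le_eq mult.commute)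
  qed
  then have "sublinear_shift p y (c *\<^sub>R x) / c \<le> sublinear_shift p y x"
    unfolding sublinear_shift_def[of p y x] by (intro cINF_greatest) auto
  then show "sublinear_shift p y (c *\<^sub>R x) \<le> c * sublinear_shift p y x"
    using c by (simp add: field_simps)
qed

lemma sublinear_shift_le_self: "sublinear p \<Longrightarrow> sublinear_shift p y x \<le> p x"
  using sublinear_shift_le[of p 0 y x] by simp

text \<open>A minimal sublinear functional is linear: otherwise one of its shifts lies strictly below it.\<close>

lemma exists_linear_below_sublinear:
  fixes p :: "'a::real_normed_vector \<Rightarrow> real"
  assumes p: "sublinear p"
  shows "\<exists>f. linear f \<and> (\<forall>x. f x \<le> p x)"
proof -
  define S where "S = {q. sublinear q \<and> (\<forall>x. q x \<le> p x)}"
  \<comment> \<open>The order is reversed, so that the maximal element delivered by Zorn's lemma is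
    a minimal functional.\<close>
  define below where "below = (\<lambda>(q::'a \<Rightarrow> real) r. \<forall>x. r x \<le> q x)"
  \<comment> \<open>A lower bound common to all of \<open>S\<close>; it keeps the pointwise infimum
    of a chain finite.\<close>
  have lb: "- p (- x) \<le> q x" if "q \<in> S" for q x
  proof -
    have "- q (- x) \<le> q x" "q (- x) \<le> p (- x)"
      using sublinear_lower[of q x] that by (auto simp: S_def)
    then show ?thesis by linarith
  qed
  have "\<exists>m\<in>S. \<forall>a\<in>S. below m a \<longrightarrow> a = m"
  proof (rule predicate_Zorn)
    show "partial_order_on S (relation_of below S)"
      unfolding partial_order_on_def preorder_on_def refl_on_def trans_def antisym_def
        relation_of_def below_def
      by (safe; (intro ext order_antisym)?; (auto; fail | meson order_trans))
  next
    fix C assume C: "C \<in> Chains (relation_of below S)"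
    then have CS: "C \<subseteq> S" by (auto simp: Chains_def relation_of_def)
    show "\<exists>u\<in>S. \<forall>a\<in>C. below a u"
    proof (cases "C = {}")
      case True
      then show ?thesis using p by (auto simp: S_def)
    next
      case False
      define u where "u = (\<lambda>x. INF q\<in>C. q x)"
      have bd: "bdd_below ((\<lambda>q. q x) ` C)" for x
        using lb CS by (intro bdd_belowI2[where m = "- p (- x)"]) auto
      have ule: "u x \<le> q x" if "q \<in> C" for q x
        unfolding u_def using that bd by (intro cINF_lower) auto
      have "sublinear u"
        unfolding sublinear_def
      proof (intro conjI allI impI)
        fix x y
        have "u (x + y) - r y \<le> q x" if "q \<in> C" "r \<in> C" for q r
        proof -
          \<comment> \<open>Two members of a chain are comparable, and the smaller one serves both
            arguments; this makes the infimum subadditive.\<close>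
          have "\<exists>w\<in>C. w x \<le> q x \<and> w y \<le> r y"
          proof -
            have "below q r \<or> below r q"
              using C that unfolding Chains_def relation_of_def by blast
            then show ?thesis using that unfolding below_def by blast
          qed
          then obtain w where w: "w \<in> C" "w x \<le> q x" "w y \<le> r y" by blast
          have "w (x + y) \<le> w x + w y" using w(1) CS by (auto simp: S_def sublinear_def)
          then show ?thesis using ule[OF w(1), of "x + y"] w by linarith
        qed
        then have "u (x + y) - r y \<le> u x" if "r \<in> C" for r
          unfolding u_def[THEN fun_cong, of x] using that False by (intro cINF_greatest) auto
        then have "u (x + y) - u x \<le> u y"
          unfolding u_def[THEN fun_cong, of y] using False
          by (intro cINF_greatest) (auto simp: algebra_simps)
        then show "u (x + y) \<le> u x + u y" by simp
      next
        fix c :: real and x assume c: "c > 0"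
        have "u (c *\<^sub>R x) / c \<le> q x" if "q \<in> C" for q
          using ule[OF that, of "c *\<^sub>R x"] that CS sublinear_scaleR[of q c x] c
          by (auto simp: S_def field_simps)
        then have "u (c *\<^sub>R x) / c \<le> u x"
          unfolding u_def[THEN fun_cong, of x] using False by (intro cINF_greatest) auto
        then show "u (c *\<^sub>R x) \<le> c * u x" using c by (simp add: field_simps)
      qed
      moreover have "u x \<le> p x" for x
      proof -
        obtain q where q: "q \<in> C" using False by blast
        then have "q x \<le> p x" using CS by (auto simp: S_def)
        then show ?thesis using ule[OF q, of x] by linarith
      qed
      ultimately show ?thesis using ule by (auto simp: S_def below_def)
    qed
  qed
  then obtain m where m: "sublinear m" "\<And>x. m x \<le> p x"
    and min: "\<And>a. a \<in> S \<Longrightarrow> below m a \<Longrightarrow> a = m" unfolding S_def by auto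
  have eq: "sublinear_shift m y = m" for y
  proof (rule min)
    show "sublinear_shift m y \<in> S"
      using sublinear_shift_sublinear[OF m(1)] order_trans[OF sublinear_shift_le_self[OF m(1)] m(2)]
      by (simp add: S_def)
  qed (simp add: below_def sublinear_shift_le_self[OF m(1)])
  have add: "m (x + y) = m x + m y" for x y
  proof (rule antisym)
    show "m (x + y) \<le> m x + m y" using m(1) by (auto simp: sublinear_def)
    \<comment> \<open>As \<open>m\<close> equals its own shift along \<open>y\<close>, the parameter
      t = 1 gives superadditivity.\<close>
    show "m x + m y \<le> m (x + y)"
      using sublinear_shift_le[OF m(1), of 1 y x] by (simp add: eq)
  qed
  have neg: "m (- x) = - m x" for x
    using add[of x "- x"] sublinear_zero[OF m(1)] by simp
  have "m (c *\<^sub>R x) = c * m x" for c x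
  proof (cases c "0::real" rule: linorder_cases)
    case less
    then show ?thesis using sublinear_scaleR[OF m(1), of "- c" x] neg[of "c *\<^sub>R x"] by simp
  qed (use sublinear_scaleR[OF m(1), of c x] sublinear_zero[OF m(1)] in auto)
  then have "linear m" using add by (intro linearI) auto
  then show ?thesis using m(2) by blast
qed

text \<open>Starting from the shift of the norm along \<open>x0\<close> builds in the value at
  \<open>x0\<close>: that shift is at most \<open>- norm x0\<close> at \<open>- x0\<close>, hence so
  is any linear functional below it.\<close>

lemma norming_functional:
  fixes x0 :: "'a::real_normed_vector"
  shows "\<exists>f. bounded_linear f \<and> (\<forall>x. \<bar>f x\<bar> \<le> norm x) \<and> f x0 = norm x0"
proof -
  have n: "sublinear (norm :: 'a \<Rightarrow> real)"
    by (auto simp: sublinear_def norm_triangle_ineq)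
  obtain f where f: "linear f" "\<And>x. f x \<le> sublinear_shift norm x0 x"
    using exists_linear_below_sublinear[OF sublinear_shift_sublinear[OF n, of x0]] by blast
  have le: "f x \<le> norm x" for x
    using f(2)[of x] sublinear_shift_le_self[OF n, of x0 x] by linarith
  have abs: "\<bar>f x\<bar> \<le> norm x" for x
    using le[of x] le[of "- x"] linear_neg[OF f(1), of x] by simp
  have "f (- x0) \<le> norm (- x0 + 1 *\<^sub>R x0) - 1 * norm x0"
    using f(2)[of "- x0"] sublinear_shift_le[OF n, of 1 x0 "- x0"] by linarith
  then have "norm x0 \<le> f x0" using linear_neg[OF f(1), of x0] by simp
  moreover have "bounded_linear f"
    using f(1) abs by (intro bounded_linear_intro[where K = 1]) (auto simp: linear_add linear_scale)
  ultimately show ?thesis using abs le[of x0] by (intro exI[of _ f]) auto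
qed

text \<open>The usual complexification g(x) - i g(i x) of a real norming functional. The factor 2
  comes from |z| <= |Re z| + |Im z| and only enlarges later constants; the lower bound at
  \<open>x0\<close> is read off the real part.\<close>

lemma complex_norming_functional:
  fixes x0 :: "'a::banach"
  assumes sc: "complex_scaling sc"
  shows "\<exists>f :: 'a \<Rightarrow> complex. bounded_linear f \<and> (\<forall>c x. f (sc c x) = c * f x)
    \<and> (\<forall>x. norm (f x) \<le> 2 * norm x) \<and> norm x0 \<le> norm (f x0)"
proof -
  obtain g where g: "bounded_linear g" "\<And>x. \<bar>g x\<bar> \<le> norm x" "g x0 = norm x0"
    using norming_functional[of x0] by blast
  interpret g: bounded_linear g by fact
  have s: "sc (a + b) x = sc a x + sc b x" "sc a (x + y) = sc a x + sc a y"
    "sc (a * b) x = sc a (sc b x)" "sc (complex_of_real r) x = r *\<^sub>R x"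
    "norm (sc a x) = cmod a * norm x" for a b r x y
    using sc unfolding complex_scaling_def by auto
  define f where "f = (\<lambda>x. Complex (g x) (- g (sc \<i> x)))"
  have i_scale: "sc \<i> (r *\<^sub>R x) = r *\<^sub>R sc \<i> x" for r x
    using s(3)[of \<i> "of_real r" x] s(3)[of "of_real r" \<i> x] s(4) by (simp add: mult.commute)
  have ii: "sc \<i> (sc \<i> x) = - x" for x
    using s(3)[of \<i> \<i> x] s(4)[of "-1" x] by simp
  have nf: "norm (f x) \<le> 2 * norm x" for x
    using g(2)[of x] g(2)[of "sc \<i> x"] cmod_le[of "f x"] s(5)[of \<i> x] by (simp add: f_def)
  have bl: "bounded_linear f"
  proof (rule bounded_linear_intro[where K = 2])
    show "f (x + y) = f x + f y" for x y
      by (simp add: f_def complex_eq_iff s g.add)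
    show "f (r *\<^sub>R x) = r *\<^sub>R f x" for r x
      by (simp add: f_def complex_eq_iff i_scale g.scaleR)
    show "norm (f x) \<le> norm x * 2" for x using nf[of x] by simp
  qed
  have "f (sc c x) = c * f x" for c x
  proof -
    have c: "c = of_real (Re c) + \<i> * of_real (Im c)" by (simp add: complex_eq)
    have e: "sc c x = Re c *\<^sub>R x + Im c *\<^sub>R sc \<i> x"
      by (subst c) (simp only: s i_scale)
    have e2: "sc \<i> (sc c x) = Re c *\<^sub>R sc \<i> x - Im c *\<^sub>R x"
      unfolding e by (simp add: s i_scale ii)
    show ?thesis
      unfolding f_def e2 by (simp add: complex_eq_iff e g.add g.diff g.scaleR algebra_simps)
  qed
  moreover have "norm x0 \<le> norm (f x0)"
    using complex_Re_le_cmod[of "f x0"] g(3) by (simp add: f_def)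
  ultimately show ?thesis using bl nf by blast
qed

section \<open>Integrals over the half line\<close>

text \<open>The issue is the two ends. Near 0 the increments of a primitive of \<open>f\<close> are
  dominated by those of the indefinite integral of \<open>g\<close>, so the primitive is uniformly
  continuous, extends to 0, and the fundamental theorem applies. At infinity, integrability on all
  bounded intervals together with domination suffices.\<close>

lemma integrable_on_halfline_dominated:
  fixes f :: "real \<Rightarrow> 'a::banach"
  assumes cont: "continuous_on {0<..} f" and le: "\<And>s. s > 0 \<Longrightarrow> norm (f s) \<le> g s"
    and g: "g integrable_on {0<..}"
  shows "f integrable_on {0<..}"
proof -
  define f' g' where "f' = (\<lambda>s::real. if s \<in> {0<..} then f s else 0)"
    and "g' = (\<lambda>s::real. if s \<in> {0<..} then g s else 0)"
  have g'UNIV: "g' integrable_on UNIV"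
    using g unfolding g'_def integrable_restrict_UNIV .
  have le': "norm (f' s) \<le> g' s" for s using le by (auto simp: f'_def g'_def)
  have g'int: "g' integrable_on {a..b}" for a b
    using integrable_on_subcbox[OF g'UNIV, of a b] by simp
  have fint: "f integrable_on {a..b}" if "a > 0" for a b
    using that by (intro integrable_continuous_real continuous_on_subset[OF cont]) auto
  have f'0: "f' integrable_on {0..b}" if b: "b > 0" for b
  proof -
    \<comment> \<open>The primitive is normalised at \<open>b\<close>, because the integral starting
      from 0 is not yet known to exist.\<close>
    define F where "F = (\<lambda>u. - integral {u..b} f)"
    define G where "G = (\<lambda>u. integral {0..u} g')"
    have Fdiff: "norm (F v - F u) \<le> G v - G u" if "0 < u" "u \<le> v" "v \<le> b" for u v
    proof -
      have "F v - F u = integral {u..v} f"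
        using Henstock_Kurzweil_Integration.integral_combine[OF that(2,3) fint[OF that(1)]]
        by (simp add: F_def algebra_simps)
      moreover have "norm (integral {u..v} f) \<le> integral {u..v} g'"
        using that le by (intro integral_norm_bound_integral fint g'int) (auto simp: g'_def)
      moreover have "G v - G u = integral {u..v} g'"
        using Henstock_Kurzweil_Integration.integral_combine[OF _ that(2) g'int, of 0] that
        by (simp add: G_def algebra_simps)
      ultimately show ?thesis by simp
    qed
    have Fd: "dist (F v) (F u) \<le> dist (G v) (G u)" if "u \<in> {0<..b}" "v \<in> {0<..b}" for u v
      using Fdiff[of u v] Fdiff[of v u] that
      by (cases "u \<le> v") (auto simp: dist_norm norm_minus_commute)
    have "continuous_on {0..b} G"
      unfolding G_def by (rule indefinite_integral_continuous_1[OF g'int])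
    then have "uniformly_continuous_on {0..b} G"
      by (rule compact_uniformly_continuous) simp
    then have "uniformly_continuous_on {0<..b} F"
      unfolding uniformly_continuous_on_def
    proof (intro allI impI)
      fix e :: real assume e: "e > 0"
      assume "\<forall>e>0. \<exists>d>0. \<forall>x\<in>{0..b}. \<forall>x'\<in>{0..b}. dist x' x < d \<longrightarrow> dist (G x') (G x) < e"
      then obtain d where d: "d > 0"
        "\<And>x x'. x \<in> {0..b} \<Longrightarrow> x' \<in> {0..b} \<Longrightarrow> dist x' x < d \<Longrightarrow> dist (G x') (G x) < e"
        using e by metis
      show "\<exists>d>0. \<forall>x\<in>{0<..b}. \<forall>x'\<in>{0<..b}. dist x' x < d \<longrightarrow> dist (F x') (F x) < e"
      proof (intro exI[of _ d] conjI ballI impI)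
        fix x x' assume x: "x \<in> {0<..b}" "x' \<in> {0<..b}" "dist x' x < d"
        then have "dist (G x') (G x) < e" by (intro d(2)) auto
        then show "dist (F x') (F x) < e" using Fd[OF x(1,2)] by linarith
      qed fact
    qed
    from uniformly_continuous_on_extension_on_closure[OF this]
    obtain E where E: "uniformly_continuous_on (closure {0<..b}) E" "\<And>x. x \<in> {0<..b} \<Longrightarrow> F x = E x"
      by metis
    have Ec: "continuous_on {0..b} E"
      using uniformly_continuous_imp_continuous[OF E(1)] b by simp
    have "(E has_vector_derivative f' x) (at x)" if x: "x \<in> {0<..<b}" for x
    proof -
      have "((\<lambda>u. integral {x/2..u} f) has_vector_derivative f x) (at x within {x/2..b})"
        using x by (intro integral_has_vector_derivative continuous_on_subset[OF cont]) auto
      then have "((\<lambda>u. integral {x/2..u} f - integral {x/2..b} f) has_vector_derivative f x)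
          (at x within {x/2<..<b})"
        by (intro derivative_eq_intros) (auto intro: has_vector_derivative_within_subset)
      then have "((\<lambda>u. integral {x/2..u} f - integral {x/2..b} f) has_vector_derivative f x) (at x)"
        using x at_within_open[of x "{x/2<..<b}"] by simp
      moreover have eq: "integral {x/2..u} f - integral {x/2..b} f = E u" if u: "u \<in> {x/2<..<b}" for u
        using Henstock_Kurzweil_Integration.integral_combine[of "x/2" u b f] fint[of "x/2" b] E(2)[of u, symmetric] x u
        by (auto simp: F_def algebra_simps)
      ultimately have "(E has_vector_derivative f x) (at x)"
        by (elim has_vector_derivative_transform_within_open[where S = "{x/2<..<b}"])
          (use x eq in auto)
      then show ?thesis using x by (simp add: f'_def)
    qed
    then have "(f' has_integral (E b - E 0)) {0..b}"
      using b Ec by (intro fundamental_theorem_of_calculus_interior) auto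
    then show ?thesis by blast
  qed
  have "f' integrable_on UNIV"
  proof (rule integrable_on_all_intervals_UNIV[OF _ le' g'UNIV])
    fix a b :: real
    define c where "c = max (max \<bar>a\<bar> \<bar>b\<bar>) 1"
    have "(\<lambda>s. if s \<in> {0..c} then f' s else 0) integrable_on {-c..c}"
    proof -
      have "c > 0" by (simp add: c_def)
      then have "{0..c} \<inter> {-c..c} = {0..c}" by auto
      then show ?thesis using f'0[OF \<open>c > 0\<close>] by (simp only: integrable_restrict_Int)
    qed
    then have "f' integrable_on {-c..c}"
      by (rule integrable_eq) (auto simp: f'_def)
    then show "f' integrable_on cbox a b"
      unfolding cbox_interval by (rule integrable_on_subinterval) (auto simp: c_def)
  qed
  then show ?thesis unfolding f'_def integrable_restrict_UNIV .
qed

text \<open>Monotone convergence applies to \<open>g\<close>, and the error for the vector-valued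
  \<open>f\<close> is at most the error for \<open>g\<close>. This reduces half-line integrals to
  compact intervals, where Fubini and contour arguments are available.\<close>

lemma integral_halfline_LIMSEQ:
  fixes f :: "real \<Rightarrow> 'a::banach"
  assumes cont: "continuous_on {0<..} f" and le: "\<And>s. s > 0 \<Longrightarrow> norm (f s) \<le> g s"
    and g: "g integrable_on {0<..}"
  shows "(\<lambda>k. integral {1 / real (Suc k)..real (Suc k)} f) \<longlonglongrightarrow> integral {0<..} f"
proof -
  define J where "J = (\<lambda>k. {1 / real (Suc k)..real (Suc k)})"
  have J: "J k \<subseteq> {0<..}" for k
  proof -
    have "0 < 1 / real (Suc k)" by simp
    show ?thesis unfolding J_def
    proof
      fix x assume "x \<in> {1 / real (Suc k)..real (Suc k)}"
      then show "x \<in> {0<..}" using less_le_trans[OF \<open>0 < 1 / real (Suc k)\<close>, of x] by (simp only: atLeastAtMost_iff greaterThan_iff)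
    qed
  qed
  then have J2: "J k \<inter> {0<..} = J k" for k by auto
  have f: "f integrable_on {0<..}" by (rule integrable_on_halfline_dominated[OF assms])
  have fJ: "f integrable_on J k" for k
    unfolding J_def by (intro integrable_continuous_real continuous_on_subset[OF cont])
      (use J in \<open>auto simp: J_def\<close>)
  have gJ: "g integrable_on J k" for k
    unfolding J_def by (rule integrable_on_subinterval[OF g]) (use J in \<open>auto simp: J_def\<close>)
  have g0: "0 \<le> g s" if "s > 0" for s using order_trans[OF norm_ge_zero le[OF that]] .
  have r: "(\<lambda>s. if s \<in> J k then f s else 0) integrable_on {0<..}"
    "(\<lambda>s. if s \<in> J k then g s else 0) integrable_on {0<..}"
    "integral {0<..} (\<lambda>s. if s \<in> J k then f s else 0) = integral (J k) f"
    "integral {0<..} (\<lambda>s. if s \<in> J k then g s else 0) = integral (J k) g" for k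
    using fJ gJ J2 by (simp_all add: integrable_restrict_Int integral_restrict_Int)
  have "(\<lambda>k. integral {0<..} (\<lambda>s. if s \<in> J k then g s else 0)) \<longlonglongrightarrow> integral {0<..} g"
  proof (rule conjunct2[OF monotone_convergence_increasing])
    show "(\<lambda>s. if s \<in> J k then g s else 0) integrable_on {0<..}" for k by (rule r)
    show "(if s \<in> J k then g s else 0) \<le> (if s \<in> J (Suc k) then g s else 0)"
      if "s \<in> {0<..}" for k s
    proof -
      have "1 / real (Suc (Suc k)) \<le> 1 / real (Suc k)" by (simp add: field_simps)
      then show ?thesis using g0[of s] that by (auto simp: J_def)
    qed
    show "(\<lambda>k. if s \<in> J k then g s else 0) \<longlonglongrightarrow> g s" if s: "s \<in> {0<..}" for s
    proof -
      obtain k0 :: nat where k0: "real k0 \<ge> max s (1 / s)" using real_arch_simple by blast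
      have "s \<in> J k" if "k \<ge> k0" for k
      proof -
        have "real (Suc k) \<ge> s" "real (Suc k) \<ge> 1 / s" using k0 that by auto
        then show ?thesis using s by (auto simp: J_def field_simps)
      qed
      then have "eventually (\<lambda>k. (if s \<in> J k then g s else 0) = g s) sequentially"
        unfolding eventually_sequentially by auto
      then show ?thesis by (rule tendsto_eventually)
    qed
    have "\<bar>integral (J k) g\<bar> \<le> integral {0<..} g" for k
    proof -
      have "integral (J k) g \<le> integral {0<..} g"
        using g0 J by (intro integral_subset_le gJ g) auto
      moreover have "0 \<le> integral (J k) g"
        using g0 J by (intro integral_nonneg gJ) auto
      ultimately show ?thesis by simp
    qed
    then show "bounded (range (\<lambda>k. integral {0<..} (\<lambda>s. if s \<in> J k then g s else 0)))"
      unfolding r by (intro boundedI[where B = "integral {0<..} g"]) auto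
  qed
  from tendsto_diff[OF tendsto_const[of "integral {0<..} g"] this]
  have lim0: "(\<lambda>k. integral {0<..} g - integral (J k) g) \<longlonglongrightarrow> 0"
    unfolding r by simp
  have "norm (integral (J k) f - integral {0<..} f) \<le> integral {0<..} g - integral (J k) g" for k
  proof -
    have "norm (integral {0<..} (\<lambda>s. f s - (if s \<in> J k then f s else 0)))
        \<le> integral {0<..} (\<lambda>s. g s - (if s \<in> J k then g s else 0))"
      using le g0 by (intro integral_norm_bound_integral integrable_diff f g r) auto
    then show ?thesis
      by (subst (asm) (1 2) Henstock_Kurzweil_Integration.integral_diff)
        (simp_all add: f g r norm_minus_commute)
  qed
  then have "(\<lambda>k. integral (J k) f - integral {0<..} f) \<longlonglongrightarrow> 0"
    by (intro Lim_null_comparison[OF _ lim0] always_eventually) auto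
  then show ?thesis unfolding J_def by (rule LIM_zero_cancel)
qed

lemma integrable_powr_exp_halfline:
  fixes p a :: real
  assumes "p > 0" "a > 0"
  shows "(\<lambda>s. s powr (p - 1) * exp (- (a * s))) integrable_on {0<..}"
proof -
  have "(\<lambda>t. norm (complex_of_real t powr (of_real p - 1) / of_real (exp (a * t)))) integrable_on {0<..}"
    using absolutely_integrable_Gamma_integral[of "of_real p" a] assms
    unfolding absolutely_integrable_on_def by auto
  then show ?thesis
    by (rule integrable_eq)
      (simp add: norm_divide norm_powr_real_powr norm_mult norm_inverse exp_minus divide_inverse)
qed

lemma has_integral_Gamma_halfline:
  fixes p :: real
  assumes "p > 0"
  shows "((\<lambda>s. s powr (p - 1) * exp (- s)) has_integral Gamma p) {0<..}"
proof -
  have "((\<lambda>t. t powr (p - 1) / exp t) has_integral Gamma p) {0<..}"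
  proof (subst has_integral_spike_set_eq)
    show "((\<lambda>t. t powr (p - 1) / exp t) has_integral Gamma p) {0..}"
      by (rule Gamma_integral_real[OF assms])
    have e: "{0<..} - {0..} = ({}::real set)" "{0..} - {0<..} = {0::real}" by auto
    show "negligible {x \<in> {0<..} - {0::real..}. x powr (p - 1) / exp x \<noteq> 0}"
      "negligible {x \<in> {0::real..} - {0<..}. x powr (p - 1) / exp x \<noteq> 0}"
      unfolding e by (auto intro!: negligible_subset[of "{0}"])
  qed
  then show ?thesis by (simp add: exp_minus divide_inverse)
qed

section \<open>Cauchy estimates and rotation of rays\<close>

text \<open>Cauchy's formula as an integral over the real interval [0,1], so that it can be
  interchanged with an integral over \<open>s\<close> and estimated by a kernel in
  \<open>x\<close>.\<close>

lemma Cauchy_higher_deriv_circle_integral: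
  assumes f: "f holomorphic_on S" "open S" "cball z r \<subseteq> S" "r > 0"
  shows "((\<lambda>x. f (z + of_real r * cis (2 * pi * x)) / cis (2 * pi * x) ^ m) has_integral
    (deriv ^^ m) f z * of_real r ^ m / fact m) {0..1}"
proof -
  have "((\<lambda>u. f u / (u - z) ^ Suc m) has_contour_integral
      (2 * pi * \<i>) / fact m * (deriv ^^ m) f z) (circlepath z r)"
    by (rule Cauchy_has_contour_integral_higher_derivative_circlepath)
      (use f in \<open>auto intro!: holomorphic_on_imp_continuous_on holomorphic_on_subset[OF f(1)]\<close>)
  then have "((\<lambda>x. f (circlepath z r x) / (circlepath z r x - z) ^ Suc m *
      vector_derivative (circlepath z r) (at x within {0..1})) has_integral
      (2 * pi * \<i>) / fact m * (deriv ^^ m) f z) {0..1}"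
    by (simp add: has_contour_integral_def)
  then have "((\<lambda>x. f (z + of_real r * cis (2 * pi * x)) / (of_real r * cis (2 * pi * x)) ^ Suc m *
      (2 * pi * \<i> * r * cis (2 * pi * x))) has_integral
      (2 * pi * \<i>) / fact m * (deriv ^^ m) f z) {0..1}"
    by (rule has_integral_eq[rotated])
      (simp add: vector_derivative_circlepath01, simp add: circlepath cis_conv_exp mult_ac)
  then have "((\<lambda>x. of_real r ^ m / (2 * pi * \<i>) * (f (z + of_real r * cis (2 * pi * x)) / (of_real r * cis (2 * pi * x)) ^ Suc m *
      (2 * pi * \<i> * r * cis (2 * pi * x)))) has_integral
      of_real r ^ m / (2 * pi * \<i>) * ((2 * pi * \<i>) / fact m * (deriv ^^ m) f z)) {0..1}"
    by (rule has_integral_mult_right)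
  then show ?thesis
    using f(4) by (simp add: field_simps power_mult_distrib)
qed

text \<open>The squared modulus is (1-\<rho>)^2 + 4 \<rho> sin(pi y)^2, and |sin(pi y)| >= |y|. It
  measures the distance from a point of the circle to the singularity.\<close>

lemma norm_one_minus_cis_ge:
  assumes "1/2 \<le> \<rho>" "\<rho> \<le> 1" "\<bar>y\<bar> \<le> 1/2"
  shows "(1 - \<rho> + \<bar>y\<bar>) / 2 \<le> norm (1 - of_real \<rho> * cis (2 * pi * y))"
proof -
  define t where "t = pi * \<bar>y\<bar>"
  have t: "0 \<le> t" "t \<le> 2"
    using assms(3) pi_less_4 mult_mono[of pi 4 "\<bar>y\<bar>" "1/2"] by (auto simp: t_def)
  have "\<bar>sin t - (\<Sum>m<3. sin_coeff m * t ^ m)\<bar> \<le> inverse (fact 3) * \<bar>t\<bar> ^ 3"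
    by (rule Maclaurin_sin_bound)
  moreover have "(\<Sum>m<3. sin_coeff m * t ^ m) = t"
    by (simp add: eval_nat_numeral sin_coeff_def)
  moreover have "\<bar>t\<bar> ^ 3 \<le> 4 * t"
  proof -
    have "t * t \<le> 2 * 2" using t by (intro mult_mono) auto
    then show ?thesis using t mult_left_mono[of "t * t" 4 t] by (simp add: power3_eq_cube mult_ac)
  qed
  moreover have "inverse (fact 3 :: real) = 1 / 6" by (simp add: eval_nat_numeral)
  \<comment> \<open>Since t <= 2, the Taylor remainder t^3/6 is at most 2t/3.\<close>
  ultimately have "sin t \<ge> t / 3" by (auto simp: abs_if split: if_splits)
  moreover have "t \<ge> 3 * \<bar>y\<bar>" using pi_gt3 by (auto simp: t_def intro: mult_right_mono)
  ultimately have "sin t \<ge> \<bar>y\<bar>" by linarith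
  then have "(sin t)\<^sup>2 \<ge> y\<^sup>2" by (metis abs_ge_zero power2_abs power_mono)
  moreover have "(sin t)\<^sup>2 = (sin (pi * y))\<^sup>2" by (auto simp: t_def abs_if)
  ultimately have s: "(sin (pi * y))\<^sup>2 \<ge> y\<^sup>2" by simp
  have c: "cos (2 * pi * y) = 1 - 2 * (sin (pi * y))\<^sup>2"
    using cos_double_sin[of "pi * y"] by (simp add: mult_ac)
  have "(norm (1 - of_real \<rho> * cis (2 * pi * y)))\<^sup>2 = (1 - \<rho> * cos (2 * pi * y))\<^sup>2 + (\<rho> * sin (2 * pi * y))\<^sup>2"
    by (simp add: cmod_power2)
  also have "\<dots> = 1 - 2 * \<rho> * cos (2 * pi * y) + \<rho>\<^sup>2 * ((cos (2 * pi * y))\<^sup>2 + (sin (2 * pi * y))\<^sup>2)"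
    by (simp only: power2_eq_square ring_distribs) (simp add: mult_ac)
  also have "\<dots> = (1 - \<rho>)\<^sup>2 + 4 * \<rho> * (sin (pi * y))\<^sup>2"
    unfolding sin_cos_squared_add2 unfolding c by (simp add: power2_eq_square algebra_simps)
  finally have n: "(norm (1 - of_real \<rho> * cis (2 * pi * y)))\<^sup>2 = (1 - \<rho>)\<^sup>2 + 4 * \<rho> * (sin (pi * y))\<^sup>2" .
  have "1 * y\<^sup>2 \<le> (4 * \<rho>) * (sin (pi * y))\<^sup>2"
    using s assms by (intro mult_mono) auto
  moreover have "((1 - \<rho> + \<bar>y\<bar>) / 2)\<^sup>2 \<le> (1 - \<rho>)\<^sup>2 + y\<^sup>2"
  proof -
    have "(u + v)\<^sup>2 \<le> 4 * (u\<^sup>2 + v\<^sup>2)" for u v :: real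
    proof -
      have "(u + v)\<^sup>2 \<le> 2 * (u\<^sup>2 + v\<^sup>2)" using sum_squares_bound[of u v] by (simp add: power2_sum)
      also have "\<dots> \<le> 4 * (u\<^sup>2 + v\<^sup>2)" by (rule mult_right_mono) auto
      finally show ?thesis .
    qed
    from this[of "1 - \<rho>" "\<bar>y\<bar>"] show ?thesis by (simp add: power_divide)
  qed
  ultimately have "((1 - \<rho> + \<bar>y\<bar>) / 2)\<^sup>2 \<le> (norm (1 - of_real \<rho> * cis (2 * pi * y)))\<^sup>2"
    unfolding n by linarith
  then show ?thesis by (rule power2_le_imp_le) simp
qed

text \<open>Turns pointwise bounds by a distance to the singularity into powers of \<open>n\<close>:
  used with p = 2 and a = 1/n for the coefficients, and with p = \<alpha>+1 and a = (n+1)^(-1/2) for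
  the Laguerre polynomials.\<close>

lemma integral_powr_kernel_le:
  fixes a c p :: real
  assumes "a > 0" "p > 1" "0 \<le> c" "c \<le> 1"
  shows "(\<lambda>x. (a + \<bar>x - c\<bar>) powr - p) integrable_on {0..1}"
    and "integral {0..1} (\<lambda>x. (a + \<bar>x - c\<bar>) powr - p) \<le> 2 * a powr (1 - p) / (p - 1)"
proof -
  define q where "q = p - 1"
  have q: "q > 0" "p = q + 1" using assms by (auto simp: q_def)
  have 1: "((\<lambda>x. (a + \<bar>x - c\<bar>) powr - p) has_integral (- ((a + (1 - c)) powr - q) / q - (- (a powr - q) / q))) {c..1}"
  proof -
    have "((\<lambda>x. (a + (x - c)) powr - p) has_integral
        ((- ((a + (1 - c)) powr - q) / q) - (- ((a + (c - c)) powr - q) / q))) {c..1}"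
      by (rule fundamental_theorem_of_calculus[OF assms(4)])
        (use assms q in \<open>auto simp: q(2) has_real_derivative_iff_has_vector_derivative[symmetric]
          intro!: derivative_eq_intros\<close>)
    then have "((\<lambda>x. (a + (x - c)) powr - p) has_integral (- ((a + (1 - c)) powr - q) / q - (- (a powr - q) / q))) {c..1}"
      by simp
    then show ?thesis by (rule has_integral_eq[rotated]) auto
  qed
  have 2: "((\<lambda>x. (a + \<bar>x - c\<bar>) powr - p) has_integral (a powr - q) / q - ((a + c) powr - q) / q) {0..c}"
  proof -
    have "((\<lambda>x. (a + (c - x)) powr - p) has_integral
        (((a + (c - c)) powr - q) / q - ((a + (c - 0)) powr - q) / q)) {0..c}"
      by (rule fundamental_theorem_of_calculus[OF assms(3)])
        (use assms q in \<open>auto simp: q(2) has_real_derivative_iff_has_vector_derivative[symmetric]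
          intro!: derivative_eq_intros\<close>)
    then have "((\<lambda>x. (a + (c - x)) powr - p) has_integral (a powr - q) / q - ((a + c) powr - q) / q) {0..c}"
      by simp
    then show ?thesis by (rule has_integral_eq[rotated]) auto
  qed
  have 3: "((\<lambda>x. (a + \<bar>x - c\<bar>) powr - p) has_integral
      ((a powr - q) / q - ((a + c) powr - q) / q) + (- ((a + (1 - c)) powr - q) / q - (- (a powr - q) / q))) {0..1}"
    by (rule has_integral_combine[OF assms(3,4) 2 1])
  then show "(\<lambda>x. (a + \<bar>x - c\<bar>) powr - p) integrable_on {0..1}" by blast
  have "0 \<le> (a + c) powr - q / q" "0 \<le> (a + (1 - c)) powr - q / q" using q by auto
  moreover have "2 * a powr (1 - p) / (p - 1) = a powr - q / q + a powr - q / q" by (simp add: q_def)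
  ultimately show "integral {0..1} (\<lambda>x. (a + \<bar>x - c\<bar>) powr - p) \<le> 2 * a powr (1 - p) / (p - 1)"
    using integral_unique[OF 3] by simp
qed

text \<open>The difference of the integrals along two rays of a convex cone is controlled by the values
  of the integrand on the two segments joining the rays, via a primitive on the cone.\<close>

lemma ray_integral_rotation:
  fixes F :: "complex \<Rightarrow> complex"
  assumes F: "F holomorphic_on S" and S: "convex S" "open S"
    and cone: "\<And>r u. r > 0 \<Longrightarrow> u \<in> S \<Longrightarrow> of_real r * u \<in> S"
    and ab: "a \<in> S" "b \<in> S" and dR: "0 < d" "d \<le> R"
    and bR: "\<And>u. u \<in> closed_segment a b \<Longrightarrow> norm (F (of_real R * u)) \<le> BR"
    and bd: "\<And>u. u \<in> closed_segment a b \<Longrightarrow> norm (F (of_real d * u)) \<le> Bd"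
  shows "norm (integral {d..R} (\<lambda>r. F (of_real r * a) * a) - integral {d..R} (\<lambda>r. F (of_real r * b) * b))
    \<le> norm (a - b) * (R * BR + d * Bd)"
proof -
  obtain P where P: "\<And>x. x \<in> S \<Longrightarrow> (P has_field_derivative F x) (at x within S)"
    using holomorphic_convex_primitive'[OF S F] by blast
  have ray: "integral {d..R} (\<lambda>r. F (of_real r * u) * u) = P (of_real R * u) - P (of_real d * u)"
    if u: "u \<in> S" for u
  proof (rule integral_unique, rule fundamental_theorem_of_calculus[OF dR(2)])
    fix r assume "r \<in> {d..R}"
    then have rS: "of_real r * u \<in> S" using cone u dR by auto
    have "(P has_field_derivative F (of_real r * u)) (at (of_real r * u))"
      using P[OF rS] unfolding at_within_open[OF rS S(2)] .
    moreover have "((\<lambda>r. of_real r * u) has_vector_derivative u) (at r within {d..R})"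
      by (auto intro!: derivative_eq_intros)
    ultimately have "((P \<circ> (\<lambda>r. of_real r * u)) has_vector_derivative (u * F (of_real r * u))) (at r within {d..R})"
      by (intro field_vector_diff_chain_within) (auto intro: has_field_derivative_at_within)
    then show "((\<lambda>r. P (of_real r * u)) has_vector_derivative F (of_real r * u) * u) (at r within {d..R})"
      by (simp add: o_def mult.commute)
  qed
  have seg: "norm (P (of_real r * a) - P (of_real r * b)) \<le> B * (r * norm (a - b))"
    if r: "r > 0" and B: "\<And>u. u \<in> closed_segment a b \<Longrightarrow> norm (F (of_real r * u)) \<le> B" for r B
  proof -
    have eq: "closed_segment (of_real r * a) (of_real r * b) = (\<lambda>u. of_real r * u) ` closed_segment a b"
      by (rule closed_segment_linear_image) (auto intro!: linearI simp: algebra_simps)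
    have sub: "closed_segment a b \<subseteq> S" by (rule closed_segment_subset[OF ab S(1)])
    have "norm (P (of_real r * a) - P (of_real r * b)) \<le> B * norm (of_real r * a - of_real r * b)"
    proof (rule field_differentiable_bound)
      show "convex (closed_segment (of_real r * a) (of_real r * b))" by simp
      fix z assume "z \<in> closed_segment (of_real r * a) (of_real r * b)"
      then obtain u where u: "u \<in> closed_segment a b" "z = of_real r * u" unfolding eq by blast
      then have zS: "z \<in> S" using cone r sub by auto
      show "norm (F z) \<le> B" using B u by auto
      show "(P has_field_derivative F z) (at z within closed_segment (of_real r * a) (of_real r * b))"
        using P[OF zS] by (rule DERIV_subset) (use eq cone r sub in auto)
    qed auto
    also have "of_real r * a - of_real r * b = of_real r * (a - b)" by (simp add: algebra_simps)
    finally show ?thesis using r by (simp add: norm_mult mult_ac)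
  qed
  have "norm (integral {d..R} (\<lambda>r. F (of_real r * a) * a) - integral {d..R} (\<lambda>r. F (of_real r * b) * b))
    = norm ((P (of_real R * a) - P (of_real R * b)) - (P (of_real d * a) - P (of_real d * b)))"
    unfolding ray[OF ab(1)] ray[OF ab(2)] by (simp add: algebra_simps)
  also have "\<dots> \<le> BR * (R * norm (a - b)) + Bd * (d * norm (a - b))"
    using dR by (intro order_trans[OF norm_triangle_ineq4] add_mono seg bR bd) auto
  finally show ?thesis by (simp add: algebra_simps)
qed

text \<open>Cauchy's inequality on the disc of radius c|z|/2: there Re w >= c|z|/2 and |w| <=
  3|z|/2, so |w| / Re w <= 3/c.\<close>

lemma higher_deriv_cone_bound:
  assumes h: "h holomorphic_on {z. Re z > 0}"
    and bnd: "\<And>z. Re z > 0 \<Longrightarrow> norm (h z) \<le> B * (norm z / Re z) ^ N"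
    and c: "0 < c" "c \<le> 1" and z: "z \<noteq> 0" "Re z \<ge> c * norm z"
  shows "norm ((deriv ^^ k) h z) \<le> fact k * (B * (3 / c) ^ N) / (c * norm z / 2) ^ k"
proof -
  define r where "r = c * norm z / 2"
  have r: "r > 0" "2 * r \<le> norm z" using c z by (auto simp: r_def mult_left_le_one_le)
  have B: "B \<ge> 0" using order_trans[OF norm_ge_zero bnd[of 1]] by simp
  have re: "Re w \<ge> r" if "norm (z - w) \<le> r" for w
    using abs_Re_le_cmod[of "z - w"] that z(2) by (simp add: r_def)
  have sub: "cball z r \<subseteq> {z. Re z > 0}"
    using re r(1) by (fastforce simp: dist_norm)
  show ?thesis
    unfolding r_def[symmetric]
  proof (rule Cauchy_inequality)
    show "h holomorphic_on ball z r"
      using sub ball_subset_cball[of z r] by (intro holomorphic_on_subset[OF h]) blast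
    show "continuous_on (cball z r) h"
      using sub by (intro holomorphic_on_imp_continuous_on holomorphic_on_subset[OF h]) auto
    fix w assume w: "norm (z - w) = r"
    have "norm w \<le> norm z + r" using norm_triangle_ineq4[of z "z - w"] w by simp
    also have "\<dots> \<le> 3 / c * r" using r(2) c by (simp add: r_def field_simps)
    also have "\<dots> \<le> 3 / c * Re w" using re[of w] w c by (intro mult_left_mono) auto
    finally have q: "norm w / Re w \<le> 3 / c" using re[of w] w r by (simp add: divide_le_eq)
    have "norm (h w) \<le> B * (norm w / Re w) ^ N" using re[of w] w r by (intro bnd) auto
    also have "\<dots> \<le> B * (3 / c) ^ N"
      using q B re[of w] w r by (intro mult_left_mono power_mono) auto
    finally show "norm (h w) \<le> B * (3 / c) ^ N" .
  qed (use r in auto)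
qed

text \<open>The ray is rotated by half the argument of \<open>\<tau>\<close>: the points \<open>s\<close> and \<open>\<tau> s\<close> then both stay in the
  sector of half angle \<open>\<pi>/4\<close>, uniformly in \<open>\<tau>\<close>.\<close>

lemma rotated_second_deriv_bound:
  fixes \<alpha> :: real
  assumes \<alpha>: "\<alpha> > -1"
    and h: "h holomorphic_on {z. Re z > 0}"
    and bnd: "\<And>z. Re z > 0 \<Longrightarrow> norm (h z) \<le> B * (norm z / Re z) ^ N"
    and \<tau>: "Re \<tau> \<ge> \<eta>" "norm \<tau> \<le> 2" and \<eta>: "\<eta> > 0"
    and dR: "0 < d" "d \<le> R"
    and D: "D = 512 * B * (12 / \<eta>) ^ N / \<eta> ^ 4"
  shows "norm (integral {d..R} (\<lambda>s. of_real (s powr (\<alpha> + 2) * exp (- s)) * (deriv ^^ 2) h (\<tau> * of_real s)))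
    \<le> 32 * 6 ^ N * B * integral {0<..} (\<lambda>r. r powr \<alpha> * exp (- (1 / 2 * r))) / (norm \<tau>)\<^sup>2
      + 2 * D * (R powr (\<alpha> + 1) * exp (- R / 2) + d powr (\<alpha> + 1))"
proof -
  define h2 where "h2 = (deriv ^^ 2) h"
  \<comment> \<open>The convex cone on which both the weight and h''(\<tau> s) are holomorphic; it
    contains the original direction 1 and the rotated direction \<open>b\<close>.\<close>
  define S where "S = {s. 0 < Re s \<and> 0 < Re (\<tau> * s)}"
  define F where "F = (\<lambda>s. s powr of_real (\<alpha> + 2) * exp (- s) * h2 (\<tau> * s))"
  define \<sigma> where "\<sigma> = csqrt \<tau>"
  \<comment> \<open>If \<tau> has argument \<theta>, then \<open>b\<close> has argument -\<theta>/2
    and \<tau> b has argument \<theta>/2.\<close>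
  define b where "b = cnj \<sigma> / of_real (norm \<sigma>)"
  define G where "G = integral {0<..} (\<lambda>r. r powr \<alpha> * exp (- (1 / 2 * r)))"
  have B: "B \<ge> 0" using order_trans[OF norm_ge_zero bnd[of 1]] by simp
  have D0: "D \<ge> 0" using D B \<eta> by simp
  have \<tau>0: "Re \<tau> > 0" "\<tau> \<noteq> 0" using \<tau> \<eta> by auto
  have \<eta>2: "\<eta> \<le> 2" using \<tau> complex_Re_le_cmod[of \<tau>] by linarith
  have sq: "\<sigma> * \<sigma> = \<tau>" using power2_csqrt[of \<tau>] by (simp add: \<sigma>_def power2_eq_square)
  have \<sigma>0: "\<sigma> \<noteq> 0" using sq \<tau>0 by auto
  have "Re \<tau> = (Re \<sigma>)\<^sup>2 - (Im \<sigma>)\<^sup>2" unfolding sq[symmetric] by (simp add: power2_eq_square)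
  then have "(Im \<sigma>)\<^sup>2 \<le> (Re \<sigma>)\<^sup>2" using \<tau>0 by simp
  then have "\<bar>Im \<sigma>\<bar> \<le> Re \<sigma>" using Re_csqrt[of \<tau>] by (metis \<sigma>_def abs_le_square_iff abs_of_nonneg)
  then have Re\<sigma>: "norm \<sigma> \<le> 2 * Re \<sigma>" using cmod_le[of \<sigma>] by simp
  have nb: "norm b = 1" using \<sigma>0 by (simp add: b_def norm_divide)
  have Reb: "Re b \<ge> 1 / 2" using Re\<sigma> \<sigma>0 by (simp add: b_def field_simps)
  have \<tau>b: "\<tau> * b = of_real (norm \<sigma>) * \<sigma>"
  proof -
    have "\<tau> * b = \<sigma> * (\<sigma> * cnj \<sigma>) / of_real (norm \<sigma>)" by (simp add: b_def sq[symmetric])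
    also have "\<sigma> * cnj \<sigma> = of_real (norm \<sigma>) * of_real (norm \<sigma>)"
      by (simp add: complex_norm_square[symmetric] power2_eq_square[symmetric])
    finally show ?thesis using \<sigma>0 by simp
  qed
  have n\<tau>: "norm \<tau> = norm \<sigma> * norm \<sigma>" unfolding sq[symmetric] by (simp add: norm_mult)
  have Re\<tau>b: "Re (\<tau> * b) \<ge> norm \<tau> / 2"
    unfolding \<tau>b n\<tau> using Re\<sigma> mult_left_mono[OF Re\<sigma>, of "norm \<sigma>"] by simp
  have S_eq: "S = {s. inner 1 s > 0} \<inter> {s. inner (cnj \<tau>) s > 0}"
    by (auto simp: S_def inner_complex_def)
  have S: "convex S" "open S"
    unfolding S_eq by (intro convex_Int convex_halfspace_gt open_Int open_halfspace_gt)+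
  have h2: "h2 holomorphic_on {z. Re z > 0}"
    unfolding h2_def by (intro holomorphic_higher_deriv h open_halfspace_Re_gt)
  have F_hol: "F holomorphic_on S"
    unfolding F_def
    by (intro holomorphic_intros holomorphic_on_compose_gen[OF _ h2, unfolded o_def])
      (auto simp: S_def complex_nonpos_Reals_iff)
  have h2b: "norm (h2 z) \<le> 2 * (B * (3 / c) ^ N) / (c * x / 2)\<^sup>2"
    if "0 < c" "c \<le> 1" "Re z \<ge> c * norm z" "0 < x" "x \<le> norm z" for c z x
  proof -
    have "norm (h2 z) \<le> fact 2 * (B * (3 / c) ^ N) / (c * norm z / 2) ^ 2"
      unfolding h2_def using that by (intro higher_deriv_cone_bound[OF h bnd]) auto
    also have "\<dots> \<le> fact 2 * (B * (3 / c) ^ N) / (c * x / 2)\<^sup>2"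
      using that B by (intro divide_left_mono power_mono) (auto intro!: mult_pos_pos)
    finally show ?thesis by simp
  qed
  have F_norm: "norm (F (of_real r * u)) \<le> r powr (\<alpha> + 2) * exp (- r / 2) * norm (h2 (\<tau> * (of_real r * u)))"
    if "r > 0" "norm u \<le> 1" "Re u \<ge> 1 / 2" for r u
  proof -
    have "norm ((of_real r * u) powr of_real (\<alpha> + 2)) = (r * norm u) powr (\<alpha> + 2)"
      using that by (subst norm_powr_real_powr') (auto simp: norm_mult)
    also have "\<dots> \<le> r powr (\<alpha> + 2)"
      using that \<alpha> by (intro powr_mono2) (auto simp: mult_left_le)
    finally have 1: "norm ((of_real r * u) powr of_real (\<alpha> + 2)) \<le> r powr (\<alpha> + 2)" .
    have "norm (exp (- (of_real r * u))) = exp (- (r * Re u))" by simp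
    also have "\<dots> \<le> exp (- r / 2)"
      using mult_left_mono[OF that(3), of r] that(1) by simp
    finally have 2: "norm (exp (- (of_real r * u))) \<le> exp (- r / 2)" .
    show ?thesis unfolding F_def norm_mult by (intro mult_mono 1 2) auto
  qed
  \<comment> \<open>On the joining segments only the aperture \<eta>/4 is available, so
    \<open>D\<close> degenerates with \<eta>. This is harmless: \<open>seg\<close> enters only the
    boundary terms at radii \<open>d\<close> and \<open>R\<close>, which vanish in the
    limit.\<close>
  have seg: "norm (F (of_real r * u)) \<le> D * r powr \<alpha> * exp (- r / 2)"
    if u: "u \<in> closed_segment 1 b" and r: "r > 0" for u r
  proof -
    obtain v where v: "0 \<le> v" "v \<le> 1" "u = (1 - v) *\<^sub>R 1 + v *\<^sub>R b" using u by (auto simp: in_segment)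
    have nu: "norm u \<le> 1"
    proof -
      have "norm u \<le> norm ((1 - v) *\<^sub>R (1::complex)) + norm (v *\<^sub>R b)"
        unfolding v(3) by (rule norm_triangle_ineq)
      then show ?thesis using v nb by simp
    qed
    have Reu: "Re u \<ge> 1 / 2"
    proof -
      have "Re u = (1 - v) + v * Re b" by (simp add: v(3))
      moreover have "v * Re b \<ge> v * (1/2)" using v Reb by (intro mult_left_mono) auto
      ultimately show ?thesis using v by linarith
    qed
    have Re\<tau>u: "Re (\<tau> * u) \<ge> \<eta> / 2"
    proof -
      have "\<tau> * u = (1 - v) *\<^sub>R \<tau> + v *\<^sub>R (\<tau> * b)" by (simp add: v(3) scaleR_conv_of_real algebra_simps)
      then have "Re (\<tau> * u) = (1 - v) * Re \<tau> + v * Re (\<tau> * b)"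
        by (simp only: plus_complex.simps scaleR_complex.simps)
      moreover have "(1 - v) * Re \<tau> \<ge> (1 - v) * (\<eta> / 2)" using v \<tau> \<eta> by (intro mult_left_mono) auto
      moreover have "v * Re (\<tau> * b) \<ge> v * (\<eta> / 2)"
        using v \<tau> Re\<tau>b complex_Re_le_cmod[of \<tau>] by (intro mult_left_mono) auto
      moreover have "(1 - v) * (\<eta> / 2) + v * (\<eta> / 2) = \<eta> / 2" by (simp add: field_simps)
      ultimately show ?thesis by linarith
    qed
    define z where "z = \<tau> * (of_real r * u)"
    have z: "z = of_real r * (\<tau> * u)" by (simp add: z_def)
    have Rez: "Re z \<ge> r * (\<eta> / 2)" unfolding z using Re\<tau>u r by simp
    have "norm z = r * (norm \<tau> * norm u)" using r by (simp add: z norm_mult)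
    also have "\<dots> \<le> r * (2 * 1)" using r \<tau> nu by (intro mult_left_mono mult_mono) auto
    finally have nz: "norm z \<le> r * 2" by simp
    have "\<eta> / 4 * norm z \<le> \<eta> / 4 * (r * 2)" using nz \<eta> by (intro mult_left_mono) auto
    then have "Re z \<ge> \<eta> / 4 * norm z" using Rez by (simp add: field_simps)
    moreover have "r * (\<eta> / 2) \<le> norm z" using Rez complex_Re_le_cmod[of z] by linarith
    ultimately have "norm (h2 z) \<le> 2 * (B * (3 / (\<eta> / 4)) ^ N) / ((\<eta> / 4) * (r * (\<eta> / 2)) / 2)\<^sup>2"
      using \<eta> \<eta>2 r by (intro h2b) auto
    also have "\<dots> = D / r\<^sup>2"
      using \<eta> r unfolding D by (simp add: field_simps power2_eq_square power4_eq_xxxx)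
    finally have hz: "norm (h2 z) \<le> D / r\<^sup>2" .
    have "norm (F (of_real r * u)) \<le> r powr (\<alpha> + 2) * exp (- r / 2) * norm (h2 z)"
      unfolding z_def by (rule F_norm[OF r nu Reu])
    also have "\<dots> \<le> r powr (\<alpha> + 2) * exp (- r / 2) * (D / r\<^sup>2)"
      using hz by (intro mult_left_mono) auto
    also have "\<dots> = D * r powr \<alpha> * exp (- r / 2)"
      using r by (simp add: powr_add powr_numeral field_simps)
    finally show ?thesis .
  qed
  have inS: "1 \<in> S" "b \<in> S"
  proof -
    have "0 < norm \<tau> / 2" using \<tau>0 by simp
    then have "0 < Re (\<tau> * b)" using Re\<tau>b by (rule less_le_trans)
    then show "1 \<in> S" "b \<in> S" using \<tau>0 Reb unfolding S_def by auto
  qed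
  have Re_scale: "Re (of_real r * w) = r * Re w" for r w by simp
  have cone: "of_real r * u \<in> S" if "r > 0" "u \<in> S" for r u
  proof -
    have "\<tau> * (of_real r * u) = of_real r * (\<tau> * u)" by (simp only: mult.left_commute)
    then have "Re (\<tau> * (of_real r * u)) = r * Re (\<tau> * u)" by (simp only: Re_scale)
    then show ?thesis using that unfolding S_def by (simp only: mem_Collect_eq Re_scale zero_less_mult_iff) simp
  qed
  have rot: "norm (integral {d..R} (\<lambda>r. F (of_real r * 1) * 1) - integral {d..R} (\<lambda>r. F (of_real r * b) * b))
      \<le> norm (1 - b) * (R * (D * R powr \<alpha> * exp (- R / 2)) + d * (D * d powr \<alpha> * exp (- d / 2)))"
    by (rule ray_integral_rotation[OF F_hol S cone inS dR]) (use seg dR in auto)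
  have b2: "norm (integral {d..R} (\<lambda>r. F (of_real r * b) * b)) \<le> 32 * 6 ^ N * B / (norm \<tau>)\<^sup>2 * G"
  proof -
    have ii: "(\<lambda>r. r powr \<alpha> * exp (- (1 / 2 * r))) integrable_on {0<..}"
      using integrable_powr_exp_halfline[of "\<alpha> + 1" "1 / 2"] \<alpha> by simp
    have ii': "(\<lambda>r. r powr \<alpha> * exp (- (1 / 2 * r))) integrable_on {d..R}"
      by (rule integrable_on_subinterval[OF ii]) (use dR in auto)
    have "norm (integral {d..R} (\<lambda>r. F (of_real r * b) * b))
      \<le> integral {d..R} (\<lambda>r. 32 * 6 ^ N * B / (norm \<tau>)\<^sup>2 * (r powr \<alpha> * exp (- (1 / 2 * r))))"
    proof (rule integral_norm_bound_integral)
      show "(\<lambda>r. F (of_real r * b) * b) integrable_on {d..R}"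
      proof (intro integrable_continuous_real continuous_intros)
        show "continuous_on {d..R} (\<lambda>r. F (of_real r * b))"
        proof (rule continuous_on_compose2[OF holomorphic_on_imp_continuous_on[OF F_hol]])
          show "(\<lambda>r. of_real r * b) ` {d..R} \<subseteq> S"
            using dR inS(2) by (auto intro!: cone)
        qed (intro continuous_intros)
      qed
      show "(\<lambda>r. 32 * 6 ^ N * B / (norm \<tau>)\<^sup>2 * (r powr \<alpha> * exp (- (1 / 2 * r)))) integrable_on {d..R}"
        by (rule integrable_on_mult_right[OF ii'])
      fix r assume "r \<in> {d..R}"
      then have r: "r > 0" using dR by auto
      define z where "z = \<tau> * (of_real r * b)"
      have z: "z = of_real r * (\<tau> * b)" by (simp add: z_def)
      have nz: "norm z = r * norm \<tau>" using r nb by (simp add: z norm_mult)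
      have "Re z \<ge> 1 / 2 * norm z" unfolding nz unfolding z Re_scale
        using mult_left_mono[OF Re\<tau>b, of r] r by simp
      \<comment> \<open>On the rotated ray the aperture is 1/2 for every \<tau>. This gives the
        constant 32 * 6^N, independent of \<eta>, in the term that survives.\<close>
      then have "norm (h2 z) \<le> 2 * (B * (3 / (1 / 2)) ^ N) / (1 / 2 * (r * norm \<tau>) / 2)\<^sup>2"
        using r \<tau>0 nz by (intro h2b) auto
      also have "\<dots> = 32 * 6 ^ N * B / (norm \<tau>)\<^sup>2 / r\<^sup>2" by (simp add: field_simps power2_eq_square)
      finally have hz: "norm (h2 z) \<le> 32 * 6 ^ N * B / (norm \<tau>)\<^sup>2 / r\<^sup>2" .
      have "norm (F (of_real r * b) * b) \<le> r powr (\<alpha> + 2) * exp (- r / 2) * norm (h2 z)"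
        using F_norm[OF r _ Reb] nb by (simp add: norm_mult z_def)
      also have "\<dots> \<le> r powr (\<alpha> + 2) * exp (- r / 2) * (32 * 6 ^ N * B / (norm \<tau>)\<^sup>2 / r\<^sup>2)"
        using hz by (intro mult_left_mono) auto
      also have "\<dots> = 32 * 6 ^ N * B / (norm \<tau>)\<^sup>2 * (r powr \<alpha> * exp (- (1 / 2 * r)))"
        using r by (simp add: powr_add powr_numeral field_simps)
      finally show "norm (F (of_real r * b) * b) \<le> 32 * 6 ^ N * B / (norm \<tau>)\<^sup>2 * (r powr \<alpha> * exp (- (1 / 2 * r)))" .
    qed
    also have "\<dots> = 32 * 6 ^ N * B / (norm \<tau>)\<^sup>2 * integral {d..R} (\<lambda>r. r powr \<alpha> * exp (- (1 / 2 * r)))"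
      by simp
    also have "\<dots> \<le> 32 * 6 ^ N * B / (norm \<tau>)\<^sup>2 * G"
      unfolding G_def using dR B by (intro mult_left_mono integral_subset_le ii ii') auto
    finally show ?thesis .
  qed
  have "norm (1 - b) \<le> 2" using norm_triangle_ineq4[of 1 b] nb by simp
  then have "norm (1 - b) * (R * (D * R powr \<alpha> * exp (- R / 2)) + d * (D * d powr \<alpha> * exp (- d / 2)))
    \<le> 2 * (R * (D * R powr \<alpha> * exp (- R / 2)) + d * (D * d powr \<alpha> * exp (- d / 2)))"
    using D0 dR by (intro mult_right_mono) auto
  also have "\<dots> = 2 * D * (R powr (\<alpha> + 1) * exp (- R / 2) + d powr (\<alpha> + 1) * exp (- d / 2))"
    using dR by (simp add: powr_add algebra_simps)
  also have "\<dots> \<le> 2 * D * (R powr (\<alpha> + 1) * exp (- R / 2) + d powr (\<alpha> + 1))"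
    using D0 dR by (intro mult_left_mono add_left_mono) (auto simp: mult_left_le)
  finally have e2: "norm (1 - b) * (R * (D * R powr \<alpha> * exp (- R / 2)) + d * (D * d powr \<alpha> * exp (- d / 2)))
    \<le> 2 * D * (R powr (\<alpha> + 1) * exp (- R / 2) + d powr (\<alpha> + 1))" .
  have "integral {d..R} (\<lambda>s. of_real (s powr (\<alpha> + 2) * exp (- s)) * h2 (\<tau> * of_real s))
      = integral {d..R} (\<lambda>r. F (of_real r * 1) * 1)"
  proof (rule Henstock_Kurzweil_Integration.integral_cong)
    fix s assume "s \<in> {d..R}"
    then have "of_real s powr of_real (\<alpha> + 2) = complex_of_real (s powr (\<alpha> + 2))"
      using dR by (intro powr_of_real) auto
    then show "of_real (s powr (\<alpha> + 2) * exp (- s)) * h2 (\<tau> * of_real s) = F (of_real s * 1) * 1"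
      by (simp add: F_def exp_of_real[symmetric])
  qed
  then show ?thesis
    unfolding h2_def[symmetric] G_def[symmetric] using rot b2 e2
    by (smt (verit) norm_triangle_ineq2 times_divide_eq_left)
qed

text \<open>\<open>C\<close> is fixed before \<open>h\<close>, \<open>B\<close> and
  \<open>n\<close>, so one constant serves all functionals. The boundary terms of the rotation go
  into \<open>err\<close>; they may depend badly on \<open>n\<close>, since \<open>k\<close> tends
  to infinity with \<open>n\<close> fixed. The truncation to compact intervals permits exchanging
  the integrals over \<open>s\<close> and over the circle.\<close>

lemma weighted_higher_deriv_bound:
  fixes \<alpha> :: real and N :: nat
  assumes \<alpha>: "\<alpha> > -1"
  shows "\<exists>C\<ge>0. \<forall>h B n. h holomorphic_on {z. Re z > 0} \<longrightarrow>
    (\<forall>z. Re z > 0 \<longrightarrow> norm (h z) \<le> B * (norm z / Re z) ^ N) \<longrightarrow> n \<ge> 2 \<longrightarrow>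
    (\<exists>err. err \<longlonglongrightarrow> 0 \<and> (\<forall>k. norm (integral {1 / real (Suc k)..real (Suc k)}
        (\<lambda>s. of_real (s powr (real n + \<alpha>) * exp (- s)) * (deriv ^^ n) h (of_real s)))
      \<le> C * B * fact (n - 2) * real n + err k))"
proof -
  define G where "G = integral {0<..} (\<lambda>r::real. r powr \<alpha> * exp (- (1 / 2 * r)))"
  have G0: "G \<ge> 0"
    unfolding G_def using integrable_powr_exp_halfline[of "\<alpha> + 1" "1 / 2"] \<alpha>
    by (intro integral_nonneg) auto
  define C1 where "C1 = 32 * 6 ^ N * G"
  have C10: "C1 \<ge> 0" using G0 by (simp add: C1_def)
  show ?thesis
  proof (intro exI[of _ "24 * C1"] conjI allI impI)
    show "0 \<le> 24 * C1" using C10 by simp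
    fix h :: "complex \<Rightarrow> complex" and B :: real and n :: nat
    assume h: "h holomorphic_on {z. Re z > 0}"
      and bnd': "\<forall>z. Re z > 0 \<longrightarrow> norm (h z) \<le> B * (norm z / Re z) ^ N" and n: "n \<ge> 2"
    from bnd' have bnd: "norm (h z) \<le> B * (norm z / Re z) ^ N" if "Re z > 0" for z using that by blast
    have B: "B \<ge> 0" using order_trans[OF norm_ge_zero bnd[of 1]] by simp
    define m where "m = n - 2"
    have nm: "n = m + 2" using n by (simp add: m_def)
    define h2 where "h2 = (deriv ^^ 2) h"
    \<comment> \<open>The circle about 1 stays at distance 1/n from the imaginary axis, while
      \<rho>^(-(n-2)) remains below e.\<close>
    define \<rho> where "\<rho> = 1 - 1 / real n"
    define a where "a = 1 / real n"
    have \<rho>: "1/2 \<le> \<rho>" "\<rho> \<le> 1" "\<rho> < 1" "\<rho> > 0" "1 - \<rho> = a" and a: "a > 0"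
      using n by (auto simp: \<rho>_def a_def field_simps)
    define D where "D = 512 * B * (12 / a) ^ N / a ^ 4"
    have D0: "D \<ge> 0" using B a by (simp add: D_def)
    define E where "E = (\<lambda>k. 2 * D * (real (Suc k) powr (\<alpha> + 1) * exp (- real (Suc k) / 2)
        + (1 / real (Suc k)) powr (\<alpha> + 1)))"
    define \<tau> where "\<tau> = (\<lambda>x. 1 + of_real \<rho> * cis (2 * pi * x))"
    have \<rho>m: "1 / \<rho> ^ m \<le> 3"
    proof -
      have "1 / \<rho> ^ m = (1 + 1 / real (m + 1)) ^ m"
        by (simp add: \<rho>_def nm power_one_over[symmetric] field_simps)
      also have "\<dots> \<le> (1 + 1 / real (m + 1)) ^ (m + 1)"
        by (intro power_increasing) auto
      also have "\<dots> \<le> exp 1"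
        by (rule exp_ge_one_plus_x_over_n_power_n) auto
      also have "\<dots> \<le> 3" by (rule exp_le)
      finally show ?thesis .
    qed
    have Re\<tau>: "Re (\<tau> x) \<ge> a" for x
    proof -
      have "\<rho> * (- 1) \<le> \<rho> * cos (2 * pi * x)" using \<rho> by (intro mult_left_mono) auto
      then show ?thesis using \<rho> by (simp add: \<tau>_def)
    qed
    have n\<tau>2: "norm (\<tau> x) \<le> 2" for x
      using norm_triangle_ineq[of 1 "of_real \<rho> * cis (2 * pi * x)"] \<rho> by (simp add: \<tau>_def norm_mult)
    have n\<tau>: "norm (\<tau> x) \<ge> (a + \<bar>x - 1/2\<bar>) / 2" if "x \<in> {0..1}" for x
    proof -
      \<comment> \<open>The point of the circle nearest to \<tau> = 0 is reached at x = 1/2; the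
        shift moves it to y = 0.\<close>
      have "cis (2 * pi * (x - 1/2)) = - cis (2 * pi * x)"
        by (simp add: cis_divide[symmetric] right_diff_distrib)
      then have "\<tau> x = 1 - of_real \<rho> * cis (2 * pi * (x - 1/2))" by (simp add: \<tau>_def)
      moreover have "\<bar>x - 1/2\<bar> \<le> 1/2" using that by (auto simp: abs_if)
      ultimately show ?thesis
        using norm_one_minus_cis_ge[OF \<rho>(1,2), of "x - 1/2"] unfolding \<rho>(5) by simp
    qed
    have h2: "h2 holomorphic_on {z. Re z > 0}"
      unfolding h2_def by (intro holomorphic_higher_deriv h open_halfspace_Re_gt)
    show "\<exists>err. err \<longlonglongrightarrow> 0 \<and> (\<forall>k. norm (integral {1 / real (Suc k)..real (Suc k)}
        (\<lambda>s. of_real (s powr (real n + \<alpha>) * exp (- s)) * (deriv ^^ n) h (of_real s)))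
      \<le> 24 * C1 * B * fact (n - 2) * real n + err k)"
    proof (intro exI[of _ "\<lambda>k. 3 * fact m * E k"] conjI allI)
      have "(\<lambda>k. real (Suc k) powr (\<alpha> + 1) * exp (- real (Suc k) / 2) + (1 / real (Suc k)) powr (\<alpha> + 1)) \<longlonglongrightarrow> 0"
        using \<alpha> by real_asymp
      from tendsto_mult_left[OF this, of "3 * fact m * (2 * D)"]
      show "(\<lambda>k. 3 * fact m * E k) \<longlonglongrightarrow> 0" by (simp add: E_def mult.assoc)
    next
      fix k
      define d R where "d = 1 / real (Suc k)" and "R = real (Suc k)"
      have dR: "0 < d" "d \<le> R" by (auto simp: d_def R_def field_simps)
      define f where "f = (\<lambda>s x. of_real (s powr (\<alpha> + 2) * exp (- s)) *
          (h2 (\<tau> x * of_real s) / cis (2 * pi * x) ^ m))"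
      have Rep: "Re (\<tau> x * of_real s) > 0" if "s > 0" for x s
      proof -
        have "Re (\<tau> x * of_real s) = Re (\<tau> x) * s" by simp
        moreover have "0 < Re (\<tau> x)" using Re\<tau>[of x] a by linarith
        ultimately show ?thesis using that by simp
      qed
      have fc: "continuous_on (cbox (d, 0) (R, 1)) (\<lambda>(s, x). f s x)"
        unfolding f_def case_prod_beta \<tau>_def
      proof (intro continuous_intros)
        show "continuous_on (cbox (d, 0) (R, 1)) (\<lambda>p. h2 ((1 + of_real \<rho> * cis (2 * pi * snd p)) * of_real (fst p)))"
          by (rule continuous_on_compose2[OF holomorphic_on_imp_continuous_on[OF h2]])
            (use dR Rep in \<open>auto intro!: continuous_intros simp: \<tau>_def cbox_Pair_eq simp del: times_complex.simps\<close>)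
      qed (use dR in \<open>auto simp: cbox_Pair_eq\<close>)
      \<comment> \<open>For fixed \<open>s\<close> the points \<tau>(x) s run over the circle about
        \<open>s\<close> of radius \<rho> s. Cauchy's formula there yields the derivative of order n
        = m + 2 and the factor s^m, which completes s^(\<alpha>+2) to s^(n+\<alpha>).\<close>
      have inner: "integral {0..1} (f s) = of_real (\<rho> ^ m / fact m) *
          (of_real (s powr (real n + \<alpha>) * exp (- s)) * (deriv ^^ n) h (of_real s))" if s: "s > 0" for s
      proof -
        have sub: "cball (of_real s) (s * \<rho>) \<subseteq> {z. Re z > 0}"
        proof
          fix w assume "w \<in> cball (complex_of_real s) (s * \<rho>)"
          then have "\<bar>Re (of_real s - w)\<bar> \<le> s * \<rho>"
            using abs_Re_le_cmod[of "of_real s - w"] by (simp add: dist_norm)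
          moreover have "s * \<rho> < s" using s \<rho> by simp
          ultimately have "0 < Re w" by simp
          then show "w \<in> {z. Re z > 0}" by simp
        qed
        have "((\<lambda>x. h2 (of_real s + of_real (s * \<rho>) * cis (2 * pi * x)) / cis (2 * pi * x) ^ m) has_integral
            (deriv ^^ m) h2 (of_real s) * of_real (s * \<rho>) ^ m / fact m) {0..1}"
          by (rule Cauchy_higher_deriv_circle_integral[OF h2 open_halfspace_Re_gt sub]) (use s \<rho> in auto)
        moreover have "of_real s + of_real (s * \<rho>) * cis (2 * pi * x) = \<tau> x * of_real s" for x
          by (simp add: \<tau>_def algebra_simps)
        moreover have "(deriv ^^ m) h2 = (deriv ^^ n) h"
          unfolding h2_def nm by (simp only: funpow_add o_apply)
        ultimately have "((\<lambda>x. h2 (\<tau> x * of_real s) / cis (2 * pi * x) ^ m) has_integral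
            (deriv ^^ n) h (of_real s) * of_real (s * \<rho>) ^ m / fact m) {0..1}" by simp
        then have "(f s has_integral of_real (s powr (\<alpha> + 2) * exp (- s)) *
            ((deriv ^^ n) h (of_real s) * of_real (s * \<rho>) ^ m / fact m)) {0..1}"
          unfolding f_def by (rule has_integral_mult_right)
        then have "integral {0..1} (f s) = of_real (s powr (\<alpha> + 2) * exp (- s)) *
            ((deriv ^^ n) h (of_real s) * of_real (s * \<rho>) ^ m / fact m)"
          by (rule integral_unique)
        also have "\<dots> = of_real (\<rho> ^ m / fact m) *
            (of_real (s powr (\<alpha> + 2) * s ^ m * exp (- s)) * (deriv ^^ n) h (of_real s))"
          by (simp add: power_mult_distrib)
        also have "s powr (\<alpha> + 2) * s ^ m = s powr (real n + \<alpha>)"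
          using s by (simp add: nm powr_add powr_realpow algebra_simps)
        finally show ?thesis .
      qed
      have "of_real (\<rho> ^ m / fact m) * integral {d..R} (\<lambda>s. of_real (s powr (real n + \<alpha>) * exp (- s)) * (deriv ^^ n) h (of_real s))
          = integral {d..R} (\<lambda>s. integral {0..1} (f s))"
        unfolding Henstock_Kurzweil_Integration.integral_mult_right[symmetric]
        by (rule Henstock_Kurzweil_Integration.integral_cong) (use dR inner in auto)
      also have "\<dots> = integral {0..1} (\<lambda>x. integral {d..R} (\<lambda>s. f s x))"
        using integral_swap_continuous[OF fc] by simp
      finally have sw: "of_real (\<rho> ^ m / fact m) * integral {d..R} (\<lambda>s. of_real (s powr (real n + \<alpha>) * exp (- s)) * (deriv ^^ n) h (of_real s))
          = integral {0..1} (\<lambda>x. integral {d..R} (\<lambda>s. f s x))" .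
      have kern: "(\<lambda>x. (a + \<bar>x - 1/2\<bar>) powr - 2) integrable_on {0..1}"
        "integral {0..1} (\<lambda>x. (a + \<bar>x - 1/2\<bar>) powr - 2) \<le> 2 * real n"
        using integral_powr_kernel_le[of a 2 "1/2"] a n by (auto simp: powr_minus a_def)
      have "norm (integral {0..1} (\<lambda>x. integral {d..R} (\<lambda>s. f s x)))
          \<le> integral {0..1} (\<lambda>x. 4 * C1 * B * ((a + \<bar>x - 1/2\<bar>) powr - 2) + E k)"
      proof (rule integral_norm_bound_integral)
        have "continuous_on {0..1} (\<lambda>x. integral (cbox d R) (\<lambda>s. f s x))"
        proof (rule integral_continuous_on_param)
          have "(\<lambda>(x, s). f s x) = (\<lambda>p. (\<lambda>(s, x). f s x) (snd p, fst p))" by auto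
          then show "continuous_on ({0..1} \<times> cbox d R) (\<lambda>(x, s). f s x)"
            by (simp only:) (rule continuous_on_compose2[OF fc], auto intro!: continuous_intros simp: cbox_Pair_eq)
        qed
        then show "(\<lambda>x. integral {d..R} (\<lambda>s. f s x)) integrable_on {0..1}"
          by (intro integrable_continuous_real) simp
        show "(\<lambda>x. 4 * C1 * B * ((a + \<bar>x - 1/2\<bar>) powr - 2) + E k) integrable_on {0..1}"
          by (intro integrable_add integrable_on_mult_right kern) auto
        fix x :: real assume x: "x \<in> {0..1}"
        have "integral {d..R} (\<lambda>s. f s x) = integral {d..R} (\<lambda>s. of_real (s powr (\<alpha> + 2) * exp (- s)) * h2 (\<tau> x * of_real s)) / cis (2 * pi * x) ^ m"
          unfolding f_def by (simp flip: integral_divide)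
        then have "norm (integral {d..R} (\<lambda>s. f s x)) = norm (integral {d..R} (\<lambda>s. of_real (s powr (\<alpha> + 2) * exp (- s)) * h2 (\<tau> x * of_real s)))"
          by (simp add: norm_divide norm_power)
        also have "\<dots> \<le> C1 * B / (norm (\<tau> x))\<^sup>2 + E k"
          using rotated_second_deriv_bound[OF \<alpha> h bnd Re\<tau> n\<tau>2 a dR D_def, of x]
          by (simp add: h2_def C1_def G_def E_def d_def R_def mult_ac)
        also have "C1 * B / (norm (\<tau> x))\<^sup>2 \<le> C1 * B / ((a + \<bar>x - 1/2\<bar>) / 2)\<^sup>2"
        proof -
          have "0 < (a + \<bar>x - 1/2\<bar>) / 2" using a by auto
          then show ?thesis using n\<tau>[OF x] C10 B
            by (intro divide_left_mono power_mono mult_pos_pos zero_less_power mult_nonneg_nonneg) auto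
        qed
        also have "\<dots> = 4 * C1 * B * ((a + \<bar>x - 1/2\<bar>) powr - 2)"
        proof -
          have "C1 * B / (y / 2)\<^sup>2 = 4 * C1 * B * y powr - 2" if "y > 0" for y
            using that by (simp add: powr_neg_numeral power_divide)
          then show ?thesis using a by simp
        qed
        finally show "norm (integral {d..R} (\<lambda>s. f s x)) \<le> 4 * C1 * B * ((a + \<bar>x - 1/2\<bar>) powr - 2) + E k" by simp
      qed
      also have "\<dots> = 4 * C1 * B * integral {0..1} (\<lambda>x. (a + \<bar>x - 1/2\<bar>) powr - 2) + E k"
        by (subst Henstock_Kurzweil_Integration.integral_add)
          (auto intro!: integrable_on_mult_right kern)
      also have "\<dots> \<le> 4 * C1 * B * (2 * real n) + E k"
        using kern(2) C10 B by (intro add_right_mono mult_left_mono) auto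
      finally have le: "norm (integral {0..1} (\<lambda>x. integral {d..R} (\<lambda>s. f s x))) \<le> 8 * C1 * B * real n + E k" by simp
      have E0: "E k \<ge> 0" using D0 by (simp add: E_def)
      define I where "I = integral {d..R} (\<lambda>s. of_real (s powr (real n + \<alpha>) * exp (- s)) * (deriv ^^ n) h (of_real s))"
      have "\<rho> ^ m / fact m * norm I \<le> 8 * C1 * B * real n + E k"
        using le unfolding sw[symmetric] I_def[symmetric] norm_mult
        using \<rho> by (simp add: norm_divide norm_power)
      then have "norm I \<le> (1 / \<rho> ^ m) * (fact m * (8 * C1 * B * real n + E k))"
        using \<rho> by (simp add: field_simps)
      also have "\<dots> \<le> 3 * (fact m * (8 * C1 * B * real n + E k))"
        using \<rho>m E0 C10 B by (intro mult_right_mono) auto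
      finally show "norm (integral {1 / real (Suc k)..real (Suc k)}
          (\<lambda>s. of_real (s powr (real n + \<alpha>) * exp (- s)) * (deriv ^^ n) h (of_real s)))
        \<le> 24 * C1 * B * fact (n - 2) * real n + 3 * fact m * E k"
        unfolding I_def d_def R_def m_def[symmetric] by (simp add: algebra_simps)
    qed
  qed
qed

section \<open>Laguerre polynomials\<close>

lemma fps_mult_compose_nth:
  fixes b :: "'a::comm_ring_1 fps"
  assumes "b $ 0 = 0"
  shows "(f * (a oo b)) $ n = (\<Sum>k=0..n. a $ k * (f * b ^ k) $ n)"
proof -
  have "(f * (a oo b)) $ n = (\<Sum>i=0..n. \<Sum>k=0..n. f $ i * (a $ k * (b ^ k) $ (n - i)))"
    unfolding fps_mult_nth fps_compose_nth sum_distrib_left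
  proof (rule sum.cong[OF refl])
    fix i assume "i \<in> {0..n}"
    show "(\<Sum>k=0..n - i. f $ i * (a $ k * (b ^ k) $ (n - i))) = (\<Sum>k=0..n. f $ i * (a $ k * (b ^ k) $ (n - i)))"
      by (rule sum.mono_neutral_left) (use startsby_zero_power_prefix[OF assms] in auto)
  qed
  also have "\<dots> = (\<Sum>k=0..n. a $ k * (f * b ^ k) $ n)"
    by (subst sum.swap) (simp add: fps_mult_nth sum_distrib_left mult_ac)
  finally show ?thesis .
qed

text \<open>Written with powers of 1 + w instead of a quotient, so that both factors have binomial
  series as expansions.\<close>

definition laguerre_gen :: "real \<Rightarrow> real \<Rightarrow> complex \<Rightarrow> complex" where
  "laguerre_gen \<alpha> t w = (1 + w) powr - of_real (\<alpha> + 1) * exp (of_real t * (w * (1 + w) powr - 1))"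

lemma laguerre_gen_holomorphic: "laguerre_gen \<alpha> t holomorphic_on ball 0 1"
proof -
  have "1 + w \<notin> \<real>\<^sub>\<le>\<^sub>0" if "w \<in> ball 0 1" for w :: complex
    using that abs_Re_le_cmod[of w] by (auto simp: complex_nonpos_Reals_iff)
  then show ?thesis
    unfolding laguerre_gen_def by (intro holomorphic_intros) auto
qed

text \<open>The classical generating function, with \<open>z\<close> replaced by \<open>-w\<close>.\<close>

lemma laguerre_eq_higher_deriv:
  "(deriv ^^ n) (laguerre_gen \<alpha> t) 0 = fact n * (-1) ^ n * of_real (laguerre n \<alpha> t)"
proof -
  define c :: complex where "c = - of_real (\<alpha> + 1)"
  define b :: "complex fps" where "b = fps_X * fps_binomial (- 1)"
  define P where "P = fps_binomial c * (fps_exp (of_real t) oo b)"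
  have b0: "b $ 0 = 0" by (simp add: b_def)
  have "((\<lambda>w. exp (of_real t * w)) \<circ> (\<lambda>w. w * (1 + w) powr - 1)) has_fps_expansion (fps_exp (of_real t) oo b)"
    using b0 unfolding b_def by (intro fps_expansion_intros) auto
  then have "laguerre_gen \<alpha> t has_fps_expansion P"
    unfolding P_def laguerre_gen_def[abs_def] c_def[symmetric]
    by (intro fps_expansion_intros) (auto simp: o_def)
  then have "(deriv ^^ n) (laguerre_gen \<alpha> t) 0 / fact n = P $ n"
    by (simp add: fps_nth_fps_expansion)
  also have "P $ n = (\<Sum>k=0..n. of_real t ^ k / fact k * (fps_binomial c * b ^ k) $ n)"
    unfolding P_def by (simp add: fps_mult_compose_nth[OF b0])
  also have "\<dots> = (\<Sum>k=0..n. (-1) ^ n * of_real ((-1) ^ k * ((real n + \<alpha>) gchoose (n - k)) * t ^ k / fact k))"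
  proof (rule sum.cong[OF refl])
    fix k assume k: "k \<in> {0..n}"
    have "fps_binomial c * b ^ k = fps_X ^ k * fps_binomial (c - of_nat k)"
      unfolding b_def power_mult_distrib fps_binomial_power
      using fps_binomial_add_mult[of c "- of_nat k"] by (simp add: mult_ac)
    then have "(fps_binomial c * b ^ k) $ n = (c - of_nat k) gchoose (n - k)"
      using k by (simp add: fps_X_power_mult_nth)
    \<comment> \<open>Negating the upper index turns it into n + \<alpha> and produces the sign
      (-1)^(n-k), which splits into the (-1)^n of the substitution and the (-1)^k of the
      polynomial.\<close>
    also have "c - of_nat k = - (of_real (\<alpha> + 1 + real k))" by (simp add: c_def)
    also have "\<dots> gchoose (n - k) = (-1) ^ (n - k) * ((of_real (\<alpha> + 1 + real k) + of_nat (n - k) - 1) gchoose (n - k))"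
      by (rule gbinomial_minus)
    also have "of_real (\<alpha> + 1 + real k) + of_nat (n - k) - 1 = complex_of_real (real n + \<alpha>)"
      using k by (simp add: of_nat_diff)
    also have "complex_of_real (real n + \<alpha>) gchoose (n - k) = of_real ((real n + \<alpha>) gchoose (n - k))"
      by (simp add: gbinomial_prod_rev)
    also have "(-1) ^ (n - k) = (-1) ^ n * ((-1) ^ k :: complex)"
      using k by (auto simp: power_diff power_add[symmetric] neg_one_power_add_eq_neg_one_power_diff)
    finally show "of_real t ^ k / fact k * (fps_binomial c * b ^ k) $ n
        = (-1) ^ n * of_real ((-1) ^ k * ((real n + \<alpha>) gchoose (n - k)) * t ^ k / fact k)"
      by simp
  qed
  also have "\<dots> = (-1) ^ n * of_real (laguerre n \<alpha> t)"
    by (simp add: laguerre_def sum_distrib_left)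
  finally show ?thesis by (simp add: field_simps)
qed

text \<open>The radius n/(n+1) keeps the circle inside the disc of holomorphy, while the loss (1 +
  1/n)^n is at most e <= 3.\<close>

lemma laguerre_abs_le_integral:
  assumes n: "n \<ge> 1" and g: "g integrable_on {0..1}"
    and le: "\<And>x. x \<in> {0..1} \<Longrightarrow> norm (laguerre_gen \<alpha> t (of_real (real n / real (n + 1)) * cis (2 * pi * x))) \<le> g x"
  shows "\<bar>laguerre n \<alpha> t\<bar> \<le> 3 * integral {0..1} g"
proof -
  define \<rho> where "\<rho> = real n / real (n + 1)"
  have \<rho>: "0 < \<rho>" "\<rho> < 1" using n by (auto simp: \<rho>_def)
  have *: "((\<lambda>x. laguerre_gen \<alpha> t (0 + of_real \<rho> * cis (2 * pi * x)) / cis (2 * pi * x) ^ n) has_integral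
      (deriv ^^ n) (laguerre_gen \<alpha> t) 0 * of_real \<rho> ^ n / fact n) {0..1}"
    by (rule Cauchy_higher_deriv_circle_integral[OF laguerre_gen_holomorphic]) (use \<rho> in auto)
  have "norm (integral {0..1} (\<lambda>x. laguerre_gen \<alpha> t (0 + of_real \<rho> * cis (2 * pi * x)) / cis (2 * pi * x) ^ n))
      \<le> integral {0..1} g"
    using * g le by (intro integral_norm_bound_integral) (auto simp: norm_divide norm_power \<rho>_def)
  then have "\<bar>laguerre n \<alpha> t\<bar> * \<rho> ^ n \<le> integral {0..1} g"
    unfolding integral_unique[OF *] laguerre_eq_higher_deriv using \<rho>
    by (simp add: norm_mult norm_power norm_divide)
  then have l: "\<bar>laguerre n \<alpha> t\<bar> \<le> (1 / \<rho> ^ n) * integral {0..1} g" using \<rho> by (simp add: field_simps)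
  have g0: "0 \<le> integral {0..1} g"
    using order_trans[OF norm_ge_zero le] by (intro integral_nonneg g) auto
  have "1 / \<rho> ^ n = (1 + 1 / real n) ^ n"
    using n by (simp add: \<rho>_def power_one_over[symmetric] field_simps)
  also have "\<dots> \<le> exp 1" using n by (intro exp_ge_one_plus_x_over_n_power_n) auto
  also have "\<dots> \<le> 3" by (rule exp_le)
  finally show ?thesis using l mult_right_mono[OF _ g0] order_trans by blast
qed

text \<open>With \<tau> = 1 + w the exponent is t (1 - 1/\<tau>), and Re(1/\<tau>) = Re \<tau> /
  |\<tau>|^2 >= a / u^2. The resulting damping near u = 0 is what later halves the exponent
  \<alpha>.\<close>

lemma laguerre_gen_norm_le:
  assumes a: "a = 1 - \<rho>" and \<rho>: "1/2 \<le> \<rho>" "\<rho> < 1" and t: "t \<ge> 0"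
    and u: "u = norm (1 + of_real \<rho> * cis (2 * pi * x))"
  shows "u \<ge> a" "norm (laguerre_gen \<alpha> t (of_real \<rho> * cis (2 * pi * x))) \<le> exp t * (u powr - (\<alpha> + 1) * exp (- t * (a / u\<^sup>2)))"
proof -
  define \<tau> where "\<tau> = 1 + of_real \<rho> * cis (2 * pi * x)"
  have "\<rho> * (- 1) \<le> \<rho> * cos (2 * pi * x)" using \<rho> by (intro mult_left_mono) auto
  then have Re\<tau>: "Re \<tau> \<ge> a" using a by (simp add: \<tau>_def)
  have a0: "a > 0" using a \<rho> by simp
  then have \<tau>0: "\<tau> \<noteq> 0" using Re\<tau> by auto
  show "u \<ge> a" using Re\<tau> complex_Re_le_cmod[of \<tau>] by (simp add: u \<tau>_def)
  have w: "of_real \<rho> * cis (2 * pi * x) = \<tau> - 1" by (simp add: \<tau>_def)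
  have "(\<tau> - 1) * \<tau> powr - 1 = 1 - 1 / \<tau>"
    using \<tau>0 by (simp add: powr_minus field_simps)
  then have "norm (laguerre_gen \<alpha> t (of_real \<rho> * cis (2 * pi * x)))
      = norm \<tau> powr - (\<alpha> + 1) * exp (t * (1 - Re (1 / \<tau>)))"
    unfolding laguerre_gen_def w by (simp add: norm_mult norm_powr_real_powr')
  also have "Re (1 / \<tau>) = Re \<tau> / (norm \<tau>)\<^sup>2" by (simp add: Re_divide cmod_power2)
  also have "norm \<tau> powr - (\<alpha> + 1) * exp (t * (1 - Re \<tau> / (norm \<tau>)\<^sup>2))
      \<le> norm \<tau> powr - (\<alpha> + 1) * exp (t * (1 - a / (norm \<tau>)\<^sup>2))"
    using Re\<tau> t by (intro mult_left_mono) (auto intro!: mult_left_mono divide_right_mono)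
  also have "\<dots> = exp t * (u powr - (\<alpha> + 1) * exp (- t * (a / u\<^sup>2)))"
  proof -
    have "u = norm \<tau>" by (simp add: u \<tau>_def)
    then show ?thesis by (simp add: right_diff_distrib exp_diff exp_minus field_simps)
  qed
  finally show "norm (laguerre_gen \<alpha> t (of_real \<rho> * cis (2 * pi * x))) \<le> exp t * (u powr - (\<alpha> + 1) * exp (- t * (a / u\<^sup>2)))" .
qed

text \<open>The damping factor is bounded by 1. In return the bound is uniform for \<open>t\<close>
  in a compact interval including 0, as required when the time variable of the flow starts at 0; any
  polynomial growth in \<open>n\<close> is acceptable there.\<close>

lemma laguerre_crude_bound:
  assumes "\<alpha> \<ge> -1" "t \<ge> 0" "n \<ge> 1"
  shows "\<bar>laguerre n \<alpha> t\<bar> \<le> 3 * (exp t * real (n + 1) powr (\<alpha> + 1))"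
proof -
  define \<rho> where "\<rho> = real n / real (n + 1)"
  have \<rho>: "1/2 \<le> \<rho>" "\<rho> < 1" "1 - \<rho> = 1 / real (n + 1)"
    using assms(3) by (auto simp: \<rho>_def field_simps)
  have "norm (laguerre_gen \<alpha> t (of_real \<rho> * cis (2 * pi * x))) \<le> exp t * real (n + 1) powr (\<alpha> + 1)" for x
  proof -
    define u where "u = norm (1 + of_real \<rho> * cis (2 * pi * x))"
    note l = laguerre_gen_norm_le[OF refl \<rho>(1,2) assms(2) u_def, unfolded \<rho>(3)]
    have "u powr - (\<alpha> + 1) \<le> (1 / real (n + 1)) powr - (\<alpha> + 1)"
      using l(1) assms(1) by (intro powr_mono2') auto
    also have "\<dots> = real (n + 1) powr (\<alpha> + 1)"
    proof -
      have inv: "(1 / y) powr - q = y powr q" if "y > 0" for y q :: real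
        using that by (simp add: powr_minus powr_divide)
      show ?thesis by (rule inv) simp
    qed
    finally have "u powr - (\<alpha> + 1) * exp (- t * (1 / real (n + 1) / u\<^sup>2)) \<le> real (n + 1) powr (\<alpha> + 1) * 1"
      using assms(2) by (intro mult_mono) auto
    then have "exp t * (u powr - (\<alpha> + 1) * exp (- t * (1 / real (n + 1) / u\<^sup>2))) \<le> exp t * real (n + 1) powr (\<alpha> + 1)"
      by simp
    then show ?thesis using l(2)[of \<alpha>] by linarith
  qed
  then have "\<bar>laguerre n \<alpha> t\<bar> \<le> 3 * integral {0..1} (\<lambda>x::real. exp t * real (n + 1) powr (\<alpha> + 1))"
    using assms(3) unfolding \<rho>_def by (intro laguerre_abs_le_integral) auto
  then show ?thesis by simp
qed

lemma laguerre_bound: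
  assumes \<alpha>: "\<alpha> > 0" and t: "t > 0"
  shows "\<exists>C>0. \<forall>n\<ge>1. \<bar>laguerre n \<alpha> t\<bar> \<le> C * real n powr (\<alpha> / 2)"
proof -
  define p where "p = \<alpha> + 1"
  define K where "K = exp t * exp (p\<^sup>2 / (4 * t)) * 2 powr p"
  have K: "K > 0" by (simp add: K_def)
  \<comment> \<open>Uses 1 + v <= e^v and completion of the square in p v - t v^2.\<close>
  have growth: "(1 + v) powr p * exp (- t * v\<^sup>2) \<le> exp (p\<^sup>2 / (4 * t))" if "v \<ge> 0" for v
  proof -
    have "(1 + v) powr p \<le> exp v powr p" using that \<alpha> by (intro powr_mono2) (auto simp: p_def)
    also have "\<dots> = exp (p * v)" by (simp add: exp_powr_real mult.commute)
    finally have "(1 + v) powr p * exp (- t * v\<^sup>2) \<le> exp (p * v) * exp (- t * v\<^sup>2)"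
      by (intro mult_right_mono) auto
    also have "\<dots> = exp (p * v - t * v\<^sup>2)" by (simp add: exp_diff exp_minus divide_inverse)
    also have "p * v - t * v\<^sup>2 \<le> p\<^sup>2 / (4 * t)"
    proof -
      have "0 \<le> (2 * t * v - p)\<^sup>2" by simp
      then show ?thesis using t by (simp add: field_simps power2_eq_square)
    qed
    finally show ?thesis by simp
  qed
  have main: "\<bar>laguerre n \<alpha> t\<bar> \<le> 3 * K * (2 / \<alpha>) * 2 powr (\<alpha> / 2) * real n powr (\<alpha> / 2)" if n: "n \<ge> 1" for n
  proof -
    define \<rho> where "\<rho> = real n / real (n + 1)"
    define a where "a = 1 / real (n + 1)"
    \<comment> \<open>The distance at which exp(-t a / u^2) begins to suppress the
      singularity.\<close>
    define s where "s = sqrt a"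
    have \<rho>: "1/2 \<le> \<rho>" "\<rho> < 1" "1 - \<rho> = a"
      using n by (auto simp: \<rho>_def a_def field_simps)
    have s: "s > 0" "s\<^sup>2 = a" by (auto simp: s_def a_def)
    have "norm (laguerre_gen \<alpha> t (of_real \<rho> * cis (2 * pi * x))) \<le> K * (s + \<bar>x - 1/2\<bar>) powr - p"
      if x: "x \<in> {0..1}" for x
    proof -
      define u where "u = norm (1 + of_real \<rho> * cis (2 * pi * x))"
      note l = laguerre_gen_norm_le[OF \<rho>(3)[symmetric] \<rho>(1,2) less_imp_le[OF t] u_def]
      have a0: "a > 0" by (simp add: a_def)
      have u0: "u > 0" using l(1) a0 by linarith
      have "cis (2 * pi * (x - 1/2)) = - cis (2 * pi * x)"
        by (simp add: cis_divide[symmetric] right_diff_distrib)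
      then have "u = norm (1 - of_real \<rho> * cis (2 * pi * (x - 1/2)))" by (simp add: u_def)
      moreover have "\<bar>x - 1/2\<bar> \<le> 1/2" using x by (auto simp: abs_if)
      ultimately have "u \<ge> (a + \<bar>x - 1/2\<bar>) / 2"
        using norm_one_minus_cis_ge[of \<rho> "x - 1/2"] \<rho> by simp
      then have su: "s + u \<ge> (s + \<bar>x - 1/2\<bar>) / 2" using a0 s(1) by simp
      \<comment> \<open>Extracting (s+u)^(-p) leaves a function of v = s/u alone, which
        \<open>growth\<close> bounds; the singularity u^(-p) is thereby replaced by its
        regularisation at scale \<open>s\<close>.\<close>
      have "u powr - p * exp (- t * (a / u\<^sup>2)) = (s + u) powr - p * ((1 + s / u) powr p * exp (- t * (s / u)\<^sup>2))"
      proof -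
        have "1 + s / u = (s + u) / u" using u0 by (simp add: field_simps)
        then have "(s + u) powr - p * (1 + s / u) powr p = u powr - p"
          using u0 s by (simp add: powr_divide powr_minus field_simps)
        then show ?thesis by (simp add: power_divide s(2) mult.assoc[symmetric])
      qed
      also have "\<dots> \<le> (s + u) powr - p * exp (p\<^sup>2 / (4 * t))"
        using u0 s by (intro mult_left_mono growth) auto
      also have "\<dots> \<le> ((s + \<bar>x - 1/2\<bar>) / 2) powr - p * exp (p\<^sup>2 / (4 * t))"
        using su s \<alpha> by (intro mult_right_mono powr_mono2') (auto simp: p_def)
      also have "((s + \<bar>x - 1/2\<bar>) / 2) powr - p = 2 powr p * (s + \<bar>x - 1/2\<bar>) powr - p"
      proof -
        have half: "(y / 2) powr - p = 2 powr p * y powr - p" if "y > 0" for y :: real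
          using that by (simp add: powr_divide powr_minus_divide)
        show ?thesis by (rule half) (use s in simp)
      qed
      finally have "exp t * (u powr - p * exp (- t * (a / u\<^sup>2))) \<le> K * (s + \<bar>x - 1/2\<bar>) powr - p"
        by (simp add: K_def mult_ac)
      then show ?thesis using l(2)[of \<alpha>] unfolding p_def by linarith
    qed
    moreover have ker: "(\<lambda>x. (s + \<bar>x - 1/2\<bar>) powr - p) integrable_on {0..1}"
      "integral {0..1} (\<lambda>x. (s + \<bar>x - 1/2\<bar>) powr - p) \<le> 2 * s powr (1 - p) / (p - 1)"
      using integral_powr_kernel_le[of s p "1/2"] s \<alpha> by (auto simp: p_def)
    ultimately have "\<bar>laguerre n \<alpha> t\<bar> \<le> 3 * integral {0..1} (\<lambda>x. K * (s + \<bar>x - 1/2\<bar>) powr - p)"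
      using n unfolding \<rho>_def by (intro laguerre_abs_le_integral integrable_on_mult_right) auto
    also have "\<dots> \<le> 3 * (K * (2 * s powr (1 - p) / (p - 1)))"
      unfolding Henstock_Kurzweil_Integration.integral_mult_right
      using ker(2) K by (intro mult_left_mono) auto
    also have "\<dots> = 3 * K * (2 / \<alpha>) * s powr (1 - p)" by (simp add: p_def)
    also have "\<dots> \<le> 3 * K * (2 / \<alpha>) * (2 powr (\<alpha> / 2) * real n powr (\<alpha> / 2))"
    proof (rule mult_left_mono)
      have "s powr (1 - p) = real (n + 1) powr (\<alpha> / 2)"
        by (simp add: s_def a_def p_def powr_half_sqrt[symmetric] powr_powr powr_divide powr_minus field_simps)
      also have "\<dots> \<le> (2 * real n) powr (\<alpha> / 2)" using n \<alpha> by (intro powr_mono2) auto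
      also have "\<dots> = 2 powr (\<alpha> / 2) * real n powr (\<alpha> / 2)" by (simp add: powr_mult)
      finally show "s powr (1 - p) \<le> 2 powr (\<alpha> / 2) * real n powr (\<alpha> / 2)" .
    qed (use K \<alpha> in auto)
    finally show ?thesis by (simp add: mult_ac)
  qed
  show ?thesis
    by (rule exI[of _ "3 * K * (2 / \<alpha>) * 2 powr (\<alpha> / 2)"]) (use main K \<alpha> in auto)
qed

section \<open>Identities for the Laguerre polynomials in the parameter and at the origin\<close>

lemma laguerre_Suc_alpha_diff:
  "laguerre (Suc m) (\<alpha> + 1) t = laguerre m (\<alpha> + 1) t + laguerre (Suc m) \<alpha> t"
proof -
  have "laguerre (Suc m) (\<alpha> + 1) t = (\<Sum>k=0..m. (-1) ^ k * ((real (Suc m) + (\<alpha> + 1)) gchoose (Suc m - k)) * t ^ k / fact k)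
      + (-1) ^ Suc m * t ^ Suc m / fact (Suc m)"
    by (simp add: laguerre_def)
  also have "(\<Sum>k=0..m. (-1) ^ k * ((real (Suc m) + (\<alpha> + 1)) gchoose (Suc m - k)) * t ^ k / fact k)
      = (\<Sum>k=0..m. (-1) ^ k * ((real m + (\<alpha> + 1)) gchoose (m - k)) * t ^ k / fact k
        + (-1) ^ k * ((real (Suc m) + \<alpha>) gchoose (Suc m - k)) * t ^ k / fact k)"
  proof (rule sum.cong[OF refl])
    fix k assume k: "k \<in> {0..m}"
    have "((real (Suc m) + (\<alpha> + 1)) gchoose (Suc m - k))
        = ((real m + (\<alpha> + 1)) gchoose (m - k)) + ((real (Suc m) + \<alpha>) gchoose (Suc m - k))"
      using gbinomial_Suc_Suc[of "real m + (\<alpha> + 1)" "m - k"] k by (simp add: Suc_diff_le add_ac)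
    then show "(-1) ^ k * ((real (Suc m) + (\<alpha> + 1)) gchoose (Suc m - k)) * t ^ k / fact k
        = (-1) ^ k * ((real m + (\<alpha> + 1)) gchoose (m - k)) * t ^ k / fact k
        + (-1) ^ k * ((real (Suc m) + \<alpha>) gchoose (Suc m - k)) * t ^ k / fact k"
      by (simp only: ring_distribs add_divide_distrib)
  qed
  finally show ?thesis by (simp add: laguerre_def sum.distrib)
qed

text \<open>Rewrites the derivative of a Laguerre polynomial as minus the sum of all polynomials of
  lower degree with the same \<alpha>, the form that telescoping requires.\<close>

lemma sum_laguerre: "(\<Sum>k=0..m. laguerre k \<alpha> t) = laguerre m (\<alpha> + 1) t"
  by (induction m) (simp_all add: laguerre_Suc_alpha_diff, simp add: laguerre_def)

lemma laguerre_0 [simp]: "laguerre 0 \<alpha> t = 1"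
  by (simp add: laguerre_def)

lemma laguerre_has_real_derivative:
  "((laguerre (Suc n) \<alpha>) has_real_derivative - laguerre n (\<alpha> + 1) t) (at t)"
proof -
  have "((\<lambda>t. \<Sum>k=0..Suc n. (-1) ^ k * ((real (Suc n) + \<alpha>) gchoose (Suc n - k)) * t ^ k / fact k) has_real_derivative
      (\<Sum>k=0..Suc n. (-1) ^ k * ((real (Suc n) + \<alpha>) gchoose (Suc n - k)) * (real k * t ^ (k - 1)) / fact k)) (at t)"
    by (rule DERIV_sum) (auto intro!: derivative_eq_intros)
  also have "(\<Sum>k=0..Suc n. (-1) ^ k * ((real (Suc n) + \<alpha>) gchoose (Suc n - k)) * (real k * t ^ (k - 1)) / fact k)
      = (\<Sum>k=0..n. (-1) ^ Suc k * ((real (Suc n) + \<alpha>) gchoose (n - k)) * (real (Suc k) * t ^ k) / fact (Suc k))"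
    by (subst sum.atLeast0_atMost_Suc_shift) simp
  also have "\<dots> = - laguerre n (\<alpha> + 1) t"
    unfolding laguerre_def sum_negf[symmetric]
  proof (rule sum.cong[OF refl])
    fix k
    have "A * (S * B) / (S * F) = A * B / F" if "S \<noteq> 0" for A B S F :: real
      using that by simp
    from this[of "real (Suc k)" "(-1) ^ Suc k * ((real (Suc n) + \<alpha>) gchoose (n - k))" "t ^ k" "fact k"]
    show "(-1) ^ Suc k * ((real (Suc n) + \<alpha>) gchoose (n - k)) * (real (Suc k) * t ^ k) / fact (Suc k)
        = - ((-1) ^ k * ((real n + (\<alpha> + 1)) gchoose (n - k)) * t ^ k / fact k)"
      unfolding fact_Suc by (simp add: add_ac)
  qed
  finally show ?thesis unfolding laguerre_def[abs_def] .
qed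

text \<open>The factor Gamma(n+\<alpha>+1) cancels the normalisation of \<open>lag_coeff\<close> and
  1/n! remains, so the partial sum at 0 becomes an average of Taylor polynomials.\<close>

lemma laguerre_at_0:
  assumes "\<alpha> > -1"
  shows "laguerre n \<alpha> 0 = Gamma (real n + \<alpha> + 1) / (fact n * Gamma (\<alpha> + 1))"
proof -
  have "laguerre n \<alpha> 0 = (real n + \<alpha>) gchoose n"
    unfolding laguerre_def by (subst sum.remove[of _ 0]) auto
  also have "\<dots> = pochhammer (\<alpha> + 1) n / fact n"
    by (simp add: gbinomial_pochhammer' add_ac)
  also have "pochhammer (\<alpha> + 1) n = Gamma (\<alpha> + 1 + real n) / Gamma (\<alpha> + 1)"
    using assms by (intro pochhammer_Gamma) (auto elim!: nonpos_Ints_cases)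
  finally show ?thesis by (simp add: add_ac)
qed

section \<open>Derivatives of the orbits\<close>

lemma weighted_integrable:
  fixes F :: "real \<Rightarrow> 'a::banach"
  assumes cont: "continuous_on {0<..} F" and le: "\<And>s. s > 0 \<Longrightarrow> norm (F s) \<le> M * s powr r"
    and pr: "p + r > -1"
  shows "(\<lambda>s. (s powr p * exp (- s)) *\<^sub>R F s) integrable_on {0<..}"
    and "norm (integral {0<..} (\<lambda>s. (s powr p * exp (- s)) *\<^sub>R F s)) \<le> M * Gamma (p + r + 1)"
    and "(\<lambda>k. integral {1 / real (Suc k)..real (Suc k)} (\<lambda>s. (s powr p * exp (- s)) *\<^sub>R F s))
      \<longlonglongrightarrow> integral {0<..} (\<lambda>s. (s powr p * exp (- s)) *\<^sub>R F s)"
proof -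
  define g where "g = (\<lambda>s. M * (s powr (p + r) * exp (- s)))"
  have "((\<lambda>s. s powr (p + r) * exp (- s)) has_integral Gamma (p + r + 1)) {0<..}"
    using has_integral_Gamma_halfline[of "p + r + 1"] pr by simp
  then have g: "(g has_integral M * Gamma (p + r + 1)) {0<..}"
    unfolding g_def by (rule has_integral_mult_right)
  have c: "continuous_on {0<..} (\<lambda>s. (s powr p * exp (- s)) *\<^sub>R F s)"
    by (intro continuous_intros cont) auto
  have le': "norm ((s powr p * exp (- s)) *\<^sub>R F s) \<le> g s" if "s > 0" for s
  proof -
    have "norm ((s powr p * exp (- s)) *\<^sub>R F s) = s powr p * exp (- s) * norm (F s)" by simp
    also have "\<dots> \<le> s powr p * exp (- s) * (M * s powr r)"
      using le[OF that] by (intro mult_left_mono) auto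
    finally show ?thesis by (simp add: g_def powr_add mult_ac)
  qed
  show i: "(\<lambda>s. (s powr p * exp (- s)) *\<^sub>R F s) integrable_on {0<..}"
    using g by (intro integrable_on_halfline_dominated[OF c le']) auto
  show "norm (integral {0<..} (\<lambda>s. (s powr p * exp (- s)) *\<^sub>R F s)) \<le> M * Gamma (p + r + 1)"
    unfolding integral_unique[OF g, symmetric] using g le'
    by (intro integral_norm_bound_integral i) auto
  show "(\<lambda>k. integral {1 / real (Suc k)..real (Suc k)} (\<lambda>s. (s powr p * exp (- s)) *\<^sub>R F s))
      \<longlonglongrightarrow> integral {0<..} (\<lambda>s. (s powr p * exp (- s)) *\<^sub>R F s)"
    using g by (intro integral_halfline_LIMSEQ[OF c le']) auto
qed

lemma has_derivative_shift:
  fixes g :: "'a::real_normed_vector \<Rightarrow> 'b::real_normed_vector"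
  assumes "(g has_derivative g') (at (z - w))"
  shows "((\<lambda>u. g (u - w)) has_derivative g') (at z)"
proof -
  have "((\<lambda>u. u - w) has_derivative (\<lambda>h. h)) (at z)" by (auto intro!: derivative_eq_intros)
  from has_derivative_compose[OF this assms] show ?thesis by simp
qed

text \<open>\<open>orbit_deriv sc T n z x\<close> is \<open>(-1)^n\<close> times the \<open>n\<close>-th complex derivative of the orbit \<open>z \<mapsto> T z x\<close>,
  that is \<open>A^n T(z) x\<close>.\<close>

primrec orbit_deriv :: "(complex \<Rightarrow> 'a \<Rightarrow> 'a) \<Rightarrow> (complex \<Rightarrow> 'a \<Rightarrow> 'a) \<Rightarrow> nat \<Rightarrow> complex \<Rightarrow> 'a \<Rightarrow> 'a::banach" where
  "orbit_deriv sc T 0 = T"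
| "orbit_deriv sc T (Suc n) =
    (\<lambda>z x. - (SOME v. ((\<lambda>w. orbit_deriv sc T n w x) has_derivative (\<lambda>h. sc h v)) (at z)))"

section \<open>Orbit derivatives of the semigroup: semigroup law, size, weighted integrals\<close>

locale hg_semigroup =
  fixes sc :: "complex \<Rightarrow> 'a::banach \<Rightarrow> 'a" and T :: "complex \<Rightarrow> 'a \<Rightarrow> 'a" and K :: real and N :: nat
  assumes sc: "complex_scaling sc"
    and hol: "holomorphic_semigroup sc T"
    and C0: "\<And>x. ((\<lambda>t. T (complex_of_real t) x) \<longlongrightarrow> x) (at_right 0)"
    and K: "K > 0"
    and T_bound: "\<And>z x. Re z > 0 \<Longrightarrow> norm (T z x) \<le> K * (cmod z / Re z) ^ N * norm x"
begin

abbreviation U :: "nat \<Rightarrow> complex \<Rightarrow> 'a \<Rightarrow> 'a" where "U \<equiv> orbit_deriv sc T"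

lemma sc_one: "sc 1 x = x"
  using sc unfolding complex_scaling_def by (metis of_real_1 scaleR_one)

lemma sc_of_real: "sc (of_real r) x = r *\<^sub>R x"
  using sc unfolding complex_scaling_def by blast

lemma T_bounded_linear: "Re z > 0 \<Longrightarrow> bounded_linear (T z)"
  using hol unfolding holomorphic_semigroup_def by blast

lemma T_sc: "Re z > 0 \<Longrightarrow> T z (sc c x) = sc c (T z x)"
  using hol unfolding holomorphic_semigroup_def by blast

lemma T_add: "Re z > 0 \<Longrightarrow> Re w > 0 \<Longrightarrow> T (z + w) x = T z (T w x)"
  using hol unfolding holomorphic_semigroup_def by simp

text \<open>On the positive axis |z| / Re z = 1.\<close>

lemma T_real_bound: "s > 0 \<Longrightarrow> norm (T (of_real s) x) \<le> K * norm x"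
  using T_bound[of "of_real s" x] by simp

lemma orbit_deriv_unique:
  assumes "(f has_derivative (\<lambda>h. sc h v)) (at z)" "(f has_derivative (\<lambda>h. sc h v')) (at z)"
  shows "v = v'"
  using fun_cong[OF has_derivative_unique[OF assms], of 1] by (simp add: sc_one)

text \<open>Both claims are carried through one induction: the semigroup law expresses the next
  derivative near \<open>z\<close> as the orbit of a fixed vector, U(u) x = T(u - z0) (U(z0) x), so
  its differentiability is again that of an orbit of \<open>T\<close>.\<close>

lemma U_aux:
  "(\<forall>z x. Re z > 0 \<longrightarrow> (\<exists>v. ((\<lambda>w. U n w x) has_derivative (\<lambda>h. sc h v)) (at z))) \<and>
   (\<forall>z w x. Re z > 0 \<longrightarrow> Re w > 0 \<longrightarrow> U n (z + w) x = T w (U n z x))"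
proof (induction n)
  case 0
  have "U 0 (z + w) x = T w (U 0 z x)" if "Re z > 0" "Re w > 0" for z w x
    using T_add[OF that(2,1)] by (simp add: add.commute)
  then show ?case using hol unfolding holomorphic_semigroup_def by simp
next
  case (Suc n)
  have D: "((\<lambda>w. U n w x) has_derivative (\<lambda>h. sc h (- U (Suc n) z x))) (at z)" if "Re z > 0" for z x
    using someI_ex[of "\<lambda>v. ((\<lambda>w. U n w x) has_derivative (\<lambda>h. sc h v)) (at z)"] Suc that by simp
  have shift: "U (Suc n) (z + w) x = T w (U (Suc n) z x)" if zw: "Re z > 0" "Re w > 0" for z w x
  proof -
    have "((\<lambda>u. U n (u - w) x) has_derivative (\<lambda>h. sc h (- U (Suc n) z x))) (at (z + w))"
      by (rule has_derivative_shift) (use D[OF zw(1)] in simp)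
    then have "((\<lambda>u. T w (U n (u - w) x)) has_derivative (\<lambda>h. T w (sc h (- U (Suc n) z x)))) (at (z + w))"
      by (rule bounded_linear.has_derivative[OF T_bounded_linear[OF zw(2)]])
    then have "((\<lambda>u. U n u x) has_derivative (\<lambda>h. T w (sc h (- U (Suc n) z x)))) (at (z + w))"
    proof (rule has_derivative_transform_within_open[where s = "{u. Re u > Re w}"])
      show "open {u. Re u > Re w}" by (rule open_halfspace_Re_gt)
      show "z + w \<in> {u. Re u > Re w}" using zw by simp
      fix u assume "u \<in> {u. Re u > Re w}"
      then have "U n ((u - w) + w) x = T w (U n (u - w) x)"
        using Suc zw by (metis (no_types, lifting) diff_gt_0_iff_gt mem_Collect_eq minus_complex.simps(1))
      then show "T w (U n (u - w) x) = U n u x" by simp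
    qed
    then have "((\<lambda>u. U n u x) has_derivative (\<lambda>h. sc h (T w (- U (Suc n) z x)))) (at (z + w))"
      by (simp add: T_sc[OF zw(2)])
    then have "T w (- U (Suc n) z x) = - U (Suc n) (z + w) x"
      using D[of "z + w" x] zw by (intro orbit_deriv_unique) auto
    moreover have "T w (- U (Suc n) z x) = - T w (U (Suc n) z x)"
      using linear_neg[OF bounded_linear.linear[OF T_bounded_linear[OF zw(2)]]] .
    ultimately show ?thesis by simp
  qed
  have "\<exists>v. ((\<lambda>w. U (Suc n) w x) has_derivative (\<lambda>h. sc h v)) (at z)" if z: "Re z > 0" for z x
  proof -
    \<comment> \<open>Any point strictly between 0 and \<open>z\<close> in real part would serve as
      the base point.\<close>
    define z0 where "z0 = z / 2"
    have z0: "Re z0 > 0" "Re (z - z0) > 0" using z by (auto simp: z0_def)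
    obtain v where "((\<lambda>w. T w (U (Suc n) z0 x)) has_derivative (\<lambda>h. sc h v)) (at (z - z0))"
      using hol z0 unfolding holomorphic_semigroup_def by blast
    then have "((\<lambda>u. T (u - z0) (U (Suc n) z0 x)) has_derivative (\<lambda>h. sc h v)) (at z)"
      by (rule has_derivative_shift)
    then have "((\<lambda>u. U (Suc n) u x) has_derivative (\<lambda>h. sc h v)) (at z)"
    proof (rule has_derivative_transform_within_open[where s = "{u. Re u > Re z0}"])
      show "open {u. Re u > Re z0}" by (rule open_halfspace_Re_gt)
      show "z \<in> {u. Re u > Re z0}" using z0 by simp
      fix u assume "u \<in> {u. Re u > Re z0}"
      then show "T (u - z0) (U (Suc n) z0 x) = U (Suc n) u x"
        using shift[OF z0(1), of "u - z0" x] by (simp del: orbit_deriv.simps)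
    qed
    then show ?thesis by blast
  qed
  then show ?case using shift by blast
qed

lemma U_has_derivative:
  "Re z > 0 \<Longrightarrow> ((\<lambda>w. U n w x) has_derivative (\<lambda>h. sc h (- U (Suc n) z x))) (at z)"
  using someI_ex[of "\<lambda>v. ((\<lambda>w. U n w x) has_derivative (\<lambda>h. sc h v)) (at z)"] U_aux[of n] by simp

lemma U_add: "Re z > 0 \<Longrightarrow> Re w > 0 \<Longrightarrow> U n (z + w) x = T w (U n z x)"
  using U_aux[of n] by blast

lemma U_has_vector_derivative:
  assumes "s > 0"
  shows "((\<lambda>s. U n (of_real s) x) has_vector_derivative - U (Suc n) (of_real s) x) (at s)"
proof -
  have "(of_real has_derivative (\<lambda>h. complex_of_real h)) (at s)"
    by (auto intro!: derivative_eq_intros)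
  from has_derivative_compose[OF this U_has_derivative[of "of_real s" n x]] assms
  have "((\<lambda>s. U n (of_real s) x) has_derivative (\<lambda>h. sc (of_real h) (- U (Suc n) (of_real s) x))) (at s)"
    by simp
  then show ?thesis unfolding has_vector_derivative_def sc_of_real .
qed

lemma U_continuous: "continuous_on {0<..} (\<lambda>s. U n (of_real s) x)"
  by (intro continuous_at_imp_continuous_on ballI
      has_vector_derivative_continuous[OF U_has_vector_derivative]) auto

lemma U_shift_continuous:
  assumes "u \<ge> 0"
  shows "continuous_on {0<..} (\<lambda>s. U n (of_real (s + u)) x)"
  by (rule continuous_on_compose2[OF U_continuous]) (use assms in \<open>auto intro!: continuous_intros\<close>)

lemma functional_orbit:
  assumes f: "bounded_linear f" "\<And>c x. f (sc c x) = c * f x"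
  shows "(\<lambda>z. f (T z x)) holomorphic_on {z. Re z > 0}"
    and "Re z > 0 \<Longrightarrow> (deriv ^^ n) (\<lambda>z. f (T z x)) z = (-1) ^ n * f (U n z x)"
proof -
  have D: "((\<lambda>w. f (U n w x)) has_field_derivative - f (U (Suc n) z x)) (at z)" if "Re z > 0" for n z
  proof -
    have "((\<lambda>w. f (U n w x)) has_derivative (\<lambda>h. f (sc h (- U (Suc n) z x)))) (at z)"
      by (rule bounded_linear.has_derivative[OF f(1) U_has_derivative[OF that]])
    then have "((\<lambda>w. f (U n w x)) has_derivative (\<lambda>h. h * f (- U (Suc n) z x))) (at z)"
      unfolding f(2) .
    moreover have "f (- U (Suc n) z x) = - f (U (Suc n) z x)"
      by (rule linear_neg[OF bounded_linear.linear[OF f(1)]])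
    ultimately show ?thesis by (simp add: has_field_derivative_def mult_commute_abs)
  qed
  show "(\<lambda>z. f (T z x)) holomorphic_on {z. Re z > 0}"
    unfolding holomorphic_on_open[OF open_halfspace_Re_gt] using D[of _ 0] by auto
  show "(deriv ^^ n) (\<lambda>z. f (T z x)) z = (-1) ^ n * f (U n z x)" if "Re z > 0" using that
  proof (induction n arbitrary: z)
    case (Suc n)
    have "eventually (\<lambda>w. w \<in> {z. Re z > 0}) (nhds z)"
      using Suc.prems by (intro eventually_nhds_in_open open_halfspace_Re_gt) auto
    then have "eventually (\<lambda>w. (deriv ^^ n) (\<lambda>z. f (T z x)) w = (-1) ^ n * f (U n w x)) (nhds z)"
      by eventually_elim (use Suc.IH in auto)
    then have "(deriv ^^ Suc n) (\<lambda>z. f (T z x)) z = deriv (\<lambda>w. (-1) ^ n * f (U n w x)) z"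
      by (simp add: deriv_cong_ev)
    also have "\<dots> = (-1) ^ n * - f (U (Suc n) z x)"
      by (intro DERIV_imp_deriv DERIV_cmult D Suc.prems)
    finally show ?case by (simp del: orbit_deriv.simps)
  qed simp
qed

lemma functional_orbit_bound:
  fixes f :: "'a \<Rightarrow> complex"
  assumes "\<And>x. norm (f x) \<le> 2 * norm x" "Re z > 0"
  shows "norm (f (T z x)) \<le> (2 * K * norm x) * (norm z / Re z) ^ N"
  using order_trans[OF assms(1) mult_left_mono[OF T_bound[OF assms(2)]]] by (simp add: mult_ac)

text \<open>The constant of Cauchy's inequality on the circle of centre \<open>s\<close> and radius \<open>s (n+1)/(n+2)\<close>.\<close>

definition ub :: "nat \<Rightarrow> real" where
  "ub n = fact n * (6 * K * (2 * (real n + 2)) ^ N)"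

lemma ub_pos: "ub n > 0" using K by (simp add: ub_def)

text \<open>The radius s (n+1)/(n+2) keeps the loss in s^(-n) below 3 and costs only a factor
  polynomial in \<open>n\<close>. A radius that is a fixed fraction of \<open>s\<close> would cost
  an exponential factor, too much for the decay by powers of \<open>m\<close> in the smoothing
  estimates.\<close>

lemma U_bound:
  assumes s: "s > 0"
  shows "norm (U n (of_real s) x) \<le> ub n / s ^ n * norm x"
proof -
  obtain f :: "'a \<Rightarrow> complex" where f: "bounded_linear f" "\<And>c x. f (sc c x) = c * f x"
    "\<And>x. norm (f x) \<le> 2 * norm x" "norm (U n (of_real s) x) \<le> norm (f (U n (of_real s) x))"
    using complex_norming_functional[OF sc, of "U n (of_real s) x"] by blast
  define q where "q = (real n + 1) / (real n + 2)"
  define r where "r = s * q"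
  have q: "0 < q" "1 - q = 1 / (real n + 2)" "q < 1" by (auto simp: q_def field_simps)
  have r: "0 < r" "r < s" "s - r = s / (real n + 2)"
    using q s unfolding r_def by (auto simp: right_diff_distrib[of s 1 q, simplified, symmetric])
  have re: "Re w \<ge> s / (real n + 2)" if "norm (complex_of_real s - w) \<le> r" for w
    using abs_Re_le_cmod[of "of_real s - w"] that r(3) by simp
  have pos: "s / (real n + 2) > 0" using s by simp
  have sub: "cball (of_real s) r \<subseteq> {z. Re z > 0}"
    using re pos by (fastforce simp: dist_norm)
  note hol = functional_orbit(1)[OF f(1,2)]
  have "norm ((deriv ^^ n) (\<lambda>z. f (T z x)) (of_real s)) \<le> fact n * (2 * K * norm x * (2 * (real n + 2)) ^ N) / r ^ n"
  proof (rule Cauchy_inequality)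
    show "(\<lambda>z. f (T z x)) holomorphic_on ball (of_real s) r"
      using sub ball_subset_cball[of "complex_of_real s" r] by (intro holomorphic_on_subset[OF hol]) blast
    show "continuous_on (cball (of_real s) r) (\<lambda>z. f (T z x))"
      using sub by (intro holomorphic_on_imp_continuous_on holomorphic_on_subset[OF hol])
    fix w assume w: "norm (complex_of_real s - w) = r"
    then have Rew: "Re w \<ge> s / (real n + 2)" "Re w > 0" using re[of w] pos by auto
    have "norm w \<le> norm (complex_of_real s) + norm (of_real s - w)"
      using norm_triangle_ineq4[of "of_real s" "of_real s - w"] by simp
    also have "\<dots> \<le> 2 * s" using w r s by simp
    also have "\<dots> = 2 * (real n + 2) * (s / (real n + 2))" by (simp add: field_simps)
    also have "\<dots> \<le> 2 * (real n + 2) * Re w" using Rew by (intro mult_left_mono) auto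
    finally have "norm w / Re w \<le> 2 * (real n + 2)" using Rew by (simp add: divide_le_eq)
    then have "(2 * K * norm x) * (norm w / Re w) ^ N \<le> (2 * K * norm x) * (2 * (real n + 2)) ^ N"
      using K Rew by (intro mult_left_mono power_mono) auto
    then show "norm (f (T w x)) \<le> 2 * K * norm x * (2 * (real n + 2)) ^ N"
      using functional_orbit_bound[OF f(3) Rew(2), of x] by linarith
  qed (rule r)
  moreover have "(deriv ^^ n) (\<lambda>z. f (T z x)) (of_real s) = (-1) ^ n * f (U n (of_real s) x)"
    using s by (intro functional_orbit f) auto
  ultimately have "norm (U n (of_real s) x) \<le> fact n * (2 * K * norm x * (2 * (real n + 2)) ^ N) / r ^ n"
    using f(4) by (simp add: norm_mult norm_power)
  also have "\<dots> = (1 / q ^ n) * (fact n * (2 * K * norm x * (2 * (real n + 2)) ^ N) / s ^ n)"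
    by (simp add: r_def power_mult_distrib)
  also have "\<dots> \<le> 3 * (fact n * (2 * K * norm x * (2 * (real n + 2)) ^ N) / s ^ n)"
  proof (rule mult_right_mono)
    have "1 / q ^ n = (1 + 1 / real (n + 1)) ^ n"
      by (simp add: q_def power_one_over[symmetric] field_simps)
    also have "\<dots> \<le> (1 + 1 / real (n + 1)) ^ (n + 1)" by (intro power_increasing) auto
    also have "\<dots> \<le> exp 1" by (rule exp_ge_one_plus_x_over_n_power_n) auto
    also have "\<dots> \<le> 3" by (rule exp_le)
    finally show "1 / q ^ n \<le> 3" .
  qed (use K s in auto)
  finally show ?thesis by (simp add: ub_def mult_ac)
qed

lemma U_bound_powr: "s > 0 \<Longrightarrow> norm (U n (of_real s) x) \<le> (ub n * norm x) * s powr - real n"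
  using U_bound[of s n x] by (simp add: powr_minus powr_realpow divide_inverse mult_ac)

text \<open>Weight exponent \<open>p\<close> and derivative order \<open>n\<close> are separate
  because the generator raises \<open>n\<close> and keeps \<open>p\<close>; the shift
  \<open>u\<close> records an application of T(u), as \<open>T_J\<close> shows.\<close>

definition J :: "real \<Rightarrow> nat \<Rightarrow> real \<Rightarrow> 'a \<Rightarrow> 'a" where
  "J p n u x = integral {0<..} (\<lambda>s. (s powr p * exp (- s)) *\<^sub>R U n (of_real (s + u)) x)"

lemma J0_props:
  assumes "p - real n > -1"
  shows "(\<lambda>s. (s powr p * exp (- s)) *\<^sub>R U n (of_real s) x) integrable_on {0<..}"
    and "norm (J p n 0 x) \<le> ub n * norm x * Gamma (p - real n + 1)"
    and "(\<lambda>k. integral {1 / real (Suc k)..real (Suc k)} (\<lambda>s. (s powr p * exp (- s)) *\<^sub>R U n (of_real s) x))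
      \<longlonglongrightarrow> J p n 0 x"
  using weighted_integrable[OF U_continuous U_bound_powr, of p n x] assms by (auto simp: J_def)

lemma T_J:
  assumes "p - real n > -1" "u > 0"
  shows "T (of_real u) (J p n 0 x) = J p n u x"
proof -
  interpret bounded_linear "T (of_real u)" using assms by (intro T_bounded_linear) auto
  have "T (of_real u) (J p n 0 x) = integral {0<..} (\<lambda>s. T (of_real u) ((s powr p * exp (- s)) *\<^sub>R U n (of_real s) x))"
    unfolding J_def using integral_linear[OF J0_props(1)[OF assms(1)] bounded_linear_axioms]
    by (simp add: o_def)
  also have "\<dots> = J p n u x"
    unfolding J_def
  proof (rule Henstock_Kurzweil_Integration.integral_cong)
    fix s :: real assume "s \<in> {0<..}"
    then show "T (of_real u) ((s powr p * exp (- s)) *\<^sub>R U n (of_real s) x)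
        = (s powr p * exp (- s)) *\<^sub>R U n (of_real (s + u)) x"
      using assms U_add[of "of_real s" "of_real u" n x] by (simp add: scaleR)
  qed
  finally show ?thesis .
qed

end

section \<open>Powers of the generator and fractional resolvents\<close>

text \<open>Euler's sequence for Gamma(\<alpha>+1) converges, hence is bounded; its terms contain
  exactly n! n^(\<alpha>+1) over a Pochhammer product, which is a quotient of Gamma values.\<close>

lemma Gamma_ratio_bound:
  fixes \<alpha> :: real
  assumes \<alpha>: "\<alpha> > -1"
  shows "\<exists>C>0. \<forall>n\<ge>1. fact (n - 1) / Gamma (real n + \<alpha> + 1) \<le> C / real n powr (\<alpha> + 1)"
proof -
  have pos: "Gamma (\<alpha> + 1) > 0" "\<And>n. pochhammer (\<alpha> + 1) n > 0"
    using \<alpha> by (auto intro!: Gamma_real_pos pochhammer_pos)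
  have "convergent (Gamma_series (\<alpha> + 1))"
    using Gamma_series_LIMSEQ convergentI by blast
  then obtain B where B: "B > 0" "\<And>n. norm (Gamma_series (\<alpha> + 1) n) \<le> B"
    using convergent_imp_Bseq BseqE by metis
  have "fact (n - 1) / Gamma (real n + \<alpha> + 1) \<le> (B * (\<alpha> + 2) / Gamma (\<alpha> + 1)) / real n powr (\<alpha> + 1)"
    if n: "n \<ge> 1" for n
  proof -
    define P where "P = pochhammer (\<alpha> + 1) n"
    define y where "y = real n powr (\<alpha> + 1)"
    have y: "y > 0" and P: "P > 0" and f: "(fact (n - 1) :: real) > 0"
      using n pos by (auto simp: y_def P_def)
    have G: "Gamma (real n + \<alpha> + 1) = P * Gamma (\<alpha> + 1)"
    proof -
      have "pochhammer (\<alpha> + 1) n = Gamma (\<alpha> + 1 + real n) / Gamma (\<alpha> + 1)"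
        using \<alpha> by (intro pochhammer_Gamma) (auto elim!: nonpos_Ints_cases)
      then show ?thesis using pos by (simp add: P_def field_simps)
    qed
    have "Gamma_series (\<alpha> + 1) n = fact n * y / (P * (\<alpha> + 1 + real n))"
      using n by (simp add: Gamma_series_def y_def P_def pochhammer_Suc powr_def mult.commute)
    moreover have "Gamma_series (\<alpha> + 1) n \<le> B"
      using B(2)[of n] by (simp only: real_norm_def abs_le_iff)
    ultimately have "fact n * y / (P * (\<alpha> + 1 + real n)) \<le> B" by simp
    moreover have "P * (\<alpha> + 1 + real n) > 0" using P \<alpha> by simp
    ultimately have "fact n * y \<le> B * (P * (\<alpha> + 1 + real n))" by (simp add: divide_le_eq)
    also have "\<dots> \<le> B * (P * ((\<alpha> + 2) * real n))"
    proof -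
      have "\<alpha> + 1 \<le> (\<alpha> + 1) * real n" using \<alpha> n mult_left_mono[of 1 "real n" "\<alpha> + 1"] by simp
      then have "\<alpha> + 1 + real n \<le> (\<alpha> + 2) * real n" by (simp add: algebra_simps)
      then show ?thesis using B P by (intro mult_left_mono) auto
    qed
    finally have "real n * (fact (n - 1) * y) \<le> real n * (B * (P * (\<alpha> + 2)))"
      using fact_reduce[of n, where ?'a = real] n by (simp add: mult_ac)
    then have "fact (n - 1) * y \<le> B * (P * (\<alpha> + 2))" using n by simp
    then have "fact (n - 1) / P \<le> B * (\<alpha> + 2) / y" using P y by (simp add: field_simps)
    then have "fact (n - 1) / P / Gamma (\<alpha> + 1) \<le> B * (\<alpha> + 2) / y / Gamma (\<alpha> + 1)"
      using pos by (intro divide_right_mono) auto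
    then show ?thesis unfolding G y_def by (simp add: mult_ac)
  qed
  then show ?thesis using B \<alpha> pos by (intro exI[of _ "B * (\<alpha> + 2) / Gamma (\<alpha> + 1)"]) auto
qed

context hg_semigroup
begin

text \<open>Interpolates between a bound of order s^(-n-1) without gain and one of order \<tau>
  s^(-n-2). The second may be too singular at s = 0 for the available weight; a small power
  \<tau>^\<delta> keeps integrability and still tends to 0.\<close>

lemma U_difference_quotient_bound:
  assumes s: "s > 0" and \<tau>: "\<tau> > 0" and \<delta>: "0 < \<delta>" "\<delta> \<le> 1"
  shows "norm ((1 / \<tau>) *\<^sub>R (U n (of_real (s + \<tau>)) x - U n (of_real s) x) + U (Suc n) (of_real s) x)
    \<le> (2 * ub (Suc n) + ub (Suc (Suc n))) * norm x * \<tau> powr \<delta> * s powr (- real n - 1 - \<delta>)"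
proof -
  define M where "M = (2 * ub (Suc n) + ub (Suc (Suc n))) * norm x"
  define Q where "Q = (1 / \<tau>) *\<^sub>R (U n (of_real (s + \<tau>)) x - U n (of_real s) x) + U (Suc n) (of_real s) x"
  define A where "A = 1 / s ^ Suc n"
  have M: "ub (Suc n) * norm x \<ge> 0" "ub (Suc (Suc n)) * norm x \<ge> 0"
    using ub_pos[of "Suc n"] ub_pos[of "Suc (Suc n)"] by auto
  have A: "A > 0" using s by (simp add: A_def)
  have lip: "norm (U k (of_real (s + r)) x - U k (of_real s) x) \<le> ub (Suc k) * norm x / s ^ Suc k * r"
    if r: "r \<ge> 0" for k r
  proof -
    have "norm (U k (of_real (s + r)) x - U k (of_real s) x) \<le> (ub (Suc k) / s ^ Suc k * norm x) * norm ((s + r) - s)"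
    proof (rule differentiable_bound[where S = "{s..s+r}"])
      fix v assume v: "v \<in> {s..s + r}"
      show "((\<lambda>v. U k (of_real v) x) has_derivative (\<lambda>h. h *\<^sub>R (- U (Suc k) (of_real v) x))) (at v within {s..s + r})"
        using U_has_vector_derivative[of v k x] v s unfolding has_vector_derivative_def
        by (auto intro: has_derivative_at_withinI)
      have "norm (U (Suc k) (of_real v) x) \<le> ub (Suc k) / v ^ Suc k * norm x"
        using v s by (intro U_bound) auto
      also have "\<dots> \<le> ub (Suc k) / s ^ Suc k * norm x"
        using v s ub_pos[of "Suc k"] by (intro mult_right_mono divide_left_mono power_mono) auto
      finally show "onorm (\<lambda>h. h *\<^sub>R (- U (Suc k) (of_real v) x)) \<le> ub (Suc k) / s ^ Suc k * norm x"
        by (subst onorm_scaleR_left) (auto simp: bounded_linear_ident onorm_id simp del: orbit_deriv.simps)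
    qed (use r in auto)
    then show ?thesis using r by (simp add: mult_ac)
  qed
  have b1: "norm Q \<le> M * A"
  proof -
    have "norm Q \<le> norm ((1 / \<tau>) *\<^sub>R (U n (of_real (s + \<tau>)) x - U n (of_real s) x)) + norm (U (Suc n) (of_real s) x)"
      unfolding Q_def by (rule norm_triangle_ineq)
    also have "\<dots> \<le> (1 / \<tau>) * (ub (Suc n) * norm x / s ^ Suc n * \<tau>) + ub (Suc n) / s ^ Suc n * norm x"
      unfolding norm_scaleR using lip[of \<tau> n] \<tau>
      by (intro add_mono mult_mono U_bound[OF s]) auto
    also have "\<dots> = 2 * (ub (Suc n) * norm x) * A" using \<tau> by (simp add: A_def)
    also have "\<dots> \<le> M * A" using M A by (intro mult_right_mono) (auto simp: M_def algebra_simps)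
    finally show ?thesis .
  qed
  have b2: "norm Q \<le> M * A * (\<tau> / s)"
  proof -
    define G where "G = (\<lambda>r. U n (of_real (s + r)) x + r *\<^sub>R U (Suc n) (of_real s) x)"
    have "norm (G \<tau> - G 0) \<le> (ub (Suc (Suc n)) * norm x / s ^ Suc (Suc n) * \<tau>) * norm (\<tau> - 0)"
    proof (rule differentiable_bound[where S = "{0..\<tau>}"])
      fix r assume r: "r \<in> {0..\<tau>}"
      have "((\<lambda>r. s + r) has_vector_derivative 1) (at r)" by (auto intro!: derivative_eq_intros)
      then have "((\<lambda>r. U n (of_real (s + r)) x) has_vector_derivative 1 *\<^sub>R (- U (Suc n) (of_real (s + r)) x)) (at r)"
        using vector_diff_chain_at[of "\<lambda>r. s + r" 1 r "\<lambda>s. U n (of_real s) x"]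
          U_has_vector_derivative[of "s + r" n x] s r by (simp add: o_def del: orbit_deriv.simps of_real_add)
      then have "(G has_vector_derivative - U (Suc n) (of_real (s + r)) x + U (Suc n) (of_real s) x) (at r)"
        unfolding G_def by (auto intro!: derivative_eq_intros simp del: orbit_deriv.simps)
      then show "(G has_derivative (\<lambda>h. h *\<^sub>R (- U (Suc n) (of_real (s + r)) x + U (Suc n) (of_real s) x))) (at r within {0..\<tau>})"
        unfolding has_vector_derivative_def by (rule has_derivative_at_withinI)
      have "norm (- U (Suc n) (of_real (s + r)) x + U (Suc n) (of_real s) x) \<le> ub (Suc (Suc n)) * norm x / s ^ Suc (Suc n) * r"
        using lip[of r "Suc n"] r by (simp add: norm_minus_commute del: orbit_deriv.simps power_Suc)
      also have "\<dots> \<le> ub (Suc (Suc n)) * norm x / s ^ Suc (Suc n) * \<tau>"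
        using r s M by (intro mult_left_mono) auto
      finally show "onorm (\<lambda>h. h *\<^sub>R (- U (Suc n) (of_real (s + r)) x + U (Suc n) (of_real s) x))
          \<le> ub (Suc (Suc n)) * norm x / s ^ Suc (Suc n) * \<tau>"
        by (subst onorm_scaleR_left) (auto simp: bounded_linear_ident onorm_id simp del: orbit_deriv.simps)
    qed (use \<tau> in auto)
    moreover have "G \<tau> - G 0 = \<tau> *\<^sub>R Q" using \<tau> by (simp add: G_def Q_def algebra_simps)
    ultimately have "\<tau> * norm Q \<le> \<tau> * (ub (Suc (Suc n)) * norm x / s ^ Suc (Suc n) * \<tau>)"
      using \<tau> by (simp add: mult_ac)
    then have "norm Q \<le> ub (Suc (Suc n)) * norm x / s ^ Suc (Suc n) * \<tau>"
      using mult_le_cancel_left_pos[OF \<tau>] by blast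
    also have "\<dots> = ub (Suc (Suc n)) * norm x * (A * (\<tau> / s))" by (simp add: A_def)
    also have "\<dots> \<le> M * (A * (\<tau> / s))"
      using M A \<tau> s by (intro mult_right_mono) (auto simp: M_def algebra_simps)
    finally show ?thesis by simp
  qed
  have M0: "M \<ge> 0" using M by (simp add: M_def algebra_simps)
  \<comment> \<open>Combines \<open>b1\<close> and \<open>b2\<close> through min(1, v) <= v^\<delta>
    for 0 < \<delta> <= 1.\<close>
  have "norm Q \<le> M * A * (\<tau> / s) powr \<delta>"
  proof (cases "\<tau> / s \<ge> 1")
    case True
    then have "1 \<le> (\<tau> / s) powr \<delta>" using \<delta> by (simp add: ge_one_powr_ge_zero)
    then have "M * A * 1 \<le> M * A * (\<tau> / s) powr \<delta>" using M0 A by (intro mult_left_mono) auto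
    then show ?thesis using b1 by linarith
  next
    case False
    then have "(\<tau> / s) powr 1 \<le> (\<tau> / s) powr \<delta>" using \<delta> \<tau> s by (intro powr_mono') auto
    then have "M * A * (\<tau> / s) \<le> M * A * (\<tau> / s) powr \<delta>"
      using M0 A \<tau> s by (intro mult_left_mono) auto
    then show ?thesis using b2 by linarith
  qed
  also have "\<dots> = M * \<tau> powr \<delta> * s powr (- real n - 1 - \<delta>)"
  proof -
    have "A = s powr (- real n - 1)"
      using s by (simp add: A_def powr_diff powr_minus powr_realpow field_simps)
    moreover have "(\<tau> / s) powr \<delta> = \<tau> powr \<delta> * s powr - \<delta>"
      using \<tau> s by (simp add: powr_divide powr_minus_divide)
    moreover have "s powr (- real n - 1 - \<delta>) = s powr (- real n - 1) * s powr - \<delta>"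
      using powr_add[of s "- real n - 1" "- \<delta>"] by simp
    ultimately show ?thesis by simp
  qed
  finally show ?thesis by (simp add: Q_def M_def)
qed

lemma J_difference_quotient_tendsto:
  assumes p: "p - real (Suc n) > -1"
  shows "((\<lambda>\<tau>. (1 / \<tau>) *\<^sub>R (T (of_real \<tau>) (J p n 0 x) - J p n 0 x)) \<longlongrightarrow> - J p (Suc n) 0 x) (at_right 0)"
proof -
  define q where "q = p - real (Suc n)"
  \<comment> \<open>At most half of the margin q + 1 > 0 is spent, so s^(q-\<delta>) is still
    integrable at 0.\<close>
  define \<delta> where "\<delta> = min 1 ((q + 1) / 2)"
  have \<delta>: "0 < \<delta>" "\<delta> \<le> 1" "q - \<delta> > -1" using p by (auto simp: \<delta>_def q_def min_def field_simps)
  define M where "M = (2 * ub (Suc n) + ub (Suc (Suc n))) * norm x"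
  have p': "p - real n > -1" using p by simp
  have est: "norm ((1 / \<tau>) *\<^sub>R (T (of_real \<tau>) (J p n 0 x) - J p n 0 x) - (- J p (Suc n) 0 x)) \<le> M * \<tau> powr \<delta> * Gamma (q - \<delta> + 1)"
    if \<tau>: "\<tau> > 0" for \<tau>
  proof -
    define w where "w = (\<lambda>s::real. s powr p * exp (- s))"
    have i0: "(\<lambda>s. w s *\<^sub>R U n (of_real s) x) integrable_on {0<..}"
      "(\<lambda>s. w s *\<^sub>R U (Suc n) (of_real s) x) integrable_on {0<..}"
      unfolding w_def using p p' by (intro J0_props(1); simp)+
    have i1: "(\<lambda>s. w s *\<^sub>R U n (of_real (s + \<tau>)) x) integrable_on {0<..}"
    proof -
      interpret bounded_linear "T (of_real \<tau>)" using \<tau> by (intro T_bounded_linear) auto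
      have "(T (of_real \<tau>) \<circ> (\<lambda>s. w s *\<^sub>R U n (of_real s) x)) integrable_on {0<..}"
        by (rule integrable_linear[OF i0(1) bounded_linear_axioms])
      then show ?thesis
        by (rule integrable_eq) (use U_add[of _ "of_real \<tau>" n x] \<tau> in \<open>auto simp: scaleR\<close>)
    qed
    have Jw: "J p k u x = integral {0<..} (\<lambda>s. w s *\<^sub>R U k (of_real (s + u)) x)" for k u
      by (simp add: J_def w_def)
    have "(1 / \<tau>) *\<^sub>R (T (of_real \<tau>) (J p n 0 x) - J p n 0 x) - (- J p (Suc n) 0 x)
        = (1 / \<tau>) *\<^sub>R (J p n \<tau> x - J p n 0 x) + J p (Suc n) 0 x"
      using T_J[OF p' \<tau>] by simp
    also have "\<dots> = integral {0<..} (\<lambda>s. (1 / \<tau>) *\<^sub>R (w s *\<^sub>R U n (of_real (s + \<tau>)) x - w s *\<^sub>R U n (of_real s) x)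
        + w s *\<^sub>R U (Suc n) (of_real s) x)"
      unfolding Jw add_0_right using i0 i1
      by (subst Henstock_Kurzweil_Integration.integral_add)
        (auto intro!: integrable_cmul integrable_diff simp: Henstock_Kurzweil_Integration.integral_diff
          simp del: orbit_deriv.simps of_real_add)
    also have "\<dots> = integral {0<..} (\<lambda>s. w s *\<^sub>R ((1 / \<tau>) *\<^sub>R (U n (of_real (s + \<tau>)) x - U n (of_real s) x)
        + U (Suc n) (of_real s) x))"
      by (simp add: algebra_simps del: orbit_deriv.simps of_real_add)
    finally have eq: "(1 / \<tau>) *\<^sub>R (T (of_real \<tau>) (J p n 0 x) - J p n 0 x) - (- J p (Suc n) 0 x)
      = integral {0<..} (\<lambda>s. (s powr p * exp (- s)) *\<^sub>R ((1 / \<tau>) *\<^sub>R (U n (of_real (s + \<tau>)) x - U n (of_real s) x)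
        + U (Suc n) (of_real s) x))" unfolding w_def .
    have "norm (integral {0<..} (\<lambda>s. (s powr p * exp (- s)) *\<^sub>R ((1 / \<tau>) *\<^sub>R (U n (of_real (s + \<tau>)) x - U n (of_real s) x)
        + U (Suc n) (of_real s) x))) \<le> M * \<tau> powr \<delta> * Gamma (p + (- real n - 1 - \<delta>) + 1)"
    proof (rule weighted_integrable(2))
      show "continuous_on {0<..} (\<lambda>s. (1 / \<tau>) *\<^sub>R (U n (of_real (s + \<tau>)) x - U n (of_real s) x) + U (Suc n) (of_real s) x)"
        using \<tau> by (intro continuous_intros U_continuous U_shift_continuous) auto
      show "p + (- real n - 1 - \<delta>) > - 1" using \<delta>(3) by (simp add: q_def)
    qed (use U_difference_quotient_bound[OF _ \<tau> \<delta>(1,2), of _ n x] in \<open>simp add: M_def mult_ac\<close>)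
    also have "p + (- real n - 1 - \<delta>) + 1 = q - \<delta> + 1" by (simp add: q_def)
    finally show ?thesis unfolding eq .
  qed
  have "((\<lambda>\<tau>. M * \<tau> powr \<delta> * Gamma (q - \<delta> + 1)) \<longlongrightarrow> 0) (at_right 0)"
  proof -
    have "((\<lambda>\<tau>::real. \<tau> powr \<delta>) \<longlongrightarrow> 0) (at_right 0)" using \<delta>(1) by real_asymp
    from tendsto_mult_left[OF this, of "M * Gamma (q - \<delta> + 1)"] show ?thesis by (simp add: mult_ac)
  qed
  then have "((\<lambda>\<tau>. (1 / \<tau>) *\<^sub>R (T (of_real \<tau>) (J p n 0 x) - J p n 0 x) - (- J p (Suc n) 0 x)) \<longlongrightarrow> 0) (at_right 0)"
    by (rule Lim_null_comparison[rotated]) (use est in \<open>auto simp: eventually_at_right_less intro!: eventually_at_rightI[of 0 1]\<close>)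
  then show ?thesis by (rule LIM_zero_cancel)
qed

lemma scaled_J_difference_quotient_tendsto:
  assumes p: "p - real (Suc n) > -1"
  shows "((\<lambda>\<tau>. (1 / \<tau>) *\<^sub>R (T (of_real \<tau>) (c *\<^sub>R J p n 0 x) - c *\<^sub>R J p n 0 x)) \<longlongrightarrow> - (c *\<^sub>R J p (Suc n) 0 x)) (at_right 0)"
proof -
  have "((\<lambda>\<tau>. c *\<^sub>R ((1 / \<tau>) *\<^sub>R (T (of_real \<tau>) (J p n 0 x) - J p n 0 x))) \<longlongrightarrow> c *\<^sub>R - J p (Suc n) 0 x) (at_right 0)"
    by (intro tendsto_intros J_difference_quotient_tendsto p)
  moreover have "eventually (\<lambda>\<tau>. c *\<^sub>R ((1 / \<tau>) *\<^sub>R (T (of_real \<tau>) (J p n 0 x) - J p n 0 x))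
      = (1 / \<tau>) *\<^sub>R (T (of_real \<tau>) (c *\<^sub>R J p n 0 x) - c *\<^sub>R J p n 0 x)) (at_right 0)"
  proof (rule eventually_at_rightI[of 0 1])
    fix \<tau> :: real assume "\<tau> \<in> {0<..<1}"
    then interpret bounded_linear "T (of_real \<tau>)" by (intro T_bounded_linear) auto
    show "c *\<^sub>R ((1 / \<tau>) *\<^sub>R (T (of_real \<tau>) (J p n 0 x) - J p n 0 x))
      = (1 / \<tau>) *\<^sub>R (T (of_real \<tau>) (c *\<^sub>R J p n 0 x) - c *\<^sub>R J p n 0 x)"
      by (simp add: scaleR algebra_simps)
  qed simp
  ultimately have "((\<lambda>\<tau>. (1 / \<tau>) *\<^sub>R (T (of_real \<tau>) (c *\<^sub>R J p n 0 x) - c *\<^sub>R J p n 0 x)) \<longlongrightarrow> c *\<^sub>R - J p (Suc n) 0 x) (at_right 0)"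
    by (rule Lim_transform_eventually)
  then show ?thesis by simp
qed

lemma genA_scaled_J:
  assumes "p - real (Suc n) > -1"
  shows "gen_dom T (c *\<^sub>R J p n 0 x)" "genA T (c *\<^sub>R J p n 0 x) = c *\<^sub>R J p (Suc n) 0 x"
proof -
  note l = scaled_J_difference_quotient_tendsto[OF assms, of c x]
  then show "gen_dom T (c *\<^sub>R J p n 0 x)" unfolding gen_dom_def by blast
  show "genA T (c *\<^sub>R J p n 0 x) = c *\<^sub>R J p (Suc n) 0 x"
    unfolding genA_def tendsto_Lim[OF _ l, simplified] by simp
qed

definition lag_coeff :: "real \<Rightarrow> nat \<Rightarrow> 'a \<Rightarrow> 'a" where
  "lag_coeff \<alpha> n x = (1 / Gamma (real n + \<alpha> + 1)) *\<^sub>R J (real n + \<alpha>) n 0 x"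

text \<open>Each application of the generator adds one orbit derivative under the fixed weight
  s^(n+\<alpha>). The worst singularity reached, at k = n, is s^\<alpha>, integrable since \<alpha>
  > -1.\<close>

lemma genA_power_frac_res:
  assumes "\<alpha> > -1" "k \<le> n"
  shows "(genA T ^^ k) (frac_res T (real n + \<alpha> + 1) x) = (1 / Gamma (real n + \<alpha> + 1)) *\<^sub>R J (real n + \<alpha>) k 0 x"
  using assms(2)
proof (induction k)
  case 0
  then show ?case by (simp add: frac_res_def J_def)
next
  case (Suc k)
  then show ?case using assms(1) genA_scaled_J(2)[of "real n + \<alpha>" k] by (simp del: of_nat_Suc)
qed

lemma gen_dom_pow_frac_res:
  assumes "\<alpha> > -1"
  shows "gen_dom_pow T n (frac_res T (real n + \<alpha> + 1) x)"
  unfolding gen_dom_pow_def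
proof (intro allI impI)
  fix k assume k: "k < n"
  have "real n + \<alpha> - real (Suc k) > - 1" using k assms by simp
  then show "gen_dom T ((genA T ^^ k) (frac_res T (real n + \<alpha> + 1) x))"
    using genA_power_frac_res[OF assms, of k n x] k genA_scaled_J(1) by simp
qed

lemma genA_power_frac_res_eq:
  "\<alpha> > -1 \<Longrightarrow> (genA T ^^ n) (frac_res T (real n + \<alpha> + 1) x) = lag_coeff \<alpha> n x"
  using genA_power_frac_res[of \<alpha> n n x] by (simp add: lag_coeff_def)

text \<open>The norming functional depends on \<open>n\<close> and \<open>x\<close>, but
  \<open>C1\<close> does not. Letting \<open>k\<close> tend to infinity removes \<open>err\<close>;
  then (n-2)! n <= 2 (n-1)!, and the Gamma quotient supplies the power of \<open>n\<close>.\<close>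

lemma lag_coeff_bound:
  assumes \<alpha>: "\<alpha> > -1"
  shows "\<exists>C>0. \<forall>n\<ge>1. \<forall>x. norm (lag_coeff \<alpha> n x) \<le> C * norm x / real n powr (\<alpha> + 1)"
proof -
  obtain C1 where C1: "C1 \<ge> 0" "\<And>h B n. h holomorphic_on {z. Re z > 0} \<Longrightarrow>
    (\<And>z. Re z > 0 \<Longrightarrow> norm (h z) \<le> B * (norm z / Re z) ^ N) \<Longrightarrow> n \<ge> 2 \<Longrightarrow>
    \<exists>err. err \<longlonglongrightarrow> 0 \<and> (\<forall>k. norm (integral {1 / real (Suc k)..real (Suc k)}
        (\<lambda>s. of_real (s powr (real n + \<alpha>) * exp (- s)) * (deriv ^^ n) h (of_real s)))
      \<le> C1 * B * fact (n - 2) * real n + err k)"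
  proof -
    obtain C where C: "C \<ge> 0" "\<forall>h B n. h holomorphic_on {z. Re z > 0} \<longrightarrow>
      (\<forall>z. Re z > 0 \<longrightarrow> norm (h z) \<le> B * (norm z / Re z) ^ N) \<longrightarrow> n \<ge> 2 \<longrightarrow>
      (\<exists>err. err \<longlonglongrightarrow> 0 \<and> (\<forall>k. norm (integral {1 / real (Suc k)..real (Suc k)}
          (\<lambda>s. of_real (s powr (real n + \<alpha>) * exp (- s)) * (deriv ^^ n) h (of_real s)))
        \<le> C * B * fact (n - 2) * real n + err k))"
      using weighted_higher_deriv_bound[OF \<alpha>, of N] by (elim exE conjE)
    show thesis
      by (rule that[OF C(1)]) (rule C(2)[THEN spec, THEN spec, THEN spec, THEN mp, THEN mp, THEN mp], auto)
  qed
  obtain C2 where C2: "C2 > 0" "\<And>n. n \<ge> 1 \<Longrightarrow> fact (n - 1) / Gamma (real n + \<alpha> + 1) \<le> C2 / real n powr (\<alpha> + 1)"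
    using Gamma_ratio_bound[OF \<alpha>] by blast
  have G1: "Gamma (\<alpha> + 1) > 0" using \<alpha> by (intro Gamma_real_pos) auto
  \<comment> \<open>In the first term one factor 2 is the norm of the functional, the other comes
    from (n-2)! n <= 2 (n-1)!. The second term covers n = 1, where the circle argument, which starts
    from the second derivative, does not apply.\<close>
  define C3 where "C3 = 4 * K * C1 + ub 1 * Gamma (\<alpha> + 1)"
  have C3: "C3 > 0" using C1 K ub_pos[of 1] G1 unfolding C3_def by (intro add_nonneg_pos mult_pos_pos mult_nonneg_nonneg) auto
  have Jb: "norm (J (real n + \<alpha>) n 0 x) \<le> C3 * norm x * fact (n - 1)" if n: "n \<ge> 1" for n x
  proof (cases "n = 1")
    case True
    have "norm (J (real n + \<alpha>) n 0 x) \<le> ub n * norm x * Gamma (real n + \<alpha> - real n + 1)"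
      using \<alpha> by (intro J0_props(2)) auto
    also have "\<dots> = ub 1 * Gamma (\<alpha> + 1) * norm x" using True by simp
    also have "\<dots> \<le> C3 * norm x" using C1 K by (intro mult_right_mono) (auto simp: C3_def)
    finally show ?thesis using True by simp
  next
    case False
    with n have n2: "n \<ge> 2" by simp
    obtain f :: "'a \<Rightarrow> complex" where f: "bounded_linear f" "\<And>c x. f (sc c x) = c * f x"
      "\<And>x. norm (f x) \<le> 2 * norm x" "norm (J (real n + \<alpha>) n 0 x) \<le> norm (f (J (real n + \<alpha>) n 0 x))"
      using complex_norming_functional[OF sc, of "J (real n + \<alpha>) n 0 x"] by blast
    interpret f: bounded_linear f by fact
    define W where "W = (\<lambda>s. (s powr (real n + \<alpha>) * exp (- s)) *\<^sub>R U n (of_real s) x)"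
    obtain err where err: "err \<longlonglongrightarrow> 0"
      "\<And>k. norm (integral {1 / real (Suc k)..real (Suc k)}
        (\<lambda>s. of_real (s powr (real n + \<alpha>) * exp (- s)) * (deriv ^^ n) (\<lambda>z. f (T z x)) (of_real s)))
      \<le> C1 * (2 * K * norm x) * fact (n - 2) * real n + err k"
      using C1(2)[OF functional_orbit(1)[OF f(1,2)] functional_orbit_bound[OF f(3)] n2, of x] by blast
    have "norm (f (integral {1 / real (Suc k)..real (Suc k)} W)) \<le> C1 * (2 * K * norm x) * fact (n - 2) * real n + err k" for k
    proof -
      have pos: "s > 0" if "s \<in> {1 / real (Suc k)..real (Suc k)}" for s
      proof -
        have "0 < 1 / real (Suc k)" by simp
        also have "\<dots> \<le> s" using that by simp
        finally show ?thesis .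
      qed
      have Wi: "W integrable_on {1 / real (Suc k)..real (Suc k)}"
        unfolding W_def using pos
        by (intro integrable_continuous_real continuous_intros continuous_on_subset[OF U_continuous]) auto
      have "(-1) ^ n * f (integral {1 / real (Suc k)..real (Suc k)} W)
          = integral {1 / real (Suc k)..real (Suc k)} (\<lambda>s. (-1) ^ n * f (W s))"
        using integral_linear[OF Wi f(1)] by (simp add: o_def)
      also have "\<dots> = integral {1 / real (Suc k)..real (Suc k)}
        (\<lambda>s. of_real (s powr (real n + \<alpha>) * exp (- s)) * (deriv ^^ n) (\<lambda>z. f (T z x)) (of_real s))"
      proof (rule Henstock_Kurzweil_Integration.integral_cong)
        fix s assume "s \<in> {1 / real (Suc k)..real (Suc k)}"
        then have "(deriv ^^ n) (\<lambda>z. f (T z x)) (of_real s) = (-1) ^ n * f (U n (of_real s) x)"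
          using pos by (intro functional_orbit f) auto
        then show "(-1) ^ n * f (W s) = of_real (s powr (real n + \<alpha>) * exp (- s)) * (deriv ^^ n) (\<lambda>z. f (T z x)) (of_real s)"
          by (simp add: W_def f.scaleR scaleR_conv_of_real)
      qed
      finally have "norm ((-1) ^ n * f (integral {1 / real (Suc k)..real (Suc k)} W))
        \<le> C1 * (2 * K * norm x) * fact (n - 2) * real n + err k" using err(2)[of k] by simp
      then show ?thesis by (simp add: norm_mult norm_power)
    qed
    moreover have "(\<lambda>k. norm (f (integral {1 / real (Suc k)..real (Suc k)} W))) \<longlonglongrightarrow> norm (f (J (real n + \<alpha>) n 0 x))"
      unfolding W_def using \<alpha> by (intro tendsto_norm f.tendsto J0_props(3)) auto
    moreover have "(\<lambda>k. C1 * (2 * K * norm x) * fact (n - 2) * real n + err k) \<longlonglongrightarrow> C1 * (2 * K * norm x) * fact (n - 2) * real n + 0"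
      by (intro tendsto_intros err)
    ultimately have "norm (f (J (real n + \<alpha>) n 0 x)) \<le> C1 * (2 * K * norm x) * fact (n - 2) * real n + 0"
      by (intro LIMSEQ_le) auto
    also have "\<dots> \<le> C1 * (2 * K * norm x) * (2 * fact (n - 1))"
    proof -
      have "fact (n - 1) = real (n - 1) * fact (n - 2)"
        using fact_reduce[of "n - 1", where ?'a = real] n2 by (simp add: numeral_2_eq_2)
      moreover have "real n \<le> 2 * real (n - 1)" using n2 by (simp add: of_nat_diff)
      ultimately have "fact (n - 2) * real n \<le> 2 * (fact (n - 1) :: real)"
        using mult_left_mono[of "real n" "2 * real (n - 1)" "fact (n - 2)"] by (simp add: mult_ac)
      then have "C1 * (2 * K * norm x) * (fact (n - 2) * real n) \<le> C1 * (2 * K * norm x) * (2 * fact (n - 1))"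
        using C1 K by (intro mult_left_mono) auto
      then show ?thesis by (simp add: mult_ac)
    qed
    also have "\<dots> \<le> C3 * norm x * fact (n - 1)"
    proof -
      have "4 * K * C1 * (norm x * fact (n - 1)) \<le> C3 * (norm x * fact (n - 1))"
        using ub_pos[of 1] G1 by (intro mult_right_mono) (auto simp: C3_def)
      then show ?thesis by (simp add: mult_ac)
    qed
    finally show ?thesis using f(4) by simp
  qed
  show ?thesis
  proof (intro exI[of _ "C3 * C2"] conjI allI impI)
    show "0 < C3 * C2" using C2 C3 by simp
    fix n :: nat and x assume n: "n \<ge> 1"
    have G: "Gamma (real n + \<alpha> + 1) > 0" using \<alpha> by (intro Gamma_real_pos) auto
    have "norm (lag_coeff \<alpha> n x) = norm (J (real n + \<alpha>) n 0 x) / Gamma (real n + \<alpha> + 1)"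
      using G by (simp add: lag_coeff_def)
    also have "\<dots> \<le> C3 * norm x * fact (n - 1) / Gamma (real n + \<alpha> + 1)"
      using G Jb[OF n] by (intro divide_right_mono) auto
    also have "\<dots> = C3 * norm x * (fact (n - 1) / Gamma (real n + \<alpha> + 1))" by simp
    also have "\<dots> \<le> C3 * norm x * (C2 / real n powr (\<alpha> + 1))"
      using C2(2)[OF n] C3 by (intro mult_left_mono) auto
    finally show "norm (lag_coeff \<alpha> n x) \<le> C3 * C2 * norm x / real n powr (\<alpha> + 1)" by (simp add: mult_ac)
  qed
qed

end

section \<open>The Laguerre expansion\<close>

text \<open>One term of the binomial expansion of (1 + e/s)^m, with binomial coefficient at least
  (m/k)^k. It trades the geometric factor, which is not uniform as s grows, for m^(-k) at the price
  of s^k.\<close>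

lemma ratio_power_le:
  fixes s e :: real
  assumes "s \<ge> 0" "e > 0" "1 \<le> k" "k \<le> m"
  shows "(s / (s + e)) ^ m \<le> (real k * s / (e * real m)) ^ k"
proof (cases "s = 0")
  case False
  then have s: "s > 0" using assms by simp
  define y where "y = e / s"
  have y: "y > 0" using s assms by (simp add: y_def)
  have k: "real k > 0" "real m > 0" using assms by auto
  have "(real m / real k) ^ k * y ^ k \<le> of_nat (m choose k) * y ^ k"
    using y binomial_ge_n_over_k_pow_k[OF assms(4), where ?'a = real] by (intro mult_right_mono) auto
  also have "\<dots> \<le> (\<Sum>j\<le>m. of_nat (m choose j) * y ^ j * 1 ^ (m - j))"
    using member_le_sum[of k "{..m}" "\<lambda>j. of_nat (m choose j) * y ^ j"] y assms by simp
  also have "\<dots> = (y + 1) ^ m" by (simp add: binomial_ring)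
  finally have le: "(real m / real k * y) ^ k \<le> (y + 1) ^ m" by (simp only: power_mult_distrib)
  have pos: "(real m / real k * y) ^ k > 0" using y k by simp
  have "(s / (s + e)) ^ m = 1 / (y + 1) ^ m"
    using s assms by (simp add: y_def power_one_over[symmetric] field_simps)
  also have "\<dots> \<le> 1 / (real m / real k * y) ^ k"
    using le pos by (intro divide_left_mono mult_pos_pos) (auto intro: less_le_trans)
  also have "\<dots> = (real k * s / (e * real m)) ^ k"
    using s k assms by (simp add: y_def power_one_over[symmetric] field_simps)
  finally show ?thesis .
qed (use assms in \<open>auto simp: power_0_left\<close>)

text \<open>Integral comparison, done through the mean value theorem for x^(-q) on each unit
  interval.\<close>

lemma sum_powr_tail_le:
  fixes q :: real
  assumes q: "q > 0" and m: "m \<ge> 1" and M: "m \<le> M"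
  shows "(\<Sum>n=Suc m..M. real n powr (- q - 1)) \<le> (real m powr - q - real M powr - q) / q"
  using M
proof (induction M rule: dec_induct)
  case (step M)
  have "\<exists>z. real M < z \<and> z < real (Suc M) \<and> real (Suc M) powr - q - real M powr - q = (real (Suc M) - real M) * (- q * z powr (- q - 1))"
    using m step.hyps by (intro MVT2) (auto intro!: derivative_eq_intros)
  then obtain z where z: "real M < z" "z < real (Suc M)"
    "real (Suc M) powr - q - real M powr - q = - q * z powr (- q - 1)" by auto
  have "real (Suc M) powr (- q - 1) \<le> z powr (- q - 1)"
    using z m step.hyps q by (intro powr_mono2') auto
  also have "z powr (- q - 1) = (real M powr - q - real (Suc M) powr - q) / q"
    using z(3) q by (simp add: field_simps)
  finally have "real (Suc M) powr (- q - 1) \<le> (real M powr - q - real (Suc M) powr - q) / q" .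
  then show ?case using step q by (simp add: field_simps)
qed simp

text \<open>Summation by parts: \<open>a\<close> plays the role of A c_n, and the sums defining
  \<open>L'\<close> cancel every term except the one with the last a(m).\<close>

lemma telescoping_sum:
  fixes a c :: "nat \<Rightarrow> 'a::real_vector"
  assumes "\<And>n. c (Suc n) = a n - a (Suc n)" and "L' 0 = 0"
    and "\<And>n. L' (Suc n) = - (\<Sum>k=0..n. L k)"
  shows "(\<Sum>n=0..m. L' n *\<^sub>R c n + L n *\<^sub>R a n) = (\<Sum>k=0..m. L k) *\<^sub>R a m"
  by (induction m) (simp_all add: assms algebra_simps)

context hg_semigroup
begin

text \<open>For s > 0 the orbit is already differentiable by holomorphy, so its derivative can be
  identified from the right-hand difference quotient, which is T(s) applied to the quotient at
  0.\<close>

lemma T_orbit_derivative_of_generator: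
  assumes lim: "((\<lambda>\<tau>. (1 / \<tau>) *\<^sub>R (T (of_real \<tau>) y - y)) \<longlongrightarrow> - v) (at_right 0)" and s: "s > 0"
  shows "((\<lambda>s. T (of_real s) y) has_vector_derivative - T (of_real s) v) (at s)"
proof -
  interpret bounded_linear "T (of_real s)" using s by (intro T_bounded_linear) auto
  have "((\<lambda>\<tau>. T (of_real s) ((1 / \<tau>) *\<^sub>R (T (of_real \<tau>) y - y) - (- v))) \<longlongrightarrow> T (of_real s) 0) (at_right 0)"
    by (intro tendsto) (use LIM_zero[OF lim] in simp)
  then have "((\<lambda>\<tau>. norm (T (of_real s) ((1 / \<tau>) *\<^sub>R (T (of_real \<tau>) y - y) + v))) \<longlongrightarrow> 0) (at_right 0)"
    by (simp add: zero tendsto_norm_zero)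
  moreover have "eventually (\<lambda>\<tau>. norm (T (of_real s) ((1 / \<tau>) *\<^sub>R (T (of_real \<tau>) y - y) + v)) =
      norm (T (of_real (\<tau> + s)) y - T (of_real s) y - (\<tau> + s - s) *\<^sub>R (- T (of_real s) v)) / norm (\<tau> + s - s)) (at_right 0)"
  proof (rule eventually_at_rightI[of 0 1])
    fix \<tau> :: real assume \<tau>: "\<tau> \<in> {0<..<1}"
    have "T (of_real (\<tau> + s)) y = T (of_real s) (T (of_real \<tau>) y)"
      using T_add[of "of_real s" "of_real \<tau>" y] s \<tau> by (simp add: add.commute)
    then have "T (of_real (\<tau> + s)) y - T (of_real s) y - (\<tau> + s - s) *\<^sub>R (- T (of_real s) v)
        = \<tau> *\<^sub>R T (of_real s) ((1 / \<tau>) *\<^sub>R (T (of_real \<tau>) y - y) + v)"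
      using \<tau> by (simp add: add diff scaleR algebra_simps)
    then show "norm (T (of_real s) ((1 / \<tau>) *\<^sub>R (T (of_real \<tau>) y - y) + v)) =
      norm (T (of_real (\<tau> + s)) y - T (of_real s) y - (\<tau> + s - s) *\<^sub>R (- T (of_real s) v)) / norm (\<tau> + s - s)"
      using \<tau> by simp
  qed simp
  ultimately have "((\<lambda>\<tau>. norm (T (of_real (\<tau> + s)) y - T (of_real s) y - (\<tau> + s - s) *\<^sub>R (- T (of_real s) v)) / norm (\<tau> + s - s)) \<longlongrightarrow> 0) (at_right 0)"
    by (rule Lim_transform_eventually)
  then have "((\<lambda>r. norm (T (of_real r) y - T (of_real s) y - (r - s) *\<^sub>R (- T (of_real s) v)) / norm (r - s)) \<longlongrightarrow> 0) (at_right s)"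
    by (subst filterlim_at_right_to_0)
  then have "((\<lambda>s. T (of_real s) y) has_vector_derivative - T (of_real s) v) (at s within {s<..})"
    unfolding has_vector_derivative_def has_derivative_iff_norm
    by (intro conjI bounded_linear_scaleR_left)
  moreover have D: "((\<lambda>s. T (of_real s) y) has_vector_derivative - U 1 (of_real s) y) (at s)"
    using U_has_vector_derivative[OF s, of 0 y] by simp
  then have "((\<lambda>s. T (of_real s) y) has_vector_derivative - U 1 (of_real s) y) (at s within {s<..})"
    by (rule has_vector_derivative_at_within)
  ultimately have "- T (of_real s) v = - U 1 (of_real s) y"
    by (intro vector_derivative_unique_within) (auto simp: trivial_limit_at_right_real)
  then show ?thesis using D by simp
qed

text \<open>A c_n in integral form. The integrand behaves like s^(\<alpha>-1) at 0, which is where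
  \<alpha> > 0 is used.\<close>

definition lag_coeff_A :: "real \<Rightarrow> nat \<Rightarrow> 'a \<Rightarrow> 'a" where
  "lag_coeff_A \<alpha> n x = (1 / Gamma (real n + \<alpha> + 1)) *\<^sub>R J (real n + \<alpha>) (Suc n) 0 x"

lemma lag_coeff_orbit_derivative:
  assumes "\<alpha> > 0" "s > 0"
  shows "((\<lambda>s. T (of_real s) (lag_coeff \<alpha> n x)) has_vector_derivative - T (of_real s) (lag_coeff_A \<alpha> n x)) (at s)"
  unfolding lag_coeff_def lag_coeff_A_def
  using assms by (intro T_orbit_derivative_of_generator scaled_J_difference_quotient_tendsto) auto

text \<open>Obtained by integrating the derivative of s^q e^(-s) U_j(s) x, whose boundary values
  vanish because q - j > 0. Divided by Gamma(q+1) it is (A+1) A^j (A+1)^(-q-1) = A^j (A+1)^(-q) in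
  integral form.\<close>

lemma J_integration_by_parts:
  assumes q: "q - real (Suc j) > -1"
  shows "J q (Suc j) 0 x + J q j 0 x = q *\<^sub>R J (q - 1) j 0 x"
proof -
  define w where "w = (\<lambda>p s::real. s powr p * exp (- s))"
  define D R where "D = (\<lambda>k. 1 / real (Suc k))" and "R = (\<lambda>k. real (Suc k))"
  define B where "B = (\<lambda>s. w q s *\<^sub>R U j (of_real s) x)"
  have pos: "s > 0" if "s \<in> {D k..R k}" for s k
  proof -
    have "0 < D k" by (simp add: D_def)
    also have "\<dots> \<le> s" using that by simp
    finally show ?thesis .
  qed
  have D0: "D k > 0" for k by (simp add: D_def)
  have DR: "D k \<le> R k" for k by (simp add: D_def R_def field_simps)
  have int: "(\<lambda>s. w p s *\<^sub>R U i (of_real s) x) integrable_on {D k..R k}" for p i k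
    unfolding w_def using pos[of _ k] D0[of k]
    by (intro integrable_continuous_real continuous_intros continuous_on_subset[OF U_continuous]) auto
  have lim: "(\<lambda>k. integral {D k..R k} (\<lambda>s. w p s *\<^sub>R U i (of_real s) x)) \<longlonglongrightarrow> J p i 0 x"
    if "p - real i > -1" for p i
    unfolding w_def D_def R_def by (rule J0_props(3)[OF that])
  have eq: "q *\<^sub>R integral {D k..R k} (\<lambda>s. w (q - 1) s *\<^sub>R U j (of_real s) x)
      - integral {D k..R k} (\<lambda>s. w q s *\<^sub>R U j (of_real s) x)
      - integral {D k..R k} (\<lambda>s. w q s *\<^sub>R U (Suc j) (of_real s) x) = B (R k) - B (D k)" for k
  proof -
    have "((\<lambda>s. q *\<^sub>R (w (q - 1) s *\<^sub>R U j (of_real s) x) - w q s *\<^sub>R U j (of_real s) x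
        - w q s *\<^sub>R U (Suc j) (of_real s) x) has_integral B (R k) - B (D k)) {D k..R k}"
    proof (rule fundamental_theorem_of_calculus[OF DR])
      fix s assume "s \<in> {D k..R k}"
      then have s: "s > 0" by (rule pos)
      have "(w q has_real_derivative q * w (q - 1) s - w q s) (at s)"
        unfolding w_def using s by (auto intro!: derivative_eq_intros simp: algebra_simps)
      from has_vector_derivative_scaleR[OF this U_has_vector_derivative[OF s, of j x]]
      have "(B has_vector_derivative w q s *\<^sub>R (- U (Suc j) (of_real s) x) + (q * w (q - 1) s - w q s) *\<^sub>R U j (of_real s) x) (at s)"
        unfolding B_def .
      then have "(B has_vector_derivative q *\<^sub>R (w (q - 1) s *\<^sub>R U j (of_real s) x) - w q s *\<^sub>R U j (of_real s) x
        - w q s *\<^sub>R U (Suc j) (of_real s) x) (at s)"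
        by (simp add: algebra_simps del: orbit_deriv.simps)
      then show "(B has_vector_derivative q *\<^sub>R (w (q - 1) s *\<^sub>R U j (of_real s) x) - w q s *\<^sub>R U j (of_real s) x
        - w q s *\<^sub>R U (Suc j) (of_real s) x) (at s within {D k..R k})"
        by (rule has_vector_derivative_at_within)
    qed
    moreover have "((\<lambda>s. q *\<^sub>R (w (q - 1) s *\<^sub>R U j (of_real s) x) - w q s *\<^sub>R U j (of_real s) x
        - w q s *\<^sub>R U (Suc j) (of_real s) x) has_integral
        q *\<^sub>R integral {D k..R k} (\<lambda>s. w (q - 1) s *\<^sub>R U j (of_real s) x)
        - integral {D k..R k} (\<lambda>s. w q s *\<^sub>R U j (of_real s) x)
        - integral {D k..R k} (\<lambda>s. w q s *\<^sub>R U (Suc j) (of_real s) x)) {D k..R k}"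
      by (intro has_integral_diff has_integral_cmul integrable_integral int)
    ultimately show ?thesis by (rule has_integral_unique[rotated])
  qed
  have B0: "(\<lambda>k. B (R k)) \<longlonglongrightarrow> 0" "(\<lambda>k. B (D k)) \<longlonglongrightarrow> 0"
  proof -
    define p where "p = q - real j"
    have p: "p > 0" using q by (simp add: p_def)
    define M where "M = ub j * norm x"
    have Bn: "norm (B s) \<le> M * (s powr p * exp (- s))" if "s > 0" for s
    proof -
      have "norm (B s) = s powr q * exp (- s) * norm (U j (of_real s) x)" by (simp add: B_def w_def)
      also have "\<dots> \<le> s powr q * exp (- s) * (M * s powr - real j)"
        unfolding M_def using U_bound_powr[OF that] by (intro mult_left_mono) auto
      also have "\<dots> = M * (s powr (q + - real j) * exp (- s))" unfolding powr_add by (simp add: mult_ac)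
      finally show ?thesis by (simp add: p_def)
    qed
    have "(\<lambda>k. real (Suc k) powr p * exp (- real (Suc k))) \<longlonglongrightarrow> 0" using p by real_asymp
    from tendsto_mult_left[OF this, of M] have "(\<lambda>k. M * (R k powr p * exp (- R k))) \<longlonglongrightarrow> 0" by (simp add: R_def)
    then show "(\<lambda>k. B (R k)) \<longlonglongrightarrow> 0"
      by (rule Lim_null_comparison[rotated]) (intro always_eventually allI Bn, simp add: R_def)
    have "(\<lambda>k. (1 / real (Suc k)) powr p * exp (- (1 / real (Suc k)))) \<longlonglongrightarrow> 0" using p by real_asymp
    from tendsto_mult_left[OF this, of M] have "(\<lambda>k. M * (D k powr p * exp (- D k))) \<longlonglongrightarrow> 0" by (simp add: D_def)
    then show "(\<lambda>k. B (D k)) \<longlonglongrightarrow> 0"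
      by (rule Lim_null_comparison[rotated]) (intro always_eventually allI Bn D0)
  qed
  have "(\<lambda>k. q *\<^sub>R integral {D k..R k} (\<lambda>s. w (q - 1) s *\<^sub>R U j (of_real s) x)
      - integral {D k..R k} (\<lambda>s. w q s *\<^sub>R U j (of_real s) x)
      - integral {D k..R k} (\<lambda>s. w q s *\<^sub>R U (Suc j) (of_real s) x))
      \<longlonglongrightarrow> q *\<^sub>R J (q - 1) j 0 x - J q j 0 x - J q (Suc j) 0 x"
    using q by (intro tendsto_intros lim) auto
  then have "(\<lambda>k. B (R k) - B (D k)) \<longlonglongrightarrow> q *\<^sub>R J (q - 1) j 0 x - J q j 0 x - J q (Suc j) 0 x"
    unfolding eq .
  moreover have "(\<lambda>k. B (R k) - B (D k)) \<longlonglongrightarrow> 0 - 0" by (intro tendsto_intros B0)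
  ultimately have "q *\<^sub>R J (q - 1) j 0 x - J q j 0 x - J q (Suc j) 0 x = 0 - 0"
    by (rule LIMSEQ_unique)
  then show ?thesis by (simp add: algebra_simps)
qed

section \<open>Partial sums and their evolution in time\<close>

lemma lag_coeff_Suc:
  assumes \<alpha>: "\<alpha> > 0"
  shows "lag_coeff \<alpha> (Suc n) x = lag_coeff_A \<alpha> n x - lag_coeff_A \<alpha> (Suc n) x"
proof -
  define q where "q = real (Suc n) + \<alpha>"
  have q: "q > 0" using \<alpha> by (simp add: q_def)
  have G: "Gamma (q + 1) = q * Gamma q" using q by (intro Gamma_plus1) (auto elim!: nonpos_Ints_cases)
  have G0: "Gamma q > 0" using q by (rule Gamma_real_pos)
  have e: "real (Suc n) + \<alpha> + 1 = q + 1" "real n + \<alpha> + 1 = q" "real n + \<alpha> = q - 1" by (auto simp: q_def)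
  have "J q (Suc (Suc n)) 0 x + J q (Suc n) 0 x = q *\<^sub>R J (q - 1) (Suc n) 0 x"
    using \<alpha> by (intro J_integration_by_parts) (simp add: q_def)
  then have "(1 / Gamma (q + 1)) *\<^sub>R J q (Suc (Suc n)) 0 x + (1 / Gamma (q + 1)) *\<^sub>R J q (Suc n) 0 x
      = (q / Gamma (q + 1)) *\<^sub>R J (q - 1) (Suc n) 0 x"
    by (metis (no_types, lifting) scaleR_add_right scaleR_scaleR times_divide_eq_left mult_1)
  also have "q / Gamma (q + 1) = 1 / Gamma q" using q G0 unfolding G by simp
  finally show ?thesis
    unfolding lag_coeff_def lag_coeff_A_def e q_def[symmetric] by (simp add: algebra_simps)
qed

definition lag_sum :: "real \<Rightarrow> nat \<Rightarrow> real \<Rightarrow> 'a \<Rightarrow> 'a" where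
  "lag_sum \<alpha> m s x = (\<Sum>n=0..m. laguerre n \<alpha> s *\<^sub>R lag_coeff \<alpha> n x)"

lemma T_sum_scaleR:
  "s > 0 \<Longrightarrow> T (of_real s) (\<Sum>n=0..m. r n *\<^sub>R c n) = (\<Sum>n=0..m. r n *\<^sub>R T (of_real s) (c n))"
  using T_bounded_linear[of "of_real s"] by (simp add: linear_sum bounded_linear.linear linear_scale)

text \<open>Along \<open>s \<mapsto> T(t + e - s) S_m(s)\<close> all but one term of the derivative telescopes away.\<close>

lemma lag_sum_flow:
  assumes \<alpha>: "\<alpha> > 0" and t: "t > 0" and e: "e > 0" and m: "m \<ge> 1"
  shows "norm (T (of_real e) (lag_sum \<alpha> m t x) - T (of_real (t + e)) (lag_sum \<alpha> m 0 x))
    \<le> 3 * (exp t * real (m + 1) powr (\<alpha> + 2)) * ((K + 1) * norm (T (of_real e) (lag_coeff_A \<alpha> m x))) * t"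
proof -
  define \<Psi> where "\<Psi> = (\<lambda>s. \<Sum>n=0..m. laguerre n \<alpha> s *\<^sub>R T (of_real (t + e - s)) (lag_coeff \<alpha> n x))"
  define a where "a = (\<lambda>n. lag_coeff_A \<alpha> n x)"
  define B where "B = 3 * (exp t * real (m + 1) powr (\<alpha> + 2)) * ((K + 1) * norm (T (of_real e) (a m)))"
  define L' where "L' = (\<lambda>n s. if n = 0 then 0 else - laguerre (n - 1) (\<alpha> + 1) s)"
  have L': "(laguerre n \<alpha> has_real_derivative L' n s) (at s)" for n s
  proof (cases n)
    case 0
    have "laguerre 0 \<alpha> = (\<lambda>_. 1)" by auto
    then show ?thesis using 0 by (simp add: L'_def)
  next
    case (Suc k)
    then show ?thesis using laguerre_has_real_derivative[of k \<alpha> s] by (simp add: L'_def)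
  qed
  have D: "(\<Psi> has_vector_derivative laguerre m (\<alpha> + 1) s *\<^sub>R T (of_real (t + e - s)) (a m)) (at s)"
    if s: "s \<le> t" for s
  proof -
    have p: "t + e - s > 0" using s e by simp
    have c: "((\<lambda>s. T (of_real (t + e - s)) (lag_coeff \<alpha> n x)) has_vector_derivative T (of_real (t + e - s)) (a n)) (at s)" for n
    proof -
      have "((\<lambda>s. t + e - s) has_vector_derivative - 1) (at s)" by (auto intro!: derivative_eq_intros)
      from vector_diff_chain_at[OF this lag_coeff_orbit_derivative[OF \<alpha> p, of n x]]
      show ?thesis by (simp add: o_def a_def)
    qed
    have "(\<Psi> has_vector_derivative (\<Sum>n=0..m. laguerre n \<alpha> s *\<^sub>R T (of_real (t + e - s)) (a n)
        + L' n s *\<^sub>R T (of_real (t + e - s)) (lag_coeff \<alpha> n x))) (at s)"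
      unfolding \<Psi>_def by (intro has_vector_derivative_sum has_vector_derivative_scaleR L' c)
    also have "(\<Sum>n=0..m. laguerre n \<alpha> s *\<^sub>R T (of_real (t + e - s)) (a n)
        + L' n s *\<^sub>R T (of_real (t + e - s)) (lag_coeff \<alpha> n x))
        = (\<Sum>n=0..m. L' n s *\<^sub>R T (of_real (t + e - s)) (lag_coeff \<alpha> n x)
          + laguerre n \<alpha> s *\<^sub>R T (of_real (t + e - s)) (a n))"
      by (simp add: add.commute)
    also have "\<dots> = (\<Sum>k=0..m. laguerre k \<alpha> s) *\<^sub>R T (of_real (t + e - s)) (a m)"
    proof (rule telescoping_sum)
      interpret bounded_linear "T (of_real (t + e - s))" using p by (intro T_bounded_linear) auto
      show "T (of_real (t + e - s)) (lag_coeff \<alpha> (Suc n) x) = T (of_real (t + e - s)) (a n) - T (of_real (t + e - s)) (a (Suc n))" for n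
        unfolding a_def lag_coeff_Suc[OF \<alpha>] by (rule diff)
    qed (auto simp: L'_def sum_laguerre)
    finally show ?thesis by (simp add: sum_laguerre)
  qed
  have "norm (\<Psi> t - \<Psi> 0) \<le> B * norm (t - 0)"
  proof (rule differentiable_bound[where S = "{0..t}"])
    fix s assume s: "s \<in> {0..t}"
    show "(\<Psi> has_derivative (\<lambda>h. h *\<^sub>R (laguerre m (\<alpha> + 1) s *\<^sub>R T (of_real (t + e - s)) (a m)))) (at s within {0..t})"
      using D[of s] s unfolding has_vector_derivative_def by (auto intro: has_derivative_at_withinI)
    \<comment> \<open>The constant K + 1 also covers s = t, where only T(e) is left; K >= 1 is not
      among the assumptions.\<close>
    have "norm (T (of_real (t + e - s)) (a m)) \<le> (K + 1) * norm (T (of_real e) (a m))"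
    proof (cases "s = t")
      case False
      then have "t - s > 0" using s by simp
      then have "T (of_real (t + e - s)) (a m) = T (of_real (t - s)) (T (of_real e) (a m))"
        using T_add[of "of_real (t - s)" "of_real e" "a m"] e by (simp add: algebra_simps)
      also have "norm \<dots> \<le> K * norm (T (of_real e) (a m))" by (rule T_real_bound) fact
      also have "\<dots> \<le> (K + 1) * norm (T (of_real e) (a m))" by (intro mult_right_mono) auto
      finally show ?thesis .
    qed (use K in \<open>simp add: algebra_simps\<close>)
    moreover have "\<bar>laguerre m (\<alpha> + 1) s\<bar> \<le> 3 * (exp t * real (m + 1) powr (\<alpha> + 2))"
    proof -
      have "\<bar>laguerre m (\<alpha> + 1) s\<bar> \<le> 3 * (exp s * real (m + 1) powr (\<alpha> + 1 + 1))"
        using \<alpha> s m by (intro laguerre_crude_bound) auto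
      also have "\<dots> \<le> 3 * (exp t * real (m + 1) powr (\<alpha> + 1 + 1))"
        using s by (intro mult_left_mono mult_right_mono) auto
      finally show ?thesis by (simp add: add.assoc)
    qed
    ultimately have "norm (laguerre m (\<alpha> + 1) s *\<^sub>R T (of_real (t + e - s)) (a m)) \<le> B"
      unfolding norm_scaleR B_def by (intro mult_mono) auto
    then show "onorm (\<lambda>h. h *\<^sub>R (laguerre m (\<alpha> + 1) s *\<^sub>R T (of_real (t + e - s)) (a m))) \<le> B"
      by (subst onorm_scaleR_left) (auto simp: bounded_linear_ident onorm_id)
  qed (use t in auto)
  moreover have "\<Psi> t = T (of_real e) (lag_sum \<alpha> m t x)" "\<Psi> 0 = T (of_real (t + e)) (lag_sum \<alpha> m 0 x)"
    unfolding \<Psi>_def lag_sum_def using e t by (simp_all add: T_sum_scaleR del: of_real_add)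
  ultimately show ?thesis using t by (simp add: B_def a_def)
qed

text \<open>The orbit derivative at s + e is of size (s+e)^(-m-1), so s^m leaves (s/(s+e))^m, which
  \<open>ratio_power_le\<close> converts; the growth s^k is later absorbed by e^(-s).\<close>

lemma U_shifted_bound:
  assumes "s \<ge> 0" "e > 0" "1 \<le> k" "k \<le> m"
  shows "norm (s ^ m *\<^sub>R U (Suc m) (of_real (s + e)) x)
    \<le> ub (Suc m) * norm x / e * (real k / (e * real m)) ^ k * s ^ k"
proof -
  have se: "s + e > 0" using assms by simp
  have ub0: "ub (Suc m) * norm x \<ge> 0" using ub_pos[of "Suc m"] by simp
  have "norm (s ^ m *\<^sub>R U (Suc m) (of_real (s + e)) x) = s ^ m * norm (U (Suc m) (of_real (s + e)) x)"
    using assms by (simp del: orbit_deriv.simps of_real_add)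
  also have "\<dots> \<le> s ^ m * (ub (Suc m) / (s + e) ^ Suc m * norm x)"
    using assms by (intro mult_left_mono U_bound[OF se]) auto
  also have "\<dots> = ub (Suc m) * norm x * (1 / (s + e)) * (s / (s + e)) ^ m"
    by (simp add: power_divide)
  also have "\<dots> \<le> ub (Suc m) * norm x * (1 / e) * (real k * s / (e * real m)) ^ k"
    using assms ub0 by (intro mult_mono ratio_power_le mult_left_mono divide_left_mono) auto
  also have "(real k * s / (e * real m)) ^ k = (real k / (e * real m)) ^ k * s ^ k"
    by (simp add: power_mult_distrib[symmetric])
  finally show ?thesis by (simp add: mult_ac)
qed

text \<open>The factor common to both errors of the smoothed expansion. As
  \<open>ub (Suc m) / fact m\<close> grows only like m^(N+1), it is O(m^(N+1-k)) with
  \<open>k\<close> still free.\<close>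

definition decay :: "nat \<Rightarrow> real \<Rightarrow> nat \<Rightarrow> real" where
  "decay k e m = ub (Suc m) / fact m / e * (real k / (e * real m)) ^ k"

lemma decay_bound:
  assumes "e > 0" "m \<ge> 1"
  shows "decay k e m \<le> (12 * K * 8 ^ N * (real k / e) ^ k / e) * real m ^ (N + 1) / real m ^ k"
proof -
  have m: "real m \<ge> 1" using assms by simp
  have "ub (Suc m) / fact m = real (Suc m) * (6 * K * (2 * (real (Suc m) + 2)) ^ N)"
    by (simp add: ub_def del: of_nat_Suc)
  also have "\<dots> \<le> (2 * real m) * (6 * K * (8 * real m) ^ N)"
  proof (rule mult_mono)
    have "2 * (real (Suc m) + 2) \<le> 8 * real m" using m by simp
    then show "6 * K * (2 * (real (Suc m) + 2)) ^ N \<le> 6 * K * (8 * real m) ^ N"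
      using K by (intro mult_left_mono power_mono) auto
  qed (use m K in auto)
  also have "\<dots> = 12 * K * 8 ^ N * real m ^ (N + 1)" by (simp add: power_mult_distrib)
  finally have "decay k e m \<le> (12 * K * 8 ^ N * real m ^ (N + 1)) / e * (real k / (e * real m)) ^ k"
    unfolding decay_def using assms by (intro mult_right_mono divide_right_mono) auto
  also have "real k / (e * real m) = (real k / e) / real m" by simp
  finally show ?thesis by (simp only: power_divide) (simp add: mult_ac)
qed

section \<open>Errors of the smoothed partial sums and passage to the limit\<close>

lemma T_lag_coeff_A_bound:
  assumes \<alpha>: "\<alpha> > 0" and e: "e > 0" and k: "1 \<le> k" "k \<le> m"
  shows "norm (T (of_real e) (lag_coeff_A \<alpha> m x))
    \<le> fact m / Gamma (real m + \<alpha> + 1) * (decay k e m * Gamma (\<alpha> + real k + 1) * norm x)"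
proof -
  have G: "Gamma (real m + \<alpha> + 1) > 0" using \<alpha> by (intro Gamma_real_pos) auto
  interpret bounded_linear "T (of_real e)" using e by (intro T_bounded_linear) auto
  have "J (real m + \<alpha>) (Suc m) e x = integral {0<..} (\<lambda>s. (s powr \<alpha> * exp (- s)) *\<^sub>R (s ^ m *\<^sub>R U (Suc m) (of_real (s + e)) x))"
    unfolding J_def by (rule Henstock_Kurzweil_Integration.integral_cong)
      (simp add: powr_add powr_realpow mult_ac del: orbit_deriv.simps of_real_add)
  also have "norm \<dots> \<le> (ub (Suc m) * norm x / e * (real k / (e * real m)) ^ k) * Gamma (\<alpha> + real k + 1)"
  proof (rule weighted_integrable(2))
    show "continuous_on {0<..} (\<lambda>s. s ^ m *\<^sub>R U (Suc m) (of_real (s + e)) x)"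
      using e by (intro continuous_intros U_shift_continuous) auto
    fix s :: real assume "s > 0"
    then show "norm (s ^ m *\<^sub>R U (Suc m) (of_real (s + e)) x)
        \<le> ub (Suc m) * norm x / e * (real k / (e * real m)) ^ k * s powr real k"
      using U_shifted_bound[OF _ e k, of s x] by (simp add: powr_realpow del: orbit_deriv.simps of_real_add)
  qed (use \<alpha> in auto)
  finally have Jb: "norm (J (real m + \<alpha>) (Suc m) e x) \<le> (ub (Suc m) * norm x / e * (real k / (e * real m)) ^ k) * Gamma (\<alpha> + real k + 1)" .
  have "norm (T (of_real e) (lag_coeff_A \<alpha> m x)) = norm (J (real m + \<alpha>) (Suc m) e x) / Gamma (real m + \<alpha> + 1)"
    unfolding lag_coeff_A_def scaleR using T_J[of "real m + \<alpha>" "Suc m" e x] e \<alpha> G by simp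
  also have "\<dots> \<le> (ub (Suc m) * norm x / e * (real k / (e * real m)) ^ k) * Gamma (\<alpha> + real k + 1) / Gamma (real m + \<alpha> + 1)"
    using Jb G by (intro divide_right_mono) auto
  also have "\<dots> = fact m / Gamma (real m + \<alpha> + 1) * (decay k e m * Gamma (\<alpha> + real k + 1) * norm x)"
    by (simp add: decay_def mult_ac)
  finally show ?thesis .
qed

text \<open>At \<open>s = 0\<close> the partial sums are weighted averages of the Taylor polynomials of \<open>r \<mapsto> T(r + e) x\<close>
  about \<open>s\<close>, evaluated at \<open>0\<close>.\<close>

lemma lag_sum_0_bound:
  assumes \<alpha>: "\<alpha> > 0" and e: "e > 0" and k: "1 \<le> k" "k \<le> m"
  shows "norm (T (of_real e) (lag_sum \<alpha> m 0 x) - T (of_real e) x)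
    \<le> decay k e m * Gamma (\<alpha> + real (Suc k) + 1) * norm x / Gamma (\<alpha> + 1)"
proof -
  define G where "G = (\<lambda>m s. \<Sum>n=0..m. (s ^ n / fact n) *\<^sub>R U n (of_real (s + e)) x)"
  have G1: "Gamma (\<alpha> + 1) > 0" using \<alpha> by (intro Gamma_real_pos) auto
  have dU: "((\<lambda>s. U n (of_real (s + e)) x) has_vector_derivative - U (Suc n) (of_real (s + e)) x) (at s)" if "s \<ge> 0" for n s
  proof -
    have "((\<lambda>s. s + e) has_vector_derivative 1) (at s)" by (auto intro!: derivative_eq_intros)
    from vector_diff_chain_at[OF this U_has_vector_derivative[of "s + e" n x]] that e
    show ?thesis by (simp add: o_def del: orbit_deriv.simps of_real_add)
  qed
  \<comment> \<open>As the expansion point of a Taylor polynomial moves, its derivative telescopes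
    to the last term; integrating from 0 gives the remainder and raises s^k to s^(k+1).\<close>
  have dG: "(G m has_vector_derivative - ((s ^ m / fact m) *\<^sub>R U (Suc m) (of_real (s + e)) x)) (at s)" if s: "s \<ge> 0" for m s
  proof (induction m)
    case 0
    show ?case using dU[OF s, of 0] by (simp add: G_def del: of_real_add orbit_deriv.simps(2))
  next
    case (Suc m)
    have p: "((\<lambda>s. s ^ Suc m / fact (Suc m)) has_real_derivative s ^ m / fact m) (at s)"
      by (auto intro!: derivative_eq_intros simp del: power_Suc)
    have "((\<lambda>s. G m s + (s ^ Suc m / fact (Suc m)) *\<^sub>R U (Suc m) (of_real (s + e)) x) has_vector_derivative
        - ((s ^ m / fact m) *\<^sub>R U (Suc m) (of_real (s + e)) x) +
        ((s ^ Suc m / fact (Suc m)) *\<^sub>R - U (Suc (Suc m)) (of_real (s + e)) x + (s ^ m / fact m) *\<^sub>R U (Suc m) (of_real (s + e)) x)) (at s)"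
      by (intro has_vector_derivative_add Suc.IH has_vector_derivative_scaleR p dU s)
    then show ?case by (simp add: G_def del: orbit_deriv.simps of_real_add power_Suc fact_Suc)
  qed
  define R where "R = (\<lambda>s. T (of_real e) x - G m s)"
  have Rb: "norm (R s) \<le> decay k e m * norm x * s powr real (Suc k)" if s: "s > 0" for s
  proof -
    define B where "B = decay k e m * norm x * s ^ k"
    have "norm (G m s - G m 0) \<le> B * norm (s - 0)"
    proof (rule differentiable_bound[where S = "{0..s}"])
      fix r assume r: "r \<in> {0..s}"
      show "(G m has_derivative (\<lambda>h. h *\<^sub>R - ((r ^ m / fact m) *\<^sub>R U (Suc m) (of_real (r + e)) x))) (at r within {0..s})"
        using dG[of r m] r unfolding has_vector_derivative_def by (auto intro: has_derivative_at_withinI)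
      have "norm (- ((r ^ m / fact m) *\<^sub>R U (Suc m) (of_real (r + e)) x)) = norm (r ^ m *\<^sub>R U (Suc m) (of_real (r + e)) x) / fact m"
        by (simp del: orbit_deriv.simps of_real_add)
      also have "\<dots> \<le> (ub (Suc m) * norm x / e * (real k / (e * real m)) ^ k * r ^ k) / fact m"
        using r by (intro divide_right_mono U_shifted_bound e k) auto
      also have "\<dots> = decay k e m * norm x * r ^ k" by (simp add: decay_def mult_ac)
      also have "\<dots> \<le> B"
        unfolding B_def decay_def using r ub_pos[of "Suc m"] e by (intro mult_left_mono power_mono) auto
      finally show "onorm (\<lambda>h. h *\<^sub>R - ((r ^ m / fact m) *\<^sub>R U (Suc m) (of_real (r + e)) x)) \<le> B"
        by (subst onorm_scaleR_left) (auto simp: bounded_linear_ident onorm_id simp del: orbit_deriv.simps of_real_add)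
    qed (use s in auto)
    moreover have "G m 0 = T (of_real e) x"
      unfolding G_def by (subst sum.remove[of _ 0]) (auto intro!: sum.neutral)
    ultimately have "norm (R s) \<le> B * s" using s by (simp add: R_def norm_minus_commute)
    then show ?thesis using s by (simp add: B_def powr_realpow mult_ac del: of_nat_Suc)
  qed
  have Rc: "continuous_on {0<..} R"
    unfolding R_def G_def using e by (intro continuous_intros U_shift_continuous) auto
  have summand: "laguerre n \<alpha> 0 *\<^sub>R T (of_real e) (lag_coeff \<alpha> n x) = (1 / Gamma (\<alpha> + 1)) *\<^sub>R
      integral {0<..} (\<lambda>s. (s powr \<alpha> * exp (- s)) *\<^sub>R ((s ^ n / fact n) *\<^sub>R U n (of_real (s + e)) x))"
    and summand_int: "(\<lambda>s. (s powr \<alpha> * exp (- s)) *\<^sub>R ((s ^ n / fact n) *\<^sub>R U n (of_real (s + e)) x)) integrable_on {0<..}" for n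
  proof -
    interpret bounded_linear "T (of_real e)" using e by (intro T_bounded_linear) auto
    have Gn: "Gamma (real n + \<alpha> + 1) > 0" using \<alpha> by (intro Gamma_real_pos) auto
    have pn: "real n + \<alpha> - real n > -1" using \<alpha> by simp
    have pw: "(s powr \<alpha> * exp (- s)) *\<^sub>R ((s ^ n / fact n) *\<^sub>R y) = (1 / fact n) *\<^sub>R ((s powr (real n + \<alpha>) * exp (- s)) *\<^sub>R y)"
      if "s > 0" for s :: real and y :: 'a
      using that by (simp add: powr_add powr_realpow mult_ac)
    have "(T (of_real e) \<circ> (\<lambda>s. (s powr (real n + \<alpha>) * exp (- s)) *\<^sub>R U n (of_real s) x)) integrable_on {0<..}"
      by (rule integrable_linear[OF J0_props(1)[OF pn] bounded_linear_axioms])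
    then have i: "(\<lambda>s. (s powr (real n + \<alpha>) * exp (- s)) *\<^sub>R U n (of_real (s + e)) x) integrable_on {0<..}"
      by (rule integrable_eq) (use U_add[of _ "of_real e" n x] e in \<open>auto simp: scaleR\<close>)
    have "(\<lambda>s. (1 / fact n) *\<^sub>R ((s powr (real n + \<alpha>) * exp (- s)) *\<^sub>R U n (of_real (s + e)) x)) integrable_on {0<..}"
      by (rule integrable_cmul[OF i])
    then show "(\<lambda>s. (s powr \<alpha> * exp (- s)) *\<^sub>R ((s ^ n / fact n) *\<^sub>R U n (of_real (s + e)) x)) integrable_on {0<..}"
      by (rule integrable_eq) (rule pw[symmetric], simp)
    have "integral {0<..} (\<lambda>s. (s powr \<alpha> * exp (- s)) *\<^sub>R ((s ^ n / fact n) *\<^sub>R U n (of_real (s + e)) x))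
        = integral {0<..} (\<lambda>s. (1 / fact n) *\<^sub>R ((s powr (real n + \<alpha>) * exp (- s)) *\<^sub>R U n (of_real (s + e)) x))"
      by (rule Henstock_Kurzweil_Integration.integral_cong) (rule pw, simp)
    also have "\<dots> = (1 / fact n) *\<^sub>R J (real n + \<alpha>) n e x"
      unfolding J_def by (rule Henstock_Kurzweil_Integration.integral_cmul)
    finally have I: "integral {0<..} (\<lambda>s. (s powr \<alpha> * exp (- s)) *\<^sub>R ((s ^ n / fact n) *\<^sub>R U n (of_real (s + e)) x))
      = (1 / fact n) *\<^sub>R J (real n + \<alpha>) n e x" .
    have "laguerre n \<alpha> 0 *\<^sub>R T (of_real e) (lag_coeff \<alpha> n x)
      = (laguerre n \<alpha> 0 * (1 / Gamma (real n + \<alpha> + 1))) *\<^sub>R J (real n + \<alpha>) n e x"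
      unfolding lag_coeff_def scaleR T_J[OF pn e] by simp
    \<comment> \<open>This cancellation gives all summands the same weight s^\<alpha> e^(-s), with
      total mass Gamma(\<alpha>+1).\<close>
    also have "laguerre n \<alpha> 0 * (1 / Gamma (real n + \<alpha> + 1)) = 1 / Gamma (\<alpha> + 1) * (1 / fact n)"
      using laguerre_at_0[of \<alpha> n] \<alpha> less_imp_neq[OF Gn, symmetric] by (simp add: mult_ac)
    finally show "laguerre n \<alpha> 0 *\<^sub>R T (of_real e) (lag_coeff \<alpha> n x) = (1 / Gamma (\<alpha> + 1)) *\<^sub>R
      integral {0<..} (\<lambda>s. (s powr \<alpha> * exp (- s)) *\<^sub>R ((s ^ n / fact n) *\<^sub>R U n (of_real (s + e)) x))"
      unfolding I by simp
  qed
  have hG: "((\<lambda>s. (s powr \<alpha> * exp (- s)) *\<^sub>R G m s) has_integral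
      Gamma (\<alpha> + 1) *\<^sub>R T (of_real e) (lag_sum \<alpha> m 0 x)) {0<..}"
  proof -
    have "((\<lambda>s. \<Sum>n=0..m. (s powr \<alpha> * exp (- s)) *\<^sub>R ((s ^ n / fact n) *\<^sub>R U n (of_real (s + e)) x)) has_integral
      (\<Sum>n=0..m. integral {0<..} (\<lambda>s. (s powr \<alpha> * exp (- s)) *\<^sub>R ((s ^ n / fact n) *\<^sub>R U n (of_real (s + e)) x)))) {0<..}"
      by (intro has_integral_sum integrable_integral summand_int) auto
    also have "(\<lambda>s. \<Sum>n=0..m. (s powr \<alpha> * exp (- s)) *\<^sub>R ((s ^ n / fact n) *\<^sub>R U n (of_real (s + e)) x))
        = (\<lambda>s. (s powr \<alpha> * exp (- s)) *\<^sub>R G m s)"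
      unfolding G_def scaleR_sum_right ..
    also have "(\<Sum>n=0..m. integral {0<..} (\<lambda>s. (s powr \<alpha> * exp (- s)) *\<^sub>R ((s ^ n / fact n) *\<^sub>R U n (of_real (s + e)) x)))
        = Gamma (\<alpha> + 1) *\<^sub>R T (of_real e) (lag_sum \<alpha> m 0 x)"
      unfolding lag_sum_def T_sum_scaleR[OF e] scaleR_sum_right summand using G1
      by (intro sum.cong) auto
    finally show ?thesis .
  qed
  have hT: "((\<lambda>s. (s powr \<alpha> * exp (- s)) *\<^sub>R T (of_real e) x) has_integral Gamma (\<alpha> + 1) *\<^sub>R T (of_real e) x) {0<..}"
    using has_integral_linear[OF has_integral_Gamma_halfline[of "\<alpha> + 1"] bounded_linear_scaleR_left] \<alpha>
    by (simp add: o_def)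
  have "((\<lambda>s. (s powr \<alpha> * exp (- s)) *\<^sub>R R s) has_integral
      Gamma (\<alpha> + 1) *\<^sub>R T (of_real e) x - Gamma (\<alpha> + 1) *\<^sub>R T (of_real e) (lag_sum \<alpha> m 0 x)) {0<..}"
    unfolding R_def scaleR_diff_right by (rule has_integral_diff[OF hT hG])
  then have "integral {0<..} (\<lambda>s. (s powr \<alpha> * exp (- s)) *\<^sub>R R s)
      = Gamma (\<alpha> + 1) *\<^sub>R (T (of_real e) x - T (of_real e) (lag_sum \<alpha> m 0 x))"
    by (simp add: integral_unique scaleR_diff_right)
  moreover have "norm (integral {0<..} (\<lambda>s. (s powr \<alpha> * exp (- s)) *\<^sub>R R s)) \<le> decay k e m * norm x * Gamma (\<alpha> + real (Suc k) + 1)"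
    by (rule weighted_integrable(2)[OF Rc Rb]) (use \<alpha> in auto)
  ultimately have "Gamma (\<alpha> + 1) * norm (T (of_real e) (lag_sum \<alpha> m 0 x) - T (of_real e) x)
      \<le> decay k e m * norm x * Gamma (\<alpha> + real (Suc k) + 1)"
    using G1 by (simp add: norm_minus_commute)
  then show ?thesis using G1 by (simp add: pos_le_divide_eq mult_ac)
qed

lemma smoothed_lag_sum_LIMSEQ:
  assumes \<alpha>: "\<alpha> > 0" and t: "t > 0" and e: "e > 0"
  shows "(\<lambda>m. T (of_real e) (lag_sum \<alpha> m t x)) \<longlonglongrightarrow> T (of_real e) (T (of_real t) x)"
proof -
  obtain C2 where C2: "C2 > 0" "\<And>n. n \<ge> 1 \<Longrightarrow> fact (n - 1) / Gamma (real n + \<alpha> + 1) \<le> C2 / real n powr (\<alpha> + 1)"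
    using Gamma_ratio_bound[of \<alpha>] \<alpha> by auto
  \<comment> \<open>The flow error carries the power \<alpha>+2 from the Laguerre factor, 1 from the
    factorial quotient and N+1-k from \<open>decay\<close>; their sum is at most -1 once k >=
    N+\<alpha>+5.\<close>
  define k where "k = N + nat \<lceil>\<alpha>\<rceil> + 5"
  have k1: "1 \<le> k" by (simp add: k_def)
  have k\<alpha>: "real k \<ge> real N + \<alpha> + 5" unfolding k_def using real_nat_ceiling_ge[of \<alpha>] by simp
  define P where "P = (\<lambda>e. 12 * K * 8 ^ N * (real k / e) ^ k / e)"
  define A1 where "A1 = 3 * exp t * 2 powr (\<alpha> + 2) * (K + 1) * t * C2 * P e * Gamma (\<alpha> + real k + 1) * norm x"
  define A2 where "A2 = P (t + e) * Gamma (\<alpha> + real (Suc k) + 1) * norm x / Gamma (\<alpha> + 1)"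
  have G: "Gamma (\<alpha> + 1) > 0" "Gamma (\<alpha> + real k + 1) > 0" "Gamma (\<alpha> + real (Suc k) + 1) > 0"
    using \<alpha> by (auto intro!: Gamma_real_pos)
  have te: "t + e > 0" using t e by simp
  have P0: "P e \<ge> 0" "P (t + e) \<ge> 0" using K e te by (auto simp: P_def)
  have est: "norm (T (of_real e) (lag_sum \<alpha> m t x) - T (of_real e) (T (of_real t) x)) \<le> (A1 + A2) / real m" if m: "m \<ge> k" for m
  proof -
    have m1: "m \<ge> 1" using m k1 by simp
    then have rm: "real m \<ge> 1" by simp
    have pw: "real m ^ k = real m powr real k" "real m ^ (N + 1) = real m powr (real N + 1)"
      using rm powr_realpow[of "real m" k] powr_realpow[of "real m" "N + 1"] by (auto simp: add.commute)
    have d: "decay k e' m \<le> P e' * real m powr (real N + 1 - real k)" if "e' > 0" for e'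
      using decay_bound[OF that m1, of k] rm unfolding pw P_def powr_diff by simp
    have 1: "norm (T (of_real e) (lag_sum \<alpha> m t x) - T (of_real (t + e)) (lag_sum \<alpha> m 0 x)) \<le> A1 / real m"
    proof -
      have f: "fact m / Gamma (real m + \<alpha> + 1) \<le> real m * C2"
      proof -
        have "fact m / Gamma (real m + \<alpha> + 1) = real m * (fact (m - 1) / Gamma (real m + \<alpha> + 1))"
          using fact_reduce[of m, where ?'a = real] m1 by simp
        also have "\<dots> \<le> real m * (C2 / real m powr (\<alpha> + 1))"
          using C2(2)[OF m1] by (intro mult_left_mono) auto
        also have "\<dots> \<le> real m * C2"
          using rm \<alpha> C2 by (intro mult_left_mono) (auto simp: divide_le_eq ge_one_powr_ge_zero)
        finally show ?thesis .
      qed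
      have "norm (T (of_real e) (lag_coeff_A \<alpha> m x))
        \<le> fact m / Gamma (real m + \<alpha> + 1) * (decay k e m * Gamma (\<alpha> + real k + 1) * norm x)"
        by (rule T_lag_coeff_A_bound[OF \<alpha> e k1 m])
      also have "\<dots> \<le> (real m * C2) * ((P e * real m powr (real N + 1 - real k)) * Gamma (\<alpha> + real k + 1) * norm x)"
      proof (rule mult_mono[OF f])
        show "decay k e m * Gamma (\<alpha> + real k + 1) * norm x \<le> P e * real m powr (real N + 1 - real k) * Gamma (\<alpha> + real k + 1) * norm x"
          using d[OF e] G by (intro mult_right_mono) auto
        show "0 \<le> decay k e m * Gamma (\<alpha> + real k + 1) * norm x"
          using ub_pos[of "Suc m"] e G by (simp add: decay_def)
      qed (use C2 in auto)
      finally have aM: "norm (T (of_real e) (lag_coeff_A \<alpha> m x)) \<le> (real m * C2) * ((P e * real m powr (real N + 1 - real k)) * Gamma (\<alpha> + real k + 1) * norm x)" .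
      have "real (m + 1) powr (\<alpha> + 2) \<le> (2 * real m) powr (\<alpha> + 2)"
        using rm \<alpha> by (intro powr_mono2) auto
      also have "\<dots> = 2 powr (\<alpha> + 2) * real m powr (\<alpha> + 2)" by (simp add: powr_mult)
      finally have mp: "real (m + 1) powr (\<alpha> + 2) \<le> 2 powr (\<alpha> + 2) * real m powr (\<alpha> + 2)" .
      have "norm (T (of_real e) (lag_sum \<alpha> m t x) - T (of_real (t + e)) (lag_sum \<alpha> m 0 x))
        \<le> 3 * (exp t * real (m + 1) powr (\<alpha> + 2)) * ((K + 1) * norm (T (of_real e) (lag_coeff_A \<alpha> m x))) * t"
        by (rule lag_sum_flow[OF \<alpha> t e m1])
      also have "\<dots> \<le> 3 * (exp t * (2 powr (\<alpha> + 2) * real m powr (\<alpha> + 2))) * ((K + 1) *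
          ((real m * C2) * ((P e * real m powr (real N + 1 - real k)) * Gamma (\<alpha> + real k + 1) * norm x))) * t"
        using t K by (intro mult_right_mono mult_mono mult_left_mono mp aM) auto
      also have "\<dots> = A1 * (real m powr (\<alpha> + 2) * real m * real m powr (real N + 1 - real k))"
        by (simp add: A1_def)
      also have "real m powr (\<alpha> + 2) * real m * real m powr (real N + 1 - real k) = real m powr (\<alpha> + real N + 4 - real k)"
        using rm powr_add[of "real m" "\<alpha> + 2" 1] powr_add[of "real m" "\<alpha> + 2 + 1" "real N + 1 - real k"]
        by (simp add: algebra_simps)
      also have "A1 * real m powr (\<alpha> + real N + 4 - real k) \<le> A1 * real m powr - 1"
      proof (rule mult_left_mono)
        show "real m powr (\<alpha> + real N + 4 - real k) \<le> real m powr - 1"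
          using k\<alpha> rm by (intro powr_mono) auto
        show "0 \<le> A1" unfolding A1_def using t K C2 P0 G by simp
      qed
      also have "\<dots> = A1 / real m" using rm by (simp add: powr_minus divide_inverse)
      finally show ?thesis .
    qed
    have 2: "norm (T (of_real (t + e)) (lag_sum \<alpha> m 0 x) - T (of_real (t + e)) x) \<le> A2 / real m"
    proof -
      have "norm (T (of_real (t + e)) (lag_sum \<alpha> m 0 x) - T (of_real (t + e)) x)
        \<le> decay k (t + e) m * Gamma (\<alpha> + real (Suc k) + 1) * norm x / Gamma (\<alpha> + 1)"
        by (rule lag_sum_0_bound[OF \<alpha> te k1 m])
      also have "\<dots> \<le> (P (t + e) * real m powr (real N + 1 - real k)) * Gamma (\<alpha> + real (Suc k) + 1) * norm x / Gamma (\<alpha> + 1)"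
        using d[OF te] G by (intro divide_right_mono mult_right_mono) auto
      also have "\<dots> = A2 * real m powr (real N + 1 - real k)" by (simp add: A2_def)
      also have "\<dots> \<le> A2 * real m powr - 1"
      proof (rule mult_left_mono)
        show "real m powr (real N + 1 - real k) \<le> real m powr - 1"
          using k\<alpha> rm \<alpha> by (intro powr_mono) auto
        show "0 \<le> A2" unfolding A2_def using P0 G by simp
      qed
      also have "\<dots> = A2 / real m" using rm by (simp add: powr_minus divide_inverse)
      finally show ?thesis .
    qed
    have "T (of_real (t + e)) x = T (of_real e) (T (of_real t) x)"
      using T_add[of "of_real e" "of_real t" x] t e by (simp add: add.commute)
    then show ?thesis using norm_triangle_le[OF add_mono[OF 1 2]] by (simp add: add_divide_distrib)
  qed
  have "(\<lambda>m. (A1 + A2) / real m) \<longlonglongrightarrow> 0" by real_asymp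
  then have "(\<lambda>m. T (of_real e) (lag_sum \<alpha> m t x) - T (of_real e) (T (of_real t) x)) \<longlonglongrightarrow> 0"
    by (rule Lim_null_comparison[rotated]) (use est in \<open>auto simp: eventually_sequentially\<close>)
  then show ?thesis by (rule LIM_zero_cancel)
qed

text \<open>The tail is summed with exponent \<alpha>/2 - (\<alpha>+1) = -\<alpha>/2 - 1. The sum is
  identified only after T(e), so the tail bound is applied under T(e) at the cost of a factor
  \<open>K\<close>, first \<open>M\<close> tends to infinity, and then \<open>e\<close> tends to
  0.\<close>

lemma lag_sum_error_bound:
  assumes \<alpha>: "\<alpha> > 0" and t: "t > 0"
  shows "\<exists>C>0. \<forall>m\<ge>1. \<forall>x. norm (T (of_real t) x - lag_sum \<alpha> m t x) \<le> C / real m powr (\<alpha> / 2) * norm x"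
proof -
  obtain Cl where Cl: "Cl > 0" "\<And>n. n \<ge> 1 \<Longrightarrow> \<bar>laguerre n \<alpha> t\<bar> \<le> Cl * real n powr (\<alpha> / 2)"
    using laguerre_bound[OF \<alpha> t] by blast
  obtain Cc where Cc: "Cc > 0" "\<And>n x. n \<ge> 1 \<Longrightarrow> norm (lag_coeff \<alpha> n x) \<le> Cc * norm x / real n powr (\<alpha> + 1)"
    using lag_coeff_bound[of \<alpha>] \<alpha> by auto
  define C where "C = Cl * Cc * (2 / \<alpha>)"
  have C: "C > 0" using Cl Cc \<alpha> by (simp add: C_def)
  have tail: "norm (lag_sum \<alpha> M t x - lag_sum \<alpha> m t x) \<le> C / real m powr (\<alpha> / 2) * norm x"
    if m: "m \<ge> 1" and M: "m \<le> M" for m M x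
  proof -
    have "lag_sum \<alpha> M t x = lag_sum \<alpha> m t x + (\<Sum>n=Suc m..M. laguerre n \<alpha> t *\<^sub>R lag_coeff \<alpha> n x)"
      unfolding lag_sum_def using M sum.ub_add_nat[of 0 m "\<lambda>n. laguerre n \<alpha> t *\<^sub>R lag_coeff \<alpha> n x" "M - m"] by simp
    then have "norm (lag_sum \<alpha> M t x - lag_sum \<alpha> m t x) \<le> (\<Sum>n=Suc m..M. norm (laguerre n \<alpha> t *\<^sub>R lag_coeff \<alpha> n x))"
      by (simp add: sum_norm_le)
    also have "\<dots> \<le> (\<Sum>n=Suc m..M. Cl * Cc * norm x * real n powr (- (\<alpha> / 2) - 1))"
    proof (rule sum_mono)
      fix n assume "n \<in> {Suc m..M}"
      then have n: "n \<ge> 1" by simp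
      have "norm (laguerre n \<alpha> t *\<^sub>R lag_coeff \<alpha> n x) \<le> (Cl * real n powr (\<alpha> / 2)) * (Cc * norm x / real n powr (\<alpha> + 1))"
        unfolding norm_scaleR using Cl Cc n by (intro mult_mono) auto
      also have "\<dots> = Cl * Cc * norm x * (real n powr (\<alpha> / 2) / real n powr (\<alpha> + 1))" by simp
      also have "real n powr (\<alpha> / 2) / real n powr (\<alpha> + 1) = real n powr (- (\<alpha> / 2) - 1)"
      proof -
        have "\<alpha> / 2 - (\<alpha> + 1) = - (\<alpha> / 2) - 1" by simp
        then show ?thesis using powr_diff[of "real n" "\<alpha> / 2" "\<alpha> + 1"] by simp
      qed
      finally show "norm (laguerre n \<alpha> t *\<^sub>R lag_coeff \<alpha> n x) \<le> Cl * Cc * norm x * real n powr (- (\<alpha> / 2) - 1)" .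
    qed
    also have "\<dots> = Cl * Cc * norm x * (\<Sum>n=Suc m..M. real n powr (- (\<alpha> / 2) - 1))"
      by (simp add: sum_distrib_left)
    also have "\<dots> \<le> Cl * Cc * norm x * ((real m powr - (\<alpha> / 2) - real M powr - (\<alpha> / 2)) / (\<alpha> / 2))"
      using Cl Cc \<alpha> m M by (intro mult_left_mono sum_powr_tail_le) auto
    also have "\<dots> \<le> Cl * Cc * norm x * (real m powr - (\<alpha> / 2) / (\<alpha> / 2))"
      using Cl Cc \<alpha> by (intro mult_left_mono divide_right_mono) auto
    also have "\<dots> = C / real m powr (\<alpha> / 2) * norm x"
      by (simp add: C_def powr_minus_divide mult_ac)
    finally show ?thesis .
  qed
  show ?thesis
  proof (intro exI[of _ "K * C"] conjI allI impI)
    show "0 < K * C" using K C by simp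
    fix m :: nat and x assume m: "m \<ge> 1"
    define y where "y = T (of_real t) x - lag_sum \<alpha> m t x"
    define B where "B = K * C / real m powr (\<alpha> / 2) * norm x"
    have "norm (T (of_real e) y) \<le> B" if e: "e > 0" for e
    proof -
      interpret bounded_linear "T (of_real e)" using e by (intro T_bounded_linear) auto
      have "(\<lambda>M. norm (T (of_real e) (lag_sum \<alpha> M t x) - T (of_real e) (lag_sum \<alpha> m t x)))
          \<longlonglongrightarrow> norm (T (of_real e) (T (of_real t) x) - T (of_real e) (lag_sum \<alpha> m t x))"
        by (intro tendsto_intros smoothed_lag_sum_LIMSEQ \<alpha> t e)
      moreover have "norm (T (of_real e) (lag_sum \<alpha> M t x) - T (of_real e) (lag_sum \<alpha> m t x)) \<le> B" if "M \<ge> m" for M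
      proof -
        have "norm (T (of_real e) (lag_sum \<alpha> M t x - lag_sum \<alpha> m t x)) \<le> K * norm (lag_sum \<alpha> M t x - lag_sum \<alpha> m t x)"
          by (rule T_real_bound[OF e])
        also have "\<dots> \<le> K * (C / real m powr (\<alpha> / 2) * norm x)"
          using tail[OF m that] K by (intro mult_left_mono) auto
        finally show ?thesis by (simp add: diff B_def)
      qed
      ultimately have "norm (T (of_real e) (T (of_real t) x) - T (of_real e) (lag_sum \<alpha> m t x)) \<le> B"
        by (intro LIMSEQ_le_const2) auto
      then show ?thesis by (simp add: y_def diff)
    qed
    \<comment> \<open>The bound does not depend on \<open>e\<close>, so strong continuity at 0
      transfers it to \<open>y\<close> itself.\<close>
    then have "eventually (\<lambda>e. norm (T (of_real e) y) \<le> B) (at_right 0)"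
      by (intro eventually_at_rightI[of 0 1]) auto
    then show "norm (T (of_real t) x - lag_sum \<alpha> m t x) \<le> K * C / real m powr (\<alpha> / 2) * norm x"
      unfolding y_def[symmetric] B_def[symmetric]
      by (rule tendsto_upperbound[OF tendsto_norm[OF C0[of y]]]) simp
  qed
qed

end

text \<open>Applies the type condition with \<nu> = \<beta>+1 and rounds the exponent up to a
  natural number, which is legitimate because |z| / Re z >= 1.\<close>

lemma hg_semigroup_of_HG_type:
  assumes "complex_scaling sc" "holomorphic_semigroup sc T"
    and "\<And>x. ((\<lambda>t. T (complex_of_real t) x) \<longlongrightarrow> x) (at_right 0)"
    and HG: "HG_type T \<beta>" and \<beta>: "\<beta> \<ge> 0"
  shows "\<exists>K N. hg_semigroup sc T K N"
proof -
  obtain C where C: "C > 0" "\<And>z x. Re z > 0 \<Longrightarrow> norm (T z x) \<le> C * (cmod z / Re z) powr (\<beta> + 1) * norm x"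
  proof -
    have "\<exists>C>0. \<forall>z x. Re z > 0 \<longrightarrow> norm (T z x) \<le> C * (cmod z / Re z) powr (\<beta> + 1) * norm x"
      using HG unfolding HG_type_def by (rule allE[of _ "\<beta> + 1"]) simp
    then show thesis using that by blast
  qed
  define N where "N = nat \<lceil>\<beta> + 1\<rceil>"
  have "norm (T z x) \<le> C * (cmod z / Re z) ^ N * norm x" if z: "Re z > 0" for z x
  proof -
    have q: "cmod z / Re z \<ge> 1" using z complex_Re_le_cmod[of z] by simp
    have "(cmod z / Re z) powr (\<beta> + 1) \<le> (cmod z / Re z) powr real N"
      unfolding N_def by (rule powr_mono[OF real_nat_ceiling_ge q])
    also have "\<dots> = (cmod z / Re z) ^ N" using q by (intro powr_realpow) linarith
    finally have "C * (cmod z / Re z) powr (\<beta> + 1) * norm x \<le> C * (cmod z / Re z) ^ N * norm x"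
      using C by (intro mult_right_mono mult_left_mono) auto
    then show ?thesis using C(2)[OF z, of x] by linarith
  qed
  then show ?thesis using assms(1-3) C(1) by (intro exI[of _ C] exI[of _ N] hg_semigroup.intro)
qed

theorem theorem5p2:
  fixes T :: "complex \<Rightarrow> 'a::banach \<Rightarrow> 'a"
    and sc :: "complex \<Rightarrow> 'a \<Rightarrow> 'a"
    and \<beta> :: real
  assumes sc: "complex_scaling sc"
    and hol: "holomorphic_semigroup sc T"
    and T0: "T 0 = id"
    and C0: "\<And>x. ((\<lambda>t. T (complex_of_real t) x) \<longlongrightarrow> x) (at_right 0)"
    and bdd: "\<exists>M. \<forall>t::real. \<forall>x. t > 0 \<longrightarrow> norm (T (complex_of_real t) x) \<le> M * norm x"
    and HG: "HG_type T \<beta>"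
    and \<beta>: "\<beta> \<ge> 0"
  shows "(\<forall>\<alpha>>-1. \<exists>C>0. \<forall>n::nat. \<forall>x. n \<ge> 1 \<longrightarrow>
            gen_dom_pow T n (frac_res T (real n + \<alpha> + 1) x) \<and>
            norm ((genA T ^^ n) (frac_res T (real n + \<alpha> + 1) x))
              \<le> C * norm x / real n powr (\<alpha> + 1))
       \<and> (\<forall>\<alpha>>0. \<forall>t>0. \<exists>C>0. \<forall>m::nat. \<forall>x. m \<ge> 1 \<longrightarrow>
            norm (T (complex_of_real t) x
                  - (\<Sum>n=0..m. laguerre n \<alpha> t *\<^sub>R (genA T ^^ n) (frac_res T (real n + \<alpha> + 1) x)))
              \<le> C / real m powr (\<alpha> / 2) * norm x)"
proof -
  obtain K N where "hg_semigroup sc T K N"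
    using hg_semigroup_of_HG_type[OF sc hol C0 HG \<beta>] by blast
  then interpret hg_semigroup sc T K N .
  show ?thesis
  proof (intro conjI allI impI)
    fix \<alpha> :: real assume \<alpha>: "\<alpha> > -1"
    from lag_coeff_bound[OF \<alpha>]
    show "\<exists>C>0. \<forall>n::nat. \<forall>x. n \<ge> 1 \<longrightarrow>
            gen_dom_pow T n (frac_res T (real n + \<alpha> + 1) x) \<and>
            norm ((genA T ^^ n) (frac_res T (real n + \<alpha> + 1) x))
              \<le> C * norm x / real n powr (\<alpha> + 1)"
      unfolding genA_power_frac_res_eq[OF \<alpha>] using gen_dom_pow_frac_res[OF \<alpha>] by blast
  next
    fix \<alpha> t :: real assume \<alpha>: "\<alpha> > 0" and t: "t > 0"
    have eq: "(genA T ^^ n) (frac_res T (real n + \<alpha> + 1) x) = lag_coeff \<alpha> n x" for n x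
      using \<alpha> by (intro genA_power_frac_res_eq) simp
    from lag_sum_error_bound[OF \<alpha> t]
    show "\<exists>C>0. \<forall>m::nat. \<forall>x. m \<ge> 1 \<longrightarrow>
            norm (T (complex_of_real t) x
                  - (\<Sum>n=0..m. laguerre n \<alpha> t *\<^sub>R (genA T ^^ n) (frac_res T (real n + \<alpha> + 1) x)))
              \<le> C / real m powr (\<alpha> / 2) * norm x"
      unfolding eq lag_sum_def by blast
  qed
qed

end
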